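(* For all integers $k\ge1$ and $N_1,N_2,\ldots,N_k\ge2$, with $\mathbf N=(N_1,\ldots,N_k)$, the following assertions hold: (i) The radius of convergence of the Taylor series of $\mathbf q_{\mathbf N}(z)$ at $0$ is equal to $1/C_{\mathbf N}$, and the Taylor series converges for any $z$ such that $|z|=1/C_{\mathbf N}$. (ii) The function $\mathbf q_{\mathbf N}(z)$ has a singularity at $z=1/C_{\mathbf N}$. (iii) For any $z$ such that $|z|\le 1/C_{\mathbf N}$, we have $|\mathbf q_{\mathbf N}(z)|\le1$. (iv) If $\Phi_{\mathbf N}=1$ (that is, $\mathbf N=(2)$), then for $m\ge1$ the $m$-th Taylor coefficient of $\mathbf q_{(2)}(z)$ is equal to the $m$-th Catalan number $\frac1{m+1}\binom{2m}{m}$, and hence, as $m\to\infty$, it is equal to $\frac{4^m}{\sqrt\pi\,m^{3/2}}(1+o(1))$. (v) If $\Phi_{\mathbf N}=2$, then there is a non-zero constant $\kappa$ (depending on $\mathbf N$) such that, as $m\to\infty$, the $m$-th Taylor coefficient of $\mathbf q_{\mathbf N}(z)$ is equal to $\kappa\,\frac{C_{\mathbf N}^m}{m\log^2(m)}(1+o(1))$. (vi) If $\Phi_{\mathbf N}\ge3$, then there is a non-zero constant $\kappa$ (depending on $\mathbf N$) such that, as $m\to\infty$, the $m$-th Taylor coefficient of $\mathbf q_{\mathbf N}(z)$ is equal to $\kappa\,\frac{C_{\mathbf N}^m}{m^{\Phi_{\mathbf N}/2}}(1+o(1))$.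
   Context: For an integer $N\ge 2$ let $r_1,\ldots,r_{\varphi(N)}$ be the integers in $\{1,\ldots,N\}$ coprime to $N$ ($\varphi$ is Euler's totient), and put $C_N:=N^{\varphi(N)}\prod_{p\mid N}p^{\varphi(N)/(p-1)}$ (product over primes $p$ dividing $N$). With $(\alpha)_m=\alpha(\alpha+1)\cdots(\alpha+m-1)$, $(\alpha)_0=1$, and $H(x,m)=\sum_{n=0}^{m-1}\frac1{x+n}$, define for $m\ge0$ $$\mathbf B_N(m)=C_N^m\prod_{j=1}^{\varphi(N)}\frac{(r_j/N)_m}{m!},\qquad \mathbf H_N(m)=\sum_{j=1}^{\varphi(N)}H(r_j/N,m)-\varphi(N)H(1,m).$$ For $\mathbf N=(N_1,\ldots,N_k)$ put $C_{\mathbf N}=\prod_{j=1}^kC_{N_j}$, $\Phi_{\mathbf N}=\sum_{j=1}^k\varphi(N_j)$, $\mathbf B_{\mathbf N}(m)=\prod_{j=1}^k\mathbf B_{N_j}(m)$, $\mathbf H_{\mathbf N}(m)=\sum_{j=1}^k\mathbf H_{N_j}(m)$, and $$\mathbf F_{\mathbf N}(z)=\sum_{m\ge0}\mathbf B_{\mathbf N}(m)z^m,\qquad \mathbf G_{\mathbf N}(z)=\sum_{m\ge1}\mathbf H_{\mathbf N}(m)\mathbf B_{\mathbf N}(m)z^m.$$ The canonical coordinate is $\mathbf q_{\mathbf N}(z)=z\exp\big(\mathbf G_{\mathbf N}(z)/\mathbf F_{\mathbf N}(z)\big)$. On $|z|\le1/C_{\mathbf N}$, the value $\mathbf q_{\mathbf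 N}(z)$ is the sum of its Taylor series at $0$. *)

theory Defs
  imports "HOL-Complex_Analysis.Complex_Analysis" "HOL-Number_Theory.Totient"
begin

text \<open>The exponents are exact: \<open>p - 1\<close> divides \<open>totient N\<close> for every prime \<open>p\<close> dividing \<open>N\<close>.\<close>
definition C1 :: "nat \<Rightarrow> real" where
  "C1 N = real N ^ totient N * (\<Prod>p\<in>prime_factors N. real p ^ (totient N div (p - 1)))"

definition H_sum :: "real \<Rightarrow> nat \<Rightarrow> real" where
  "H_sum x m = (\<Sum>n<m. 1 / (x + real n))"

definition B1 :: "nat \<Rightarrow> nat \<Rightarrow> real" where
  "B1 N m = C1 N ^ m * (\<Prod>r\<in>totatives N. pochhammer (real r / real N) m / fact m)"

definition H1 :: "nat \<Rightarrow> nat \<Rightarrow> real" where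
  "H1 N m = (\<Sum>r\<in>totatives N. H_sum (real r / real N) m) - real (totient N) * H_sum 1 m"

text \<open>A tuple \<open>(N\<^sub>1, \<dots>, N\<^sub>k)\<close> is represented by the list of its entries.\<close>
definition C_tup :: "nat list \<Rightarrow> real" where
  "C_tup Ns = (\<Prod>N\<leftarrow>Ns. C1 N)"

definition Phi_tup :: "nat list \<Rightarrow> nat" where
  "Phi_tup Ns = (\<Sum>N\<leftarrow>Ns. totient N)"

definition B_tup :: "nat list \<Rightarrow> nat \<Rightarrow> real" where
  "B_tup Ns m = (\<Prod>N\<leftarrow>Ns. B1 N m)"

definition H_tup :: "nat list \<Rightarrow> nat \<Rightarrow> real" where
  "H_tup Ns m = (\<Sum>N\<leftarrow>Ns. H1 N m)"

definition F_tup :: "nat list \<Rightarrow> complex \<Rightarrow> complex" where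
  "F_tup Ns z = (\<Sum>m. of_real (B_tup Ns m) * z ^ m)"

definition G_tup :: "nat list \<Rightarrow> complex \<Rightarrow> complex" where
  "G_tup Ns z = (\<Sum>m. of_real (H_tup Ns (Suc m) * B_tup Ns (Suc m)) * z ^ Suc m)"

text \<open>
  The canonical coordinate is first given by its defining formula; only the germ of
  \<open>q_germ Ns\<close> at 0 is ever used (the sums above are meaningless outside the disc of
  convergence). Its Taylor series at 0 is \<open>q_taylor Ns\<close>, and the value of the canonical coordinate
  on the closed disc of radius \<open>1 / C_tup Ns\<close> is the sum \<open>q_val Ns\<close> of that Taylor series.
\<close>
definition q_germ :: "nat list \<Rightarrow> complex \<Rightarrow> complex" where
  "q_germ Ns z = z * exp (G_tup Ns z / F_tup Ns z)"

definition q_taylor :: "nat list \<Rightarrow> complex fps" where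
  "q_taylor Ns = fps_expansion (q_germ Ns) 0"

definition q_val :: "nat list \<Rightarrow> complex \<Rightarrow> complex" where
  "q_val Ns z = eval_fps (q_taylor Ns) z"

text \<open>
  A function \<open>f\<close> on the open disc of radius \<open>r\<close> around 0 has a singularity at the boundary point
  \<open>w\<close> if it cannot be continued analytically to any neighbourhood of \<open>w\<close>.
\<close>
definition has_boundary_singularity :: "(complex \<Rightarrow> complex) \<Rightarrow> real \<Rightarrow> complex \<Rightarrow> bool" where
  "has_boundary_singularity f r w \<longleftrightarrow>
     \<not> (\<exists>e>0. \<exists>g. g holomorphic_on ball w e \<and> (\<forall>z\<in>ball 0 r \<inter> ball w e. g z = f z))"

end

theory Submission
  imports Defs "HOL-Real_Asymp.Real_Asymp"
begin

text \<open>
  Substituting \<open>x = C z\<close> turns \<open>\<^bold>F\<close> into \<open>F(x) = \<Sum> b\<^sub>n x\<^sup>n\<close> with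
  \<open>b\<^sub>n = \<Prod> (a)\<^sub>n / n!\<close>, where the \<open>\<Phi>\<close> parameters \<open>a \<in> (0, 1)\<close> add up to \<open>\<Phi> / 2\<close>
  because they are permuted by \<open>a \<mapsto> 1 - a\<close>; hence \<open>b\<^sub>n\<close> is asymptotic to a constant times
  \<open>n\<^bsup>-\<Phi>/2\<^esup>\<close>. The coefficients of \<open>G(x)\<close> are \<open>h\<^sub>n b\<^sub>n\<close>, where \<open>h\<^sub>n\<close>
  increases from \<open>0\<close> to a limit \<open>L\<close>. Summing over the divisors of \<open>N\<close> shows that \<open>L = ln C\<close>,
  which is Gauss's digamma theorem in disguise. With \<open>W = G / F\<close>, the canonical coordinate is
  \<open>z exp (W (C z))\<close>, and everything is a statement about the coefficients \<open>p\<^sub>n\<close> of \<open>exp W\<close>.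

  \<^bold>\<open>Positivity.\<close> Each ratio \<open>(a + n) / (1 + n)\<close> increases to \<open>1\<close>, so \<open>b\<close> is log-convex and decreasing.
  By Kaluza's argument \<open>1 / F = 1 - U\<close> where the coefficients \<open>u\<^sub>n\<close> of \<open>U\<close> are nonnegative with
  sum at most \<open>1\<close>. Then \<open>W\<close> has the coefficients \<open>\<Sum>\<^sub>k u\<^sub>k b\<^sub>n\<^sub>-\<^sub>k (h\<^sub>n - h\<^sub>n\<^sub>-\<^sub>k) \<ge> 0\<close>, so all \<open>p\<^sub>n\<close> are
  nonnegative. As \<open>G \<le> L F\<close> on \<open>[0, 1)\<close>, the coefficients of \<open>W\<close> have sum at most \<open>L\<close> and those of
  \<open>exp W\<close> at most \<open>exp L = C\<close>. This gives absolute convergence on the closed disc and the bound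
  \<open>1\<close> there.

  \<^bold>\<open>Asymptotics.\<close> Let \<open>\<Phi> \<ge> 2\<close>. Writing \<open>W = L - E / F\<close>, where \<open>E\<close> has the positive coefficients
  \<open>e\<^sub>n = (L - h\<^sub>n) b\<^sub>n = o(u\<^sub>n)\<close>, shows that the coefficients of \<open>W\<close> behave like
  \<open>E(1) u\<^sub>n\<close>, and those of \<open>exp W\<close> like \<open>E(1) exp (W(1)) u\<^sub>n\<close>: sequences comparable to a summable,
  slowly changing weight form an algebra stable under \<open>exp\<close>. This reduces the matter to \<open>u\<^sub>n\<close>. If
  \<open>\<Phi> \<ge> 3\<close> then \<open>F(1)\<close> is finite and \<open>u\<^sub>n\<close> is asymptotic to \<open>b\<^sub>n / F(1)\<^sup>2\<close>. If \<open>\<Phi> = 2\<close>, then \<open>b\<^sub>n\<close> is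
  asymptotic to \<open>\<kappa> / n\<close> and \<open>u\<close> is a probability distribution whose tail is asymptotic to
  \<open>1 / (\<kappa> ln n)\<close>; the local statement that \<open>u\<^sub>n\<close> is asymptotic to \<open>1 / (\<kappa> n ln\<^sup>2 n)\<close> follows from
  the identity \<open>U' = F' / F\<^sup>2\<close> by applying it twice. If finally \<open>\<Phi> = 1\<close>, then \<open>F = (1 - x)\<^bsup>-1/2\<^esup>\<close>, and
  \<open>exp W\<close> is found explicitly from its logarithmic derivative.

  In all cases \<open>p\<^sub>n / p\<^sub>n\<^sub>+\<^sub>1\<close> tends to \<open>1\<close>, which fixes the radius of convergence; nonnegativity
  of the coefficients then forces the singularity by Pringsheim's theorem.
\<close>

section \<open>Convolution of sequences of comparable decay\<close>

text \<open>
  The form of Tannery's theorem behind all limits of convolutions \<open>\<Sum> a\<^sub>k c\<^sub>n\<^sub>-\<^sub>k\<close>: as long as \<open>k\<close>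
  stays in the first half of the range, \<open>c\<^sub>n\<^sub>-\<^sub>k\<close> is comparable to \<open>c\<^sub>n\<close>. The parameter \<open>d\<close> is
  \<open>0\<close> or \<open>1\<close>, so that the two halves of \<open>{..n}\<close> do not share a middle index.
\<close>
lemma tendsto_sum_le_half:
  fixes a :: "nat \<Rightarrow> real" and r :: "nat \<Rightarrow> nat \<Rightarrow> real"
  assumes a: "summable (\<lambda>k. \<bar>a k\<bar>)"
    and lim: "\<And>k. r k \<longlonglongrightarrow> \<rho>"
    and bound: "\<And>k n. 2 * k + d \<le> n \<Longrightarrow> \<bar>r k n\<bar> \<le> M"
  shows "(\<lambda>n. \<Sum>k | 2 * k + d \<le> n. a k * r k n) \<longlonglongrightarrow> \<rho> * suminf a"
proof -
  define f where "f = (\<lambda>k n. if 2 * k + d \<le> n then a k * r k n else 0)"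
  have M: "0 \<le> M" using bound[of 0 d] by simp
  have f_lim: "f k \<longlonglongrightarrow> a k * \<rho>" for k
  proof -
    have "(\<lambda>n. a k * r k n) \<longlonglongrightarrow> a k * \<rho>" by (intro tendsto_intros lim)
    moreover have "eventually (\<lambda>n. a k * r k n = f k n) sequentially"
      using eventually_ge_at_top[of "2 * k + d"] by eventually_elim (simp add: f_def)
    ultimately show ?thesis by (rule Lim_transform_eventually)
  qed
  have "(\<lambda>n. suminf (\<lambda>k. f k n)) \<longlonglongrightarrow> (\<Sum>k. a k * \<rho>)"
  proof -
    have "norm (f k n) \<le> \<bar>a k\<bar> * M" for k n
      using bound[of k n] M by (auto simp: f_def abs_mult intro!: mult_left_mono)
    then have "eventually (\<lambda>(k, n). norm (f k n) \<le> \<bar>a k\<bar> * M) (at_top \<times>\<^sub>F sequentially)"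
      by (intro always_eventually) auto
    from tannerys_theorem[OF f_lim this summable_mult2[OF a]] show ?thesis by simp
  qed
  moreover have "suminf (\<lambda>k. f k n) = (\<Sum>k | 2 * k + d \<le> n. a k * r k n)" for n
  proof -
    have fin: "finite {k. 2 * k + d \<le> n}" by (rule finite_subset[of _ "{..n}"]) auto
    have "suminf (\<lambda>k. f k n) = (\<Sum>k | 2 * k + d \<le> n. f k n)"
      by (rule suminf_finite[OF fin]) (simp add: f_def)
    then show ?thesis by (simp add: f_def)
  qed
  moreover have "(\<Sum>k. a k * \<rho>) = \<rho> * suminf a"
    using suminf_mult2[OF summable_rabs_cancel[OF a], of \<rho>] by (simp add: mult.commute)
  ultimately show ?thesis by simp
qed

lemma sum_halves:
  fixes f :: "nat \<Rightarrow> real"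
  shows "(\<Sum>k\<le>n. f k) = (\<Sum>k | 2 * k \<le> n. f k) + (\<Sum>k | 2 * k + 1 \<le> n. f (n - k))"
proof -
  have "{..n} = {k. 2 * k \<le> n} \<union> {k. k \<le> n \<and> n < 2 * k}" by auto
  moreover have fin: "finite {k. 2 * k \<le> n}" "finite {k. k \<le> n \<and> n < 2 * k}"
    by (rule finite_subset[of _ "{..n}"]; auto)+
  ultimately have "(\<Sum>k\<le>n. f k) = (\<Sum>k | 2 * k \<le> n. f k) + (\<Sum>k | k \<le> n \<and> n < 2 * k. f k)"
    by (simp only:) (rule sum.union_disjoint, auto)
  also have "(\<Sum>k | k \<le> n \<and> n < 2 * k. f k) = (\<Sum>k | 2 * k + 1 \<le> n. f (n - k))"
    by (rule sum.reindex_bij_witness[of _ "\<lambda>k. n - k" "\<lambda>k. n - k"]) auto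
  finally show ?thesis .
qed

lemma fps_exp_compose_nth:
  fixes G :: "real fps"
  shows "fps_nth (fps_exp 1 oo G) n = (\<Sum>j\<le>n. fps_nth (G ^ j) n / fact j)"
  by (simp add: fps_compose_nth atLeast0AtMost)

text \<open>
  This is \<open>(exp G)' = G' exp G\<close>, read off coefficientwise.
\<close>
lemma fps_exp_compose_rec:
  fixes G :: "real fps"
  assumes "fps_nth G 0 = 0"
  shows "real n * fps_nth (fps_exp 1 oo G) n
    = (\<Sum>k\<le>n. real k * fps_nth G k * fps_nth (fps_exp 1 oo G) (n - k))"
proof (cases n)
  case (Suc m)
  have "fps_deriv (fps_exp 1 oo G) = (fps_exp 1 oo G) * fps_deriv G"
    by (simp add: fps_compose_deriv[OF assms])
  then have "fps_nth (fps_deriv (fps_exp 1 oo G)) m = fps_nth (fps_deriv G * (fps_exp 1 oo G)) m"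
    by (simp add: mult.commute)
  then have "real n * fps_nth (fps_exp 1 oo G) n = (\<Sum>k\<le>m. real (Suc k) * fps_nth G (Suc k) * fps_nth (fps_exp 1 oo G) (n - Suc k))"
    by (simp add: Suc fps_mult_nth atLeast0AtMost add.commute)
  also have "\<dots> = (\<Sum>k\<le>n. real k * fps_nth G k * fps_nth (fps_exp 1 oo G) (n - k))"
    unfolding Suc by (subst sum.atMost_Suc_shift) simp
  finally show ?thesis .
qed simp

text \<open>
  Rates of decay for which convolution preserves the rate: summable, falling by at most a constant
  factor between \<open>n / 2\<close> and \<open>n\<close>, and with consecutive ratios tending to \<open>1\<close>. In a convolution of two
  sequences of this size the dominant terms are those with one index bounded.
\<close>
locale slow_weight =
  fixes w :: "nat \<Rightarrow> real" and K :: real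
  assumes w_pos: "0 < w n"
    and w_summable: "summable w"
    and w_half: "k \<le> n \<Longrightarrow> n \<le> 2 * k \<Longrightarrow> w k \<le> K * w n"
    and w_ratio: "(\<lambda>n. w (Suc n) / w n) \<longlonglongrightarrow> 1"
begin

lemma w_nonzero [simp]: "w n \<noteq> 0"
  using w_pos[of n] by simp

lemma K_pos: "0 < K"
  using w_half[of 0 0] w_pos[of 0] by simp

lemma w_shift: "(\<lambda>n. w (n - k) / w n) \<longlonglongrightarrow> 1"
proof (induction k)
  case (Suc k)
  have "(\<lambda>n. w (n - k) / w n / (w (Suc (n - Suc k)) / w (n - Suc k))) \<longlonglongrightarrow> 1 / 1"
    by (intro tendsto_divide Suc.IH filterlim_compose[OF w_ratio] filterlim_minus_const_nat_at_top) auto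
  moreover have "eventually (\<lambda>n. w (n - k) / w n / (w (Suc (n - Suc k)) / w (n - Suc k)) = w (n - Suc k) / w n) sequentially"
    using eventually_gt_at_top[of k]
  proof eventually_elim
    case (elim n)
    then have "Suc (n - Suc k) = n - k" by simp
    then show ?case using w_pos[of "n - k"] by simp
  qed
  ultimately show ?case by (simp add: Lim_transform_eventually)
qed simp

definition mass :: real where "mass = suminf w"

lemma mass_pos: "0 < mass"
  unfolding mass_def by (rule suminf_pos[OF w_summable w_pos])

lemma tendsto_imp_bound:
  assumes "(\<lambda>n. a n / w n) \<longlonglongrightarrow> \<alpha>"
  obtains A where "0 < A" "\<And>n. \<bar>a n\<bar> \<le> A * w n"
proof -
  have "Bseq (\<lambda>n. a n / w n)" using assms by (intro convergent_imp_Bseq convergentI)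
  then obtain A where "0 < A" "\<And>n. norm (a n / w n) \<le> A" unfolding Bseq_def by blast
  then have "\<bar>a n\<bar> \<le> A * w n" for n
    using pos_divide_le_eq[OF w_pos[of n]] abs_of_pos[OF w_pos[of n]]
    by (metis abs_divide real_norm_def)
  with \<open>0 < A\<close> show ?thesis by (rule that)
qed

lemma bound_imp_summable:
  assumes "\<And>n. \<bar>a n\<bar> \<le> A * w n"
  shows "summable (\<lambda>n. \<bar>a n\<bar>)"
  by (rule summable_comparison_test[OF _ summable_mult[OF w_summable, of A]]) (use assms in auto)

lemma sum_abs_le_mass:
  assumes "\<And>n. \<bar>a n\<bar> \<le> A * w n" "finite I"
  shows "(\<Sum>k\<in>I. \<bar>a k\<bar>) \<le> A * mass"
proof -
  have "(\<Sum>k\<in>I. \<bar>a k\<bar>) \<le> (\<Sum>k\<in>I. A * w k)" by (intro sum_mono assms)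
  also have "\<dots> = A * sum w I" by (simp add: sum_distrib_left)
  also have "\<dots> \<le> A * mass"
  proof (rule mult_left_mono)
    show "sum w I \<le> mass" unfolding mass_def
      by (rule sum_le_suminf[OF w_summable assms(2)]) (use w_pos less_imp_le in auto)
    show "0 \<le> A" using assms(1)[of 0] w_pos[of 0]
      by (meson abs_ge_zero order_trans zero_le_mult_iff not_le less_le_trans)
  qed
  finally show ?thesis .
qed

lemma half_convolution_bound:
  assumes a: "\<And>n. \<bar>a n\<bar> \<le> A * w n" and c: "\<And>n. \<bar>c n\<bar> \<le> B * w n"
  shows "\<bar>\<Sum>k | 2 * k + d \<le> n. a k * c (n - k)\<bar> \<le> A * mass * (B * K * w n)"
proof -
  have fin: "finite {k. 2 * k + d \<le> n}" by (rule finite_subset[of _ "{..n}"]) auto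
  have B: "0 \<le> B" using c[of 0] w_pos[of 0]
    by (meson abs_ge_zero order_trans zero_le_mult_iff not_le less_le_trans)
  have "\<bar>\<Sum>k | 2 * k + d \<le> n. a k * c (n - k)\<bar> \<le> (\<Sum>k | 2 * k + d \<le> n. \<bar>a k\<bar> * (B * K * w n))"
  proof (rule order_trans[OF sum_abs sum_mono])
    fix k assume "k \<in> {k. 2 * k + d \<le> n}"
    then have "\<bar>c (n - k)\<bar> \<le> B * (K * w n)"
      by (intro order_trans[OF c] mult_left_mono w_half B) auto
    then show "\<bar>a k * c (n - k)\<bar> \<le> \<bar>a k\<bar> * (B * K * w n)"
      by (simp add: abs_mult mult_left_mono mult.assoc)
  qed
  also have "\<dots> = (\<Sum>k | 2 * k + d \<le> n. \<bar>a k\<bar>) * (B * K * w n)" by (simp add: sum_distrib_right)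
  also have "\<dots> \<le> A * mass * (B * K * w n)"
    by (intro mult_right_mono sum_abs_le_mass a fin mult_nonneg_nonneg B less_imp_le[OF K_pos] less_imp_le[OF w_pos])
  finally show ?thesis .
qed

lemma convolution_bound:
  assumes a: "\<And>n. \<bar>a n\<bar> \<le> A * w n" and c: "\<And>n. \<bar>c n\<bar> \<le> B * w n"
  shows "\<bar>\<Sum>k\<le>n. a k * c (n - k)\<bar> \<le> 2 * K * mass * A * B * w n"
proof -
  have "(\<Sum>k | 2 * k + 1 \<le> n. a (n - k) * c (n - (n - k))) = (\<Sum>k | 2 * k + 1 \<le> n. c k * a (n - k))"
    by (rule sum.cong) auto
  then have "(\<Sum>k\<le>n. a k * c (n - k))
      = (\<Sum>k | 2 * k + 0 \<le> n. a k * c (n - k)) + (\<Sum>k | 2 * k + 1 \<le> n. c k * a (n - k))"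
    unfolding sum_halves by simp
  also have "\<bar>\<dots>\<bar> \<le> A * mass * (B * K * w n) + B * mass * (A * K * w n)"
    by (rule order_trans[OF abs_triangle_ineq add_mono]) (rule half_convolution_bound a c)+
  finally show ?thesis by (simp add: algebra_simps)
qed

lemma half_convolution_tendsto:
  assumes a: "summable (\<lambda>n. \<bar>a n\<bar>)" and c: "(\<lambda>n. c n / w n) \<longlonglongrightarrow> \<gamma>"
  shows "(\<lambda>n. (\<Sum>k | 2 * k + d \<le> n. a k * c (n - k)) / w n) \<longlonglongrightarrow> \<gamma> * suminf a"
proof -
  obtain B where B: "0 < B" "\<And>n. \<bar>c n\<bar> \<le> B * w n" by (rule tendsto_imp_bound[OF c]) blast
  have "(\<lambda>n. \<Sum>k | 2 * k + d \<le> n. a k * (c (n - k) / w n)) \<longlonglongrightarrow> \<gamma> * suminf a"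
  proof (rule tendsto_sum_le_half[OF a])
    fix k
    have "(\<lambda>n. c (n - k) / w (n - k) * (w (n - k) / w n)) \<longlonglongrightarrow> \<gamma> * 1"
      by (intro tendsto_mult w_shift filterlim_compose[OF c] filterlim_minus_const_nat_at_top)
    moreover have "c (n - k) / w (n - k) * (w (n - k) / w n) = c (n - k) / w n" for n
      using w_pos[of "n - k"] by simp
    ultimately show "(\<lambda>n. c (n - k) / w n) \<longlonglongrightarrow> \<gamma>" by simp
  next
    fix k n :: nat assume "2 * k + d \<le> n"
    then have "\<bar>c (n - k)\<bar> \<le> B * (K * w n)"
      by (intro order_trans[OF B(2)] mult_left_mono w_half less_imp_le[OF B(1)]) auto
    then show "\<bar>c (n - k) / w n\<bar> \<le> B * K"
      using w_pos[of n] by (simp add: abs_divide divide_le_eq mult.assoc)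
  qed
  then show ?thesis by (simp add: sum_divide_distrib)
qed

lemma convolution_tendsto:
  assumes a: "(\<lambda>n. a n / w n) \<longlonglongrightarrow> \<alpha>" and c: "(\<lambda>n. c n / w n) \<longlonglongrightarrow> \<gamma>"
  shows "(\<lambda>n. (\<Sum>k\<le>n. a k * c (n - k)) / w n) \<longlonglongrightarrow> \<gamma> * suminf a + \<alpha> * suminf c"
proof -
  have sa: "summable (\<lambda>n. \<bar>a n\<bar>)" by (rule tendsto_imp_bound[OF a]) (rule bound_imp_summable)
  have sc: "summable (\<lambda>n. \<bar>c n\<bar>)" by (rule tendsto_imp_bound[OF c]) (rule bound_imp_summable)
  have eq: "(\<Sum>k | 2 * k + 1 \<le> n. a (n - k) * c (n - (n - k))) = (\<Sum>k | 2 * k + 1 \<le> n. c k * a (n - k))" for n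
    by (rule sum.cong) auto
  show ?thesis unfolding sum_halves eq add_divide_distrib
    using tendsto_add[OF half_convolution_tendsto[OF sa c, of 0] half_convolution_tendsto[OF sc a, of 1]]
    by simp
qed

text \<open>
  If \<open>P' = G' V\<close>, then the coefficients of \<open>P\<close> inherit the rate of those of \<open>G\<close>, provided that those of
  \<open>V\<close> are at least as small. For \<open>V = P\<close> this treats \<open>P = exp G\<close>, and for \<open>V = 1 / F\<^sup>2\<close> it treats
  \<open>P = - 1 / F\<close> with \<open>G = F\<close>. The terms in which \<open>k\<close> is small are negligible because of the factor
  \<open>k / n\<close>.
\<close>
lemma log_derivative_transfer:
  assumes rec: "\<And>n. real n * p n = (\<Sum>k\<le>n. real k * g k * v (n - k))"
    and g: "(\<lambda>n. g n / w n) \<longlonglongrightarrow> \<gamma>" and v: "\<And>n. \<bar>v n\<bar> \<le> B * w n"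
  shows "(\<lambda>n. p n / w n) \<longlonglongrightarrow> \<gamma> * suminf v"
proof -
  obtain A where A: "0 < A" "\<And>n. \<bar>g n\<bar> \<le> A * w n" by (rule tendsto_imp_bound[OF g]) blast
  have B: "0 \<le> B" using v[of 0] w_pos[of 0]
    by (meson abs_ge_zero order_trans zero_le_mult_iff not_le less_le_trans)
  have sv: "summable (\<lambda>n. \<bar>v n\<bar>)" by (rule bound_imp_summable[OF v])
  have sg: "summable (\<lambda>n. \<bar>g n\<bar>)" by (rule bound_imp_summable[OF A(2)])
  have nat_ratio: "(\<lambda>n. real (n - k) / real n) \<longlonglongrightarrow> 1" for k
  proof -
    have "(\<lambda>n. (real n - real k) / real n) \<longlonglongrightarrow> 1" by real_asymp
    moreover have "eventually (\<lambda>n. (real n - real k) / real n = real (n - k) / real n) sequentially"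
      using eventually_ge_at_top[of k] by eventually_elim (simp add: of_nat_diff)
    ultimately show ?thesis by (rule Lim_transform_eventually)
  qed
  have large: "(\<lambda>n. \<Sum>k | 2 * k + 1 \<le> n. v k * (real (n - k) / real n * (g (n - k) / w n))) \<longlonglongrightarrow> \<gamma> * suminf v"
  proof (rule tendsto_sum_le_half[OF sv])
    fix k
    have "(\<lambda>n. real (n - k) / real n * (g (n - k) / w (n - k) * (w (n - k) / w n))) \<longlonglongrightarrow> 1 * (\<gamma> * 1)"
      by (intro tendsto_mult nat_ratio w_shift filterlim_compose[OF g] filterlim_minus_const_nat_at_top)
    moreover have "g (n - k) / w (n - k) * (w (n - k) / w n) = g (n - k) / w n" for n
      using w_pos[of "n - k"] by simp
    ultimately show "(\<lambda>n. real (n - k) / real n * (g (n - k) / w n)) \<longlonglongrightarrow> \<gamma>" by simp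
  next
    fix k n :: nat assume kn: "2 * k + 1 \<le> n"
    then have "\<bar>g (n - k)\<bar> \<le> A * (K * w n)"
      by (intro order_trans[OF A(2)] mult_left_mono w_half less_imp_le[OF A(1)]) auto
    then have 1: "\<bar>g (n - k) / w n\<bar> \<le> A * K"
      using w_pos[of n] by (simp add: abs_divide divide_le_eq mult.assoc)
    have "\<bar>real (n - k) / real n\<bar> \<le> 1" using kn by (simp add: divide_le_eq)
    with 1 show "\<bar>real (n - k) / real n * (g (n - k) / w n)\<bar> \<le> A * K"
      by (metis abs_ge_zero abs_mult mult_mono mult_1 zero_le_one)
  qed
  have small: "(\<lambda>n. \<Sum>k | 2 * k + 0 \<le> n. g k * (real k / real n * (v (n - k) / w n))) \<longlonglongrightarrow> 0 * suminf g"
  proof (rule tendsto_sum_le_half[OF sg])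
    fix k
    have 1: "\<bar>v (n - k) / w n\<bar> \<le> B * K" if "2 * k \<le> n" for n
    proof -
      have "\<bar>v (n - k)\<bar> \<le> B * (K * w n)"
        using that by (intro order_trans[OF v] mult_left_mono w_half B) auto
      then show ?thesis using w_pos[of n] by (simp add: abs_divide divide_le_eq mult.assoc)
    qed
    show "(\<lambda>n. real k / real n * (v (n - k) / w n)) \<longlonglongrightarrow> 0"
    proof (rule Lim_null_comparison)
      show "eventually (\<lambda>n. norm (real k / real n * (v (n - k) / w n)) \<le> real k / real n * (B * K)) sequentially"
        using eventually_ge_at_top[of "2 * k"]
      proof eventually_elim
        case (elim n)
        show ?case unfolding real_norm_def abs_mult by (intro mult_mono 1[OF elim]) auto
      qed
      show "(\<lambda>n. real k / real n * (B * K)) \<longlonglongrightarrow> 0" by real_asymp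
    qed
    fix n assume kn: "2 * k + 0 \<le> n"
    have "\<bar>real k / real n\<bar> \<le> 1" using kn by (simp add: divide_le_eq)
    moreover have "\<bar>v (n - k) / w n\<bar> \<le> B * K" using 1 kn by simp
    ultimately show "\<bar>real k / real n * (v (n - k) / w n)\<bar> \<le> B * K"
      by (metis abs_ge_zero abs_mult mult_mono mult_1 zero_le_one)
  qed
  have "eventually (\<lambda>n. (\<Sum>k | 2 * k + 1 \<le> n. v k * (real (n - k) / real n * (g (n - k) / w n)))
      + (\<Sum>k | 2 * k + 0 \<le> n. g k * (real k / real n * (v (n - k) / w n))) = p n / w n) sequentially"
    using eventually_gt_at_top[of 0]
  proof eventually_elim
    case (elim n)
    have "p n / w n = (\<Sum>k\<le>n. real k * g k * v (n - k)) / (real n * w n)"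
      unfolding rec[symmetric] using elim by simp
    also have "\<dots> = (\<Sum>k | 2 * k \<le> n. real k * g k * v (n - k)) / (real n * w n)
        + (\<Sum>k | 2 * k + 1 \<le> n. real (n - k) * g (n - k) * v (n - (n - k))) / (real n * w n)"
      unfolding sum_halves add_divide_distrib ..
    also have "(\<Sum>k | 2 * k + 1 \<le> n. real (n - k) * g (n - k) * v (n - (n - k))) / (real n * w n)
        = (\<Sum>k | 2 * k + 1 \<le> n. v k * (real (n - k) / real n * (g (n - k) / w n)))"
      unfolding sum_divide_distrib by (rule sum.cong) (auto simp: mult_ac)
    also have "(\<Sum>k | 2 * k \<le> n. real k * g k * v (n - k)) / (real n * w n)
        = (\<Sum>k | 2 * k + 0 \<le> n. g k * (real k / real n * (v (n - k) / w n)))"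
      unfolding sum_divide_distrib by (rule sum.cong) (auto simp: mult_ac)
    finally show ?case by simp
  qed
  then show ?thesis
    using Lim_transform_eventually[OF tendsto_add[OF large small]] by simp
qed

text \<open>
  A bound of the right order for \<open>exp G\<close>, which \<open>log_derivative_transfer\<close> needs as an input.
  By \<open>convolution_bound\<close>, every further factor \<open>G\<close> costs only a constant factor \<open>Q\<close>, and
  \<open>\<Sum> Q\<^sup>j / j!\<close> converges.
\<close>
lemma exp_compose_bound:
  fixes G :: "real fps"
  assumes A: "\<And>n. \<bar>fps_nth G n\<bar> \<le> A * w n"
  obtains B where "\<And>n. \<bar>fps_nth (fps_exp 1 oo G) n\<bar> \<le> B * w n"
proof -
  define Q where "Q = 2 * K * mass * A"
  have A0: "0 \<le> A" using A[of 0] w_pos[of 0]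
    by (meson abs_ge_zero order_trans zero_le_mult_iff not_le less_le_trans)
  have Q: "0 \<le> Q" unfolding Q_def using K_pos mass_pos A0 by simp
  have pow: "\<bar>fps_nth (G ^ j) n\<bar> \<le> Q ^ j / w 0 * w n" for j n
  proof (induction j arbitrary: n)
    case 0
    show ?case using w_pos[of n] w_pos[of 0] by (cases "n = 0") auto
  next
    case (Suc j)
    have "fps_nth (G ^ Suc j) n = (\<Sum>k\<le>n. fps_nth G k * fps_nth (G ^ j) (n - k))"
      by (simp add: fps_mult_nth atLeast0AtMost)
    also have "\<bar>\<dots>\<bar> \<le> 2 * K * mass * A * (Q ^ j / w 0) * w n"
      by (rule convolution_bound[OF A Suc.IH])
    finally show ?case by (simp add: Q_def)
  qed
  have "\<bar>fps_nth (fps_exp 1 oo G) n\<bar> \<le> exp Q / w 0 * w n" for n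
  proof -
    have "\<bar>fps_nth (fps_exp 1 oo G) n\<bar> \<le> (\<Sum>j\<le>n. Q ^ j / fact j * (w n / w 0))"
      unfolding fps_exp_compose_nth
    proof (rule order_trans[OF sum_abs sum_mono])
      fix j
      show "\<bar>fps_nth (G ^ j) n / fact j\<bar> \<le> Q ^ j / fact j * (w n / w 0)"
        using divide_right_mono[OF pow[of j n], of "fact j"] by (simp add: abs_divide mult_ac)
    qed
    also have "\<dots> = (\<Sum>j\<le>n. Q ^ j / fact j) * (w n / w 0)" by (rule sum_distrib_right[symmetric])
    also have "\<dots> \<le> exp Q * (w n / w 0)"
    proof (rule mult_right_mono)
      have "(\<lambda>j. Q ^ j / fact j) sums exp Q" using exp_converges[of Q] by (simp add: scaleR_conv_of_real field_simps)
      then show "(\<Sum>j\<le>n. Q ^ j / fact j) \<le> exp Q"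
        using sum_le_suminf[of "\<lambda>j. Q ^ j / fact j" "{..n}"] Q by (auto simp: sums_iff)
      show "0 \<le> w n / w 0" using w_pos[of n] w_pos[of 0] by simp
    qed
    finally show ?thesis by simp
  qed
  then show ?thesis by (rule that)
qed

theorem exp_compose_tendsto:
  fixes G :: "real fps"
  assumes G0: "fps_nth G 0 = 0" and lim: "(\<lambda>n. fps_nth G n / w n) \<longlonglongrightarrow> \<gamma>"
  shows "summable (\<lambda>n. fps_nth (fps_exp 1 oo G) n)"
    and "(\<lambda>n. fps_nth (fps_exp 1 oo G) n / w n) \<longlonglongrightarrow> \<gamma> * (\<Sum>n. fps_nth (fps_exp 1 oo G) n)"
proof -
  obtain A where "0 < A" "\<And>n. \<bar>fps_nth G n\<bar> \<le> A * w n" by (rule tendsto_imp_bound[OF lim]) blast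
  then obtain B where B: "\<And>n. \<bar>fps_nth (fps_exp 1 oo G) n\<bar> \<le> B * w n"
    using exp_compose_bound by metis
  show "summable (\<lambda>n. fps_nth (fps_exp 1 oo G) n)"
    using bound_imp_summable[OF B] by (rule summable_rabs_cancel)
  show "(\<lambda>n. fps_nth (fps_exp 1 oo G) n / w n) \<longlonglongrightarrow> \<gamma> * (\<Sum>n. fps_nth (fps_exp 1 oo G) n)"
    by (rule log_derivative_transfer[OF _ lim B]) (rule fps_exp_compose_rec[OF G0])
qed

end

section \<open>Reciprocals of log-convex power series\<close>

lemma one_minus_X_mult_ones: "(1 - fps_X) * Abs_fps (\<lambda>_. 1 :: real) = 1"
proof (rule fps_ext)
  fix n show "fps_nth ((1 - fps_X) * Abs_fps (\<lambda>_. 1 :: real)) n = fps_nth 1 n"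
    by (cases n) (simp_all add: left_diff_distrib)
qed

text \<open>
  Below, \<open>F\<close> is the series \<open>\<Sum> b\<^sub>n x\<^sup>n\<close> and \<open>U = 1 - 1 / F\<close> has the coefficients \<open>u\<close>. The relation
  \<open>F = 1 + U F\<close> makes \<open>b\<close> a renewal sequence: \<open>u\<^sub>n\<close> is the probability that an event first recurs at
  time \<open>n\<close>, \<open>b\<^sub>n\<close> that it recurs at time \<open>n\<close>, and \<open>T\<^sub>n\<close> that it has not recurred up to time \<open>n\<close>. The
  coefficients \<open>v\<close> of \<open>1 / F\<^sup>2\<close> enter through \<open>U' = F' / F\<^sup>2\<close>.
\<close>
locale log_convex_seq =
  fixes b :: "nat \<Rightarrow> real"
  assumes b_0: "b 0 = 1"
    and b_pos: "0 < b n"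
    and b_decr: "b (Suc n) \<le> b n"
    and b_log_convex: "b (Suc n) ^ 2 \<le> b n * b (Suc (Suc n))"
begin

definition u :: "nat \<Rightarrow> real" where
  "u n = fps_nth (1 - inverse (Abs_fps b)) n"

definition T :: "nat \<Rightarrow> real" where
  "T n = 1 - (\<Sum>k\<le>n. u k)"

definition v :: "nat \<Rightarrow> real" where
  "v n = fps_nth ((inverse (Abs_fps b)) ^ 2) n"

lemma b_antimono: "m \<le> n \<Longrightarrow> b n \<le> b m"
  by (rule lift_Suc_antimono_le[of b, OF b_decr])

lemma b_le_1: "b n \<le> 1"
  using b_antimono[of 0 n] b_0 by simp

lemma b_ratio_mono: "m \<le> n \<Longrightarrow> b (Suc m) / b m \<le> b (Suc n) / b n"
proof (rule lift_Suc_mono_le[of "\<lambda>n. b (Suc n) / b n"])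
  fix n
  show "b (Suc n) / b n \<le> b (Suc (Suc n)) / b (Suc n)"
    using b_log_convex[of n] b_pos[of n] b_pos[of "Suc n"]
    by (simp add: field_simps power2_eq_square)
qed

lemma inverse_fps_nth: "fps_nth (inverse (Abs_fps b)) n = (if n = 0 then 1 else 0) - u n"
  by (simp add: u_def)

lemma fps_mult_inverse: "Abs_fps b * inverse (Abs_fps b) = 1"
  by (rule inverse_mult_eq_1') (simp add: b_0)

lemma u_0: "u 0 = 0"
  by (simp add: u_def b_0)

lemma renewal: "0 < n \<Longrightarrow> b n = (\<Sum>k\<le>n. u k * b (n - k))"
proof -
  assume n: "0 < n"
  have "(1 - Abs_fps u) = inverse (Abs_fps b)" by (rule fps_ext) (simp add: inverse_fps_nth)
  then have "(1 - Abs_fps u) * Abs_fps b = 1"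
    using fps_mult_inverse by (simp only: mult.commute)
  then have "Abs_fps b - Abs_fps u * Abs_fps b = 1" by (simp only: left_diff_distrib mult_1)
  then have "fps_nth (Abs_fps b - Abs_fps u * Abs_fps b) n = 0" using n by simp
  then show ?thesis by (simp add: fps_mult_nth atLeast0AtMost)
qed

text \<open>
  Kaluza's theorem. Multiplying the renewal equation for \<open>b\<^sub>m\<close> by \<open>b\<^sub>m\<^sub>+\<^sub>1 / b\<^sub>m\<close> and comparing with the
  one for \<open>b\<^sub>m\<^sub>+\<^sub>1\<close>, log-convexity makes every old term of the first equation at least as large as its
  counterpart in the second, so the new term \<open>u\<^sub>m\<^sub>+\<^sub>1\<close> has to be nonnegative.
\<close>
lemma u_nonneg: "0 \<le> u n"
proof (induction n rule: less_induct)
  case (less n)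
  show ?case
  proof (cases n)
    case (Suc m)
    show ?thesis
    proof (cases "m = 0")
      case True
      then show ?thesis using renewal[of 1] b_pos[of 1] Suc u_0 b_0 by simp
    next
      case False
      have "b n = b m * (b (Suc m) / b m)" using b_pos[of m] Suc by simp
      also have "\<dots> = (\<Sum>k\<le>m. u k * (b (m - k) * (b (Suc m) / b m)))"
        unfolding mult.assoc[symmetric] sum_distrib_right[symmetric] using renewal[of m] False by simp
      also have "\<dots> \<ge> (\<Sum>k\<le>m. u k * b (Suc m - k))"
      proof (intro sum_mono mult_left_mono)
        fix k assume "k \<in> {..m}"
        then show "0 \<le> u k" using less.IH[of k] Suc by simp
        show "b (Suc m - k) \<le> b (m - k) * (b (Suc m) / b m)"
          using b_ratio_mono[of "m - k" m] b_pos[of "m - k"] \<open>k \<in> {..m}\<close>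
          by (simp add: Suc_diff_le pos_divide_le_eq mult.commute)
      qed
      finally have "(\<Sum>k\<le>m. u k * b (Suc m - k)) \<le> b n" .
      also have "b n = (\<Sum>k\<le>m. u k * b (Suc m - k)) + u n" using renewal[of n] Suc b_0 by simp
      finally show ?thesis by simp
    qed
  qed (simp add: u_0)
qed

lemma u_le_b: "u n \<le> b n"
proof (cases "n = 0")
  case False
  have "u n * b (n - n) \<le> (\<Sum>k\<le>n. u k * b (n - k))"
    by (rule member_le_sum) (auto intro!: mult_nonneg_nonneg u_nonneg less_imp_le[OF b_pos])
  then show ?thesis using renewal[of n] False b_0 by simp
qed (simp add: u_0 b_0)

lemma T_decr: "m \<le> n \<Longrightarrow> T n \<le> T m"
  by (rule lift_Suc_antimono_le[of T]) (auto simp: T_def u_nonneg)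

text \<open>
  As \<open>b\<close> is decreasing, the renewal equation yields \<open>b\<^sub>n \<ge> b\<^sub>n \<Sum> u\<^sub>k\<close>.
\<close>
lemma T_nonneg: "0 \<le> T n"
proof (cases "n = 0")
  case False
  have "b n * (\<Sum>k\<le>n. u k) \<le> (\<Sum>k\<le>n. u k * b (n - k))"
    unfolding sum_distrib_left
    by (rule sum_mono, subst mult.commute) (auto intro!: mult_left_mono b_antimono u_nonneg)
  also have "\<dots> = b n * 1" using renewal[of n] False by simp
  finally have "(\<Sum>k\<le>n. u k) \<le> 1" using mult_le_cancel_left_pos[OF b_pos[of n]] by blast
  then show ?thesis by (simp add: T_def)
qed (simp add: T_def u_0)

lemma T_le_1: "T n \<le> 1"
  unfolding T_def by (simp add: sum_nonneg u_nonneg)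

lemma sum_u_le_1: "finite I \<Longrightarrow> (\<Sum>k\<in>I. u k) \<le> 1"
proof -
  assume "finite I"
  then obtain n where "I \<subseteq> {..n}" using finite_nat_iff_bounded_le by blast
  then have "(\<Sum>k\<in>I. u k) \<le> (\<Sum>k\<le>n. u k)" by (intro sum_mono2) (auto simp: u_nonneg)
  then show ?thesis using T_nonneg[of n] by (simp add: T_def)
qed

lemma summable_u: "summable u"
  by (rule bounded_imp_summable[of _ 1]) (auto simp: u_nonneg sum_u_le_1)

lemma fps_T: "Abs_fps T * (1 - fps_X) = inverse (Abs_fps b)"
proof (rule fps_ext)
  fix n
  show "fps_nth (Abs_fps T * (1 - fps_X)) n = fps_nth (inverse (Abs_fps b)) n"
    by (cases n) (simp_all add: right_diff_distrib inverse_fps_nth T_def u_0 b_0)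
qed

text \<open>
  In terms of generating functions, \<open>F \<cdot> (1 - U) / (1 - x) = 1 / (1 - x)\<close>.
\<close>
lemma renewal_tail: "(\<Sum>k\<le>n. b k * T (n - k)) = 1"
proof -
  have "Abs_fps b * Abs_fps T * (1 - fps_X) = 1"
    using fps_T fps_mult_inverse by (simp add: mult.assoc)
  then have "Abs_fps b * Abs_fps T * ((1 - fps_X) * Abs_fps (\<lambda>_. 1)) = Abs_fps (\<lambda>_. 1)"
    by (simp only: mult.assoc[symmetric] mult_1)
  then have "Abs_fps b * Abs_fps T = Abs_fps (\<lambda>_. 1)"
    by (simp only: one_minus_X_mult_ones mult_1_right)
  then have "fps_nth (Abs_fps b * Abs_fps T) n = 1" by simp
  then show ?thesis by (simp add: fps_mult_nth atLeast0AtMost)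
qed

lemma v_nth: "v n = (if n = 0 then 1 else 0) - 2 * u n + (\<Sum>k\<le>n. u k * u (n - k))"
proof -
  have "inverse (Abs_fps b) = 1 - Abs_fps u" by (rule fps_ext) (simp add: inverse_fps_nth)
  then have "inverse (Abs_fps b) ^ 2 = (1 - Abs_fps u) ^ 2" by simp
  also have "\<dots> = 1 - (Abs_fps u + Abs_fps u) + Abs_fps u * Abs_fps u"
    by (simp add: power2_eq_square algebra_simps)
  finally have "inverse (Abs_fps b) ^ 2 = 1 - (Abs_fps u + Abs_fps u) + Abs_fps u * Abs_fps u" .
  from arg_cong[OF this, of "\<lambda>f. fps_nth f n"]
  have "v n = (if n = 0 then 1 else 0) - (u n + u n) + fps_nth (Abs_fps u * Abs_fps u) n"
    unfolding v_def fps_add_nth fps_sub_nth fps_one_nth by simp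
  then show ?thesis by (simp add: fps_mult_nth atLeast0AtMost)
qed

text \<open>
  Since \<open>u \<le> b\<close>, the convolution of \<open>u\<close> with itself is at most that of \<open>u\<close> with \<open>b\<close>, which is \<open>b\<close> again
  by the renewal equation.
\<close>
lemma abs_v_le: "\<bar>v n\<bar> \<le> 2 * b n"
proof (cases "n = 0")
  case False
  have "(\<Sum>k\<le>n. u k * u (n - k)) \<le> (\<Sum>k\<le>n. u k * b (n - k))"
    by (intro sum_mono mult_left_mono u_le_b u_nonneg)
  also have "\<dots> = b n" using renewal[of n] False by simp
  finally have 1: "(\<Sum>k\<le>n. u k * u (n - k)) \<le> b n" .
  have 2: "0 \<le> (\<Sum>k\<le>n. u k * u (n - k))" by (intro sum_nonneg mult_nonneg_nonneg u_nonneg)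
  show ?thesis
    using False 1 2 u_nonneg[of n] u_le_b[of n] b_pos[of n] unfolding v_nth abs_le_iff by auto
qed (simp add: v_nth u_0 b_0)

lemma sum_v: "(\<Sum>k\<le>n. v k) = T n - (\<Sum>k\<le>n. u k * T (n - k))"
proof -
  have u: "inverse (Abs_fps b) = 1 - Abs_fps u" by (rule fps_ext) (simp add: inverse_fps_nth)
  have "Abs_fps v = (1 - Abs_fps u) * (Abs_fps T * (1 - fps_X))"
    unfolding fps_T u[symmetric] by (rule fps_ext) (simp add: v_def power2_eq_square)
  then have "Abs_fps v * Abs_fps (\<lambda>_. 1) = (1 - Abs_fps u) * Abs_fps T * ((1 - fps_X) * Abs_fps (\<lambda>_. 1))"
    by (simp only: mult.assoc)
  also have "\<dots> = Abs_fps T - Abs_fps u * Abs_fps T"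
    unfolding one_minus_X_mult_ones by (simp add: algebra_simps)
  finally have "fps_nth (Abs_fps v * Abs_fps (\<lambda>_. 1)) n = fps_nth (Abs_fps T - Abs_fps u * Abs_fps T) n"
    by simp
  then show ?thesis by (simp add: fps_mult_nth atLeast0AtMost)
qed

lemma u_log_derivative: "real n * u n = (\<Sum>k\<le>n. real k * b k * v (n - k))"
proof (cases n)
  case (Suc m)
  have "fps_deriv (Abs_fps u) = - fps_deriv (inverse (Abs_fps b))"
    by (rule fps_ext) (simp add: inverse_fps_nth)
  also have "\<dots> = fps_deriv (Abs_fps b) * inverse (Abs_fps b) ^ 2"
    by (subst fps_inverse_deriv) (auto simp: b_0)
  also have "inverse (Abs_fps b) ^ 2 = Abs_fps v"
    by (rule fps_ext) (simp add: v_def)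
  finally have "fps_nth (fps_deriv (Abs_fps u)) m = fps_nth (fps_deriv (Abs_fps b) * Abs_fps v) m" by simp
  then have "real n * u n = (\<Sum>k\<le>m. real (Suc k) * b (Suc k) * v (n - Suc k))"
    by (simp add: Suc fps_mult_nth atLeast0AtMost add.commute)
  also have "\<dots> = (\<Sum>k\<le>n. real k * b k * v (n - k))"
    unfolding Suc by (subst sum.atMost_Suc_shift) simp
  finally show ?thesis .
qed simp

end

section \<open>The exponential of a quotient of power series\<close>

text \<open>
  In addition to \<open>F\<close>, let \<open>G\<close> have the coefficients \<open>h\<^sub>n b\<^sub>n\<close> with \<open>h\<close> increasing from \<open>0\<close> to \<open>L\<close>. The
  coefficients of \<open>W = G / F\<close> are called \<open>g\<close>, those of \<open>exp W\<close> are called \<open>p\<close>, and \<open>e\<close> are those of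
  \<open>L F - G\<close>.
\<close>
locale mirror_seq = log_convex_seq +
  fixes h :: "nat \<Rightarrow> real" and L :: real
  assumes h_0: "h 0 = 0" and h_mono: "h n \<le> h (Suc n)"
    and h_lim: "h \<longlonglongrightarrow> L" and L_pos: "0 < L"
begin

definition W :: "real fps" where
  "W = Abs_fps (\<lambda>n. h n * b n) * inverse (Abs_fps b)"

abbreviation g :: "nat \<Rightarrow> real" where "g \<equiv> fps_nth W"

abbreviation p :: "nat \<Rightarrow> real" where "p \<equiv> fps_nth (fps_exp 1 oo W)"

definition e :: "nat \<Rightarrow> real" where "e n = (L - h n) * b n"

lemma h_incseq: "m \<le> n \<Longrightarrow> h m \<le> h n"
  by (rule lift_Suc_mono_le[of h, OF h_mono])

lemma h_nonneg: "0 \<le> h n"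
  using h_incseq[of 0 n] h_0 by simp

lemma h_le_L: "h n \<le> L"
  by (rule incseq_le[OF _ h_lim]) (auto simp: incseq_def h_incseq)

lemma g_0: "g 0 = 0"
  by (simp add: W_def h_0)

text \<open>
  Subtract \<open>\<Sum> u\<^sub>k b\<^sub>n\<^sub>-\<^sub>k h\<^sub>n\<^sub>-\<^sub>k\<close> from \<open>h\<^sub>n b\<^sub>n\<close> and expand \<open>b\<^sub>n\<close> by the renewal equation. In this form all terms
  are visibly nonnegative.
\<close>
lemma g_nth: "g n = (\<Sum>k\<le>n. u k * b (n - k) * (h n - h (n - k)))"
proof (cases "n = 0")
  case False
  have "g n = (\<Sum>k\<le>n. h k * b k * ((if k = n then 1 else 0) - u (n - k)))"
    by (simp add: W_def fps_mult_nth atLeast0AtMost inverse_fps_nth cong: sum.cong)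
       (rule sum.cong, auto)
  also have "\<dots> = (\<Sum>k\<le>n. h k * b k * (if k = n then 1 else 0)) - (\<Sum>k\<le>n. h k * b k * u (n - k))"
    by (simp add: right_diff_distrib sum_subtractf)
  also have "(\<Sum>k\<le>n. h k * b k * (if k = n then 1 else 0)) = h n * b n"
    by (simp add: if_distrib[of "\<lambda>x. _ * x"] cong: if_cong)
  also have "h n * b n = (\<Sum>k\<le>n. u k * b (n - k) * h n)"
    using renewal[of n] False unfolding sum_distrib_right[symmetric] by (simp add: mult.commute)
  also have "(\<Sum>k\<le>n. h k * b k * u (n - k)) = (\<Sum>k\<le>n. u k * b (n - k) * h (n - k))"
    by (rule sum.reindex_bij_witness[of _ "\<lambda>k. n - k" "\<lambda>k. n - k"]) (auto simp: mult_ac)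
  finally show ?thesis by (simp add: right_diff_distrib sum_subtractf)
qed (simp add: g_0 u_0)

lemma g_nonneg: "0 \<le> g n"
  unfolding g_nth
  by (intro sum_nonneg mult_nonneg_nonneg u_nonneg less_imp_le[OF b_pos]) (simp add: h_incseq)

lemma W_mult: "W * Abs_fps b = Abs_fps (\<lambda>n. h n * b n)"
proof -
  have "inverse (Abs_fps b) * Abs_fps b = 1" using fps_mult_inverse by (simp add: mult.commute)
  then show ?thesis by (simp add: W_def mult.assoc)
qed

lemma sum_g_b: "(\<Sum>k\<le>n. g k * b (n - k)) = h n * b n"
  using arg_cong[OF W_mult, of "\<lambda>f. fps_nth f n"] by (simp add: fps_mult_nth atLeast0AtMost)

lemma g_le_L: "g n \<le> L"
proof -
  have "g n * b (n - n) \<le> (\<Sum>k\<le>n. g k * b (n - k))"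
    by (rule member_le_sum) (auto intro!: mult_nonneg_nonneg g_nonneg less_imp_le[OF b_pos])
  also have "\<dots> = h n * b n" by (rule sum_g_b)
  also have "\<dots> \<le> L * 1"
    by (intro mult_mono h_le_L b_le_1 less_imp_le[OF b_pos] less_imp_le[OF L_pos])
  finally show ?thesis using b_0 by simp
qed

text \<open>
  For \<open>0 \<le> x < 1\<close> one has \<open>W(x) F(x) = G(x) \<le> L F(x)\<close>, hence \<open>W(x) \<le> L\<close>. Since \<open>g \<ge> 0\<close>, each
  partial sum at \<open>x\<close> is bounded by \<open>L\<close> too, and \<open>x\<close> may tend to \<open>1\<close>.
\<close>
lemma sum_g_le_L: "(\<Sum>k\<le>n. g k) \<le> L"
proof -
  have *: "(\<Sum>k\<le>n. g k * x ^ k) \<le> L" if x: "0 \<le> x" "x < 1" for x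
  proof -
    have geom: "summable (\<lambda>n. x ^ n)" using x by (intro summable_geometric) auto
    have sb: "summable (\<lambda>n. norm (b n * x ^ n))"
    proof (rule summable_comparison_test[OF _ geom], intro exI allI impI)
      fix n
      have "b n * x ^ n \<le> 1 * x ^ n" using x by (intro mult_right_mono b_le_1) auto
      moreover have "0 \<le> b n * x ^ n" using x by (intro mult_nonneg_nonneg less_imp_le[OF b_pos]) auto
      ultimately show "norm (norm (b n * x ^ n)) \<le> x ^ n" by simp
    qed
    have sg: "summable (\<lambda>n. norm (g n * x ^ n))"
    proof (rule summable_comparison_test[OF _ summable_mult[OF geom, of L]], intro exI allI impI)
      fix n
      have "g n * x ^ n \<le> L * x ^ n" using x by (intro mult_right_mono g_le_L) auto
      moreover have "0 \<le> g n * x ^ n" using x by (intro mult_nonneg_nonneg g_nonneg) auto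
      ultimately show "norm (norm (g n * x ^ n)) \<le> L * x ^ n" by simp
    qed
    have sb': "summable (\<lambda>n. b n * x ^ n)" using sb by (rule summable_norm_cancel)
    have sg': "summable (\<lambda>n. g n * x ^ n)" using sg by (rule summable_norm_cancel)
    have eq: "(\<Sum>k\<le>i. (g k * x ^ k) * (b (i - k) * x ^ (i - k))) = h i * (b i * x ^ i)" for i
    proof -
      have "(\<Sum>k\<le>i. (g k * x ^ k) * (b (i - k) * x ^ (i - k))) = (\<Sum>k\<le>i. g k * b (i - k)) * x ^ i"
        unfolding sum_distrib_right
      proof (rule sum.cong)
        fix k assume "k \<in> {..i}"
        then have "x ^ i = x ^ k * x ^ (i - k)" by (simp add: power_add[symmetric])
        then show "(g k * x ^ k) * (b (i - k) * x ^ (i - k)) = g k * b (i - k) * x ^ i"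
          by (simp add: mult_ac)
      qed simp
      then show ?thesis by (simp add: sum_g_b)
    qed
    have prod: "(\<lambda>i. h i * (b i * x ^ i)) sums ((\<Sum>i. g i * x ^ i) * (\<Sum>i. b i * x ^ i))"
      using Cauchy_product_sums[OF sg sb] unfolding eq .
    have "(\<Sum>i. g i * x ^ i) * (\<Sum>i. b i * x ^ i) \<le> L * (\<Sum>i. b i * x ^ i)"
    proof (rule sums_le[OF _ prod])
      show "(\<lambda>i. L * (b i * x ^ i)) sums (L * (\<Sum>i. b i * x ^ i))"
        by (intro sums_mult summable_sums sb')
      show "h i * (b i * x ^ i) \<le> L * (b i * x ^ i)" for i
        by (intro mult_right_mono h_le_L mult_nonneg_nonneg less_imp_le[OF b_pos]) (use x in auto)
    qed
    moreover have "0 < (\<Sum>i. b i * x ^ i)"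
      by (rule suminf_pos2[OF sb', of 0]) (use x b_pos less_imp_le in \<open>auto intro!: mult_nonneg_nonneg\<close>)
    ultimately have "(\<Sum>i. g i * x ^ i) \<le> L" by simp
    moreover have "(\<Sum>k\<le>n. g k * x ^ k) \<le> (\<Sum>i. g i * x ^ i)"
      by (rule sum_le_suminf[OF sg']) (use x g_nonneg in auto)
    ultimately show ?thesis by simp
  qed
  have "((\<lambda>x. \<Sum>k\<le>n. g k * x ^ k) \<longlongrightarrow> (\<Sum>k\<le>n. g k * 1 ^ k)) (at_left (1::real))"
    by (intro tendsto_intros)
  moreover have "eventually (\<lambda>x. (\<Sum>k\<le>n. g k * x ^ k) \<le> L) (at_left (1::real))"
    using eventually_at_left_real[of 0 1] by (auto elim!: eventually_mono intro: *)
  ultimately have "(\<Sum>k\<le>n. g k * 1 ^ k) \<le> L"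
    by (intro tendsto_upperbound) auto
  then show ?thesis by simp
qed

lemma W_power_nonneg: "0 \<le> fps_nth (W ^ j) n"
proof (induction j arbitrary: n)
  case (Suc j)
  then show ?case by (simp add: fps_mult_nth) (intro sum_nonneg mult_nonneg_nonneg g_nonneg)
qed simp

lemma sum_W_power_le: "(\<Sum>i\<le>n. fps_nth (W ^ j) i) \<le> L ^ j"
proof (induction j)
  case 0
  have "(\<Sum>i\<le>n. fps_nth (W ^ 0) i) = (\<Sum>i\<in>{0}. fps_nth (W ^ 0) i)"
    by (rule sum.mono_neutral_right) auto
  then show ?case by simp
next
  case (Suc j)
  have "(\<Sum>i\<le>n. fps_nth (W ^ Suc j) i) = (\<Sum>i\<le>n. \<Sum>k\<le>i. g k * fps_nth (W ^ j) (i - k))"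
    by (simp add: fps_mult_nth atLeast0AtMost)
  also have "\<dots> = (\<Sum>k\<le>n. \<Sum>i\<le>n - k. g k * fps_nth (W ^ j) i)"
  proof -
    have "{(k, i). k + i \<le> n} = (SIGMA k:{..n}. {..n - k})" by auto
    then have "(\<Sum>(k, i)\<in>{(k, i). k + i \<le> n}. g k * fps_nth (W ^ j) i)
        = (\<Sum>k\<le>n. \<Sum>i\<le>n - k. g k * fps_nth (W ^ j) i)" by (simp add: sum.Sigma)
    then show ?thesis using sum.triangle_reindex_eq[of "\<lambda>k i. g k * fps_nth (W ^ j) i" n] by simp
  qed
  also have "\<dots> = (\<Sum>k\<le>n. g k * (\<Sum>i\<le>n - k. fps_nth (W ^ j) i))" by (simp add: sum_distrib_left)
  also have "\<dots> \<le> (\<Sum>k\<le>n. g k * L ^ j)"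
  proof (intro sum_mono mult_left_mono g_nonneg)
    fix k
    have "(\<Sum>i\<le>n - k. fps_nth (W ^ j) i) \<le> (\<Sum>i\<le>n. fps_nth (W ^ j) i)"
      by (rule sum_mono2) (auto simp: W_power_nonneg)
    then show "(\<Sum>i\<le>n - k. fps_nth (W ^ j) i) \<le> L ^ j" using Suc.IH by simp
  qed
  also have "\<dots> = (\<Sum>k\<le>n. g k) * L ^ j" by (simp add: sum_distrib_right)
  also have "\<dots> \<le> L * L ^ j" using L_pos by (intro mult_right_mono sum_g_le_L) auto
  finally show ?case by simp
qed

lemma p_nth: "p n = (\<Sum>j\<le>n. fps_nth (W ^ j) n / fact j)"
  by (rule fps_exp_compose_nth)

lemma p_nonneg: "0 \<le> p n"
  unfolding p_nth by (intro sum_nonneg divide_nonneg_nonneg W_power_nonneg) auto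

lemma p_0: "p 0 = 1"
  by (simp add: p_nth)

text \<open>
  Termwise \<open>exp W \<le> exp L\<close>: as \<open>g \<ge> 0\<close>, truncation only decreases the sums, so that the coefficients of
  \<open>W\<^sup>j\<close> sum to at most \<open>L\<^sup>j\<close>.
\<close>
theorem sum_p_le: "(\<Sum>i\<le>n. p i) \<le> exp L"
proof -
  have low: "fps_nth (W ^ j) i = 0" if "i < j" for i j
    using startsby_zero_power_prefix[OF g_0] that by blast
  have "(\<Sum>i\<le>n. p i) = (\<Sum>i\<le>n. \<Sum>j\<le>n. fps_nth (W ^ j) i / fact j)"
    unfolding p_nth by (intro sum.cong sum.mono_neutral_left) (auto simp: low)
  also have "\<dots> = (\<Sum>j\<le>n. (\<Sum>i\<le>n. fps_nth (W ^ j) i) / fact j)"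
    unfolding sum_divide_distrib by (rule sum.swap)
  also have "\<dots> \<le> (\<Sum>j\<le>n. L ^ j / fact j)"
    by (intro sum_mono divide_right_mono sum_W_power_le) auto
  also have "\<dots> \<le> exp L"
  proof -
    have "(\<lambda>j. L ^ j / fact j) sums exp L" using exp_converges[of L] by (simp add: scaleR_conv_of_real field_simps)
    then show ?thesis
      using sum_le_suminf[of "\<lambda>j. L ^ j / fact j" "{..n}"] L_pos by (auto simp: sums_iff)
  qed
  finally show ?thesis .
qed

lemma e_nonneg: "0 \<le> e n"
  unfolding e_def by (intro mult_nonneg_nonneg less_imp_le[OF b_pos]) (simp add: h_le_L)

text \<open>
  From \<open>W = L - E / F = L - E + U E\<close>. This form isolates the main term of \<open>g\<close>, which is invisible in
  \<open>g_nth\<close>.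
\<close>
lemma g_eq_e: "0 < n \<Longrightarrow> g n = (\<Sum>k\<le>n. u k * e (n - k)) - e n"
proof -
  assume n: "0 < n"
  have u: "inverse (Abs_fps b) = 1 - Abs_fps u" by (rule fps_ext) (simp add: inverse_fps_nth)
  have "Abs_fps (\<lambda>n. h n * b n) = fps_const L * Abs_fps b - Abs_fps e"
    by (rule fps_ext) (simp add: e_def algebra_simps)
  then have "W = fps_const L * (Abs_fps b * inverse (Abs_fps b)) - Abs_fps e * inverse (Abs_fps b)"
    by (simp add: W_def left_diff_distrib mult.assoc)
  also have "\<dots> = fps_const L - Abs_fps e + Abs_fps u * Abs_fps e"
    unfolding fps_mult_inverse unfolding u by (simp add: algebra_simps)
  finally show ?thesis using n by (simp add: fps_mult_nth atLeast0AtMost)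
qed

text \<open>
  The coefficients of \<open>U E\<close> contribute \<open>\<mu> E(1)\<close> and those of \<open>E\<close> nothing at the scale of \<open>w\<close>, so \<open>g\<^sub>n\<close>
  is asymptotic to \<open>\<mu> E(1) w\<^sub>n\<close>. The constant is positive because \<open>e\<^sub>0 = L > 0\<close>, and the exponential
  multiplies it by \<open>exp (W(1)) \<ge> 1\<close>.
\<close>
theorem exp_coefficient_limit:
  assumes "slow_weight w K"
    and u: "(\<lambda>n. u n / w n) \<longlonglongrightarrow> \<mu>" and \<mu>: "0 < \<mu>"
    and e: "(\<lambda>n. e n / w n) \<longlonglongrightarrow> 0"
  obtains \<kappa> where "0 < \<kappa>" "(\<lambda>n. p n / w n) \<longlonglongrightarrow> \<kappa>"
proof -
  interpret slow_weight w K by fact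
  define \<gamma> where "\<gamma> = \<mu> * suminf e"
  have se: "summable e"
    by (rule tendsto_imp_bound[OF e]) (blast intro: summable_rabs_cancel bound_imp_summable)
  have "(\<lambda>n. (\<Sum>k\<le>n. u k * e (n - k)) / w n - e n / w n) \<longlonglongrightarrow> (0 * suminf u + \<mu> * suminf e) - 0"
    by (intro tendsto_diff convolution_tendsto u e)
  moreover have "eventually (\<lambda>n. (\<Sum>k\<le>n. u k * e (n - k)) / w n - e n / w n = g n / w n) sequentially"
    using eventually_gt_at_top[of 0] by eventually_elim (simp add: g_eq_e diff_divide_distrib)
  ultimately have g: "(\<lambda>n. g n / w n) \<longlonglongrightarrow> \<gamma>"
    by (simp add: \<gamma>_def Lim_transform_eventually)
  have "0 < e 0" by (simp add: e_def h_0 L_pos b_0)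
  then have "0 < suminf e" by (intro suminf_pos2[OF se e_nonneg])
  then have \<gamma>: "0 < \<gamma>" using \<mu> by (simp add: \<gamma>_def)
  have "0 < (\<Sum>n. p n)"
    by (rule suminf_pos2[OF exp_compose_tendsto(1)[OF g_0 g] p_nonneg, of 0]) (simp add: p_0)
  then show ?thesis using exp_compose_tendsto(2)[OF g_0 g] \<gamma> by (intro that) auto
qed

end

section \<open>Asymptotics of the first-recurrence probabilities\<close>

context log_convex_seq
begin

text \<open>
  When \<open>F(1)\<close> is finite, \<open>U' = F' / F\<^sup>2\<close> gives \<open>u\<^sub>n\<close> the same order as \<open>b\<^sub>n\<close>, with the factor
  \<open>1 / F(1)\<^sup>2\<close>; it is nonzero because \<open>F(1) \<cdot> (1 / F)(1) = 1\<close>.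
\<close>
theorem transient_coefficient_limit:
  assumes "slow_weight w K" and b: "(\<lambda>n. b n / w n) \<longlonglongrightarrow> \<beta>" and \<beta>: "0 < \<beta>"
  obtains \<mu> where "0 < \<mu>" "(\<lambda>n. u n / w n) \<longlonglongrightarrow> \<mu>"
proof -
  interpret slow_weight w K by fact
  obtain M where M: "0 < M" "\<And>n. \<bar>b n\<bar> \<le> M * w n" by (rule tendsto_imp_bound[OF b]) blast
  have v: "\<bar>v n\<bar> \<le> 2 * M * w n" for n
    using abs_v_le[of n] M(2)[of n] by simp
  define c where "c = fps_nth (inverse (Abs_fps b))"
  have c: "summable (\<lambda>n. norm (c n))"
  proof (rule summable_comparison_test)
    show "summable (\<lambda>n. (if n = 0 then 1 else 0) + u n)"
      by (intro summable_add summable_u summable_finite[of "{0}"]) auto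
    show "\<exists>N. \<forall>n\<ge>N. norm (norm (c n)) \<le> (if n = 0 then 1 else 0) + u n"
      using u_nonneg by (auto simp: c_def inverse_fps_nth u_0)
  qed
  have sb: "summable (\<lambda>n. norm (b n))" using bound_imp_summable[OF M(2)] by simp
  have "(\<lambda>n. \<Sum>i\<le>n. c i * c (n - i)) sums (suminf c * suminf c)" by (rule Cauchy_product_sums[OF c c])
  moreover have "(\<Sum>i\<le>n. c i * c (n - i)) = v n" for n
    by (simp add: c_def v_def power2_eq_square fps_mult_nth atLeast0AtMost)
  ultimately have sv: "suminf v = suminf c * suminf c" by (simp add: sums_iff)
  have "(\<lambda>n. \<Sum>i\<le>n. b i * c (n - i)) sums (suminf b * suminf c)" by (rule Cauchy_product_sums[OF sb c])
  moreover have "(\<Sum>i\<le>n. b i * c (n - i)) = (if n = 0 then 1 else 0)" for n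
    using arg_cong[OF fps_mult_inverse, of "\<lambda>f. fps_nth f n"]
    by (simp add: c_def fps_mult_nth atLeast0AtMost)
  ultimately have "(\<lambda>n. if n = 0 then 1 else 0) sums (suminf b * suminf c)" by simp
  moreover have "(\<lambda>n. if n = 0 then 1 else 0 :: real) sums 1" using sums_single[of 0 "\<lambda>_. 1 :: real"] by simp
  ultimately have "suminf b * suminf c = 1" by (metis sums_unique2)
  then have "suminf c \<noteq> 0" by auto
  then have "0 < suminf v" unfolding sv using mult_pos_pos mult_neg_neg by (metis linorder_neqE_linordered_idom)
  then show ?thesis
    using log_derivative_transfer[OF u_log_derivative b v] \<beta> by (intro that) auto
qed

end

text \<open>
  The critical case: \<open>b\<^sub>n\<close> is asymptotic to \<open>\<kappa> / n\<close>, so \<open>F(1)\<close> just diverges and \<open>1 / F\<close> vanishes at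
  \<open>1\<close>. The sum of \<open>v\<close> is then \<open>0\<close>, and the size of \<open>n u\<^sub>n\<close> is governed by the rate at which the partial
  sums of \<open>v\<close> tend to \<open>0\<close>.
\<close>
locale log_renewal = log_convex_seq +
  fixes \<kappa> D :: real
  assumes \<kappa>_pos: "0 < \<kappa>" and b_approx: "0 < n \<Longrightarrow> \<bar>real n * b n - \<kappa>\<bar> \<le> D / real n"
begin

text \<open>
  The factor \<open>2\<close> allows for \<open>n + 1\<close> in place of \<open>n\<close> in \<open>b_le\<close>, and the summand \<open>1\<close> for \<open>b\<^sub>0 = 1\<close>.
\<close>
definition c :: real where "c = 2 * (\<kappa> + D) + 1"

lemma D_nonneg: "0 \<le> D"
  using b_approx[of 1] by simp

lemma c_pos: "0 < c"
  using \<kappa>_pos D_nonneg by (simp add: c_def)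

lemma b_le: "b n \<le> c / (real n + 1)"
proof (cases "n = 0")
  case False
  have "D / real n \<le> D" using D_nonneg False by (simp add: divide_le_eq mult_le_cancel_left1)
  then have 1: "real n * b n \<le> \<kappa> + D" using b_approx[of n] False by linarith
  have "(real n + 1) * b n \<le> (2 * real n) * b n"
    using False less_imp_le[OF b_pos[of n]] by (intro mult_right_mono) auto
  also have "\<dots> \<le> c" using 1 by (simp add: c_def)
  finally show ?thesis by (simp add: le_divide_eq mult.commute)
qed (use \<kappa>_pos D_nonneg in \<open>simp add: b_0 c_def\<close>)

lemma sum_b_asymp: "(\<lambda>n. (\<Sum>k\<le>n. b k) / ln (real n)) \<longlonglongrightarrow> \<kappa>"
proof -
  define f where "f = (\<lambda>k. b k - \<kappa> / real k)"
  have "summable f"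
  proof (rule summable_comparison_test)
    have "summable (\<lambda>n. inverse (real n ^ 2))" by (rule inverse_power_summable) simp
    then show "summable (\<lambda>n. D * inverse (real n ^ 2))" by (rule summable_mult)
    show "\<exists>N. \<forall>n\<ge>N. norm (f n) \<le> D * inverse (real n ^ 2)"
    proof (intro exI allI impI)
      fix n :: nat assume n: "1 \<le> n"
      have "f n = (real n * b n - \<kappa>) / real n" using n by (simp add: f_def field_simps)
      then have "norm (f n) = \<bar>real n * b n - \<kappa>\<bar> / real n" by simp
      also have "\<dots> \<le> D / real n / real n" using n by (intro divide_right_mono b_approx) auto
      finally show "norm (f n) \<le> D * inverse (real n ^ 2)" by (simp add: field_simps power2_eq_square)
    qed
  qed
  then have f: "(\<lambda>n. \<Sum>k\<le>n. f k) \<longlonglongrightarrow> suminf f" by (rule summable_LIMSEQ')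
  have "(\<lambda>n. ((\<Sum>k\<le>n. f k) + \<kappa> * (harm n - ln (real n))) * (1 / ln (real n)) + \<kappa>)
      \<longlonglongrightarrow> (suminf f + \<kappa> * euler_mascheroni) * 0 + \<kappa>"
    by (intro tendsto_intros f euler_mascheroni_LIMSEQ) real_asymp
  moreover have "eventually (\<lambda>n. ((\<Sum>k\<le>n. f k) + \<kappa> * (harm n - ln (real n))) * (1 / ln (real n)) + \<kappa>
      = (\<Sum>k\<le>n. b k) / ln (real n)) sequentially"
    using eventually_gt_at_top[of 1]
  proof eventually_elim
    case (elim n)
    have "(\<Sum>k\<le>n. \<kappa> / real k) = (\<Sum>k=1..n. \<kappa> / real k)"
      by (rule sum.mono_neutral_right) auto
    also have "\<dots> = \<kappa> * harm n" by (simp add: harm_def sum_distrib_left divide_inverse)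
    finally have "(\<Sum>k\<le>n. f k) = (\<Sum>k\<le>n. b k) - \<kappa> * harm n" by (simp add: f_def sum_subtractf)
    then show ?case using elim by (simp add: field_simps)
  qed
  ultimately show ?thesis by (simp add: Lim_transform_eventually)
qed

lemma sum_b_pos: "0 < (\<Sum>k\<le>n. b k)"
  by (rule sum_pos) (auto simp: b_pos)

lemma T_upper: "T n * (\<Sum>k\<le>n. b k) \<le> 1"
proof -
  have "T n * (\<Sum>k\<le>n. b k) = (\<Sum>k\<le>n. b k * T n)" by (simp add: sum_distrib_left mult.commute)
  also have "\<dots> \<le> (\<Sum>k\<le>n. b k * T (n - k))"
    by (intro sum_mono mult_left_mono T_decr less_imp_le[OF b_pos]) auto
  finally show ?thesis by (simp add: renewal_tail)
qed

text \<open>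
  In \<open>1 = \<Sum> b\<^sub>k T\<^sub>n\<^sub>-\<^sub>k\<close>, the first \<open>n - m\<close> terms have \<open>T\<^sub>n\<^sub>-\<^sub>k \<le> T\<^sub>m\<close>, and the last \<open>m\<close> terms have small \<open>b\<^sub>k\<close>.
\<close>
lemma T_lower:
  assumes "m \<le> n"
  shows "1 \<le> T m * (\<Sum>k\<le>n. b k) + real m * (c / (real (n - m) + 1))"
proof -
  have "1 = (\<Sum>k\<le>n. b k * T (n - k))" by (simp add: renewal_tail)
  also have "\<dots> \<le> (\<Sum>k\<le>n. T m * b k + (if n - m < k then c / (real (n - m) + 1) else 0))"
  proof (rule sum_mono)
    fix k assume k: "k \<in> {..n}"
    show "b k * T (n - k) \<le> T m * b k + (if n - m < k then c / (real (n - m) + 1) else 0)"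
    proof (cases "n - m < k")
      case True
      have "b k * T (n - k) \<le> b (n - m) * 1"
        using True by (intro mult_mono b_antimono T_le_1 less_imp_le[OF b_pos] T_nonneg) auto
      also have "\<dots> \<le> c / (real (n - m) + 1)" using b_le[of "n - m"] by simp
      finally show ?thesis using True T_nonneg[of m] b_pos[of k] by (simp add: add_increasing)
    next
      case False
      have "T (n - k) \<le> T m" using False k assms by (intro T_decr) auto
      then have "b k * T (n - k) \<le> b k * T m" by (intro mult_left_mono less_imp_le[OF b_pos])
      then show ?thesis using False by (simp add: mult.commute)
    qed
  qed
  also have "\<dots> = T m * (\<Sum>k\<le>n. b k) + (\<Sum>k\<in>{n - m<..n}. c / (real (n - m) + 1))"
  proof -
    have "(\<Sum>k\<le>n. if n - m < k then c / (real (n - m) + 1) else 0) = (\<Sum>k\<in>{n - m<..n}. c / (real (n - m) + 1))"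
      by (rule sum.mono_neutral_cong_right) auto
    then show ?thesis by (simp add: sum.distrib sum_distrib_left)
  qed
  also have "\<dots> = T m * (\<Sum>k\<le>n. b k) + real m * (c / (real (n - m) + 1))" using assms by simp
  finally show ?thesis .
qed

text \<open>
  The bounds \<open>T_upper\<close> and \<open>T_lower\<close> match because the partial sums of \<open>b\<close> vary slowly: with \<open>n = m N\<close>
  and \<open>N\<close> of order \<open>ln m\<close>, the error in \<open>T_lower\<close> is \<open>O(1 / N)\<close> while \<open>ln n\<close> and \<open>ln m\<close> are still
  asymptotic.
\<close>
lemma T_asymp: "(\<lambda>n. T n * ln (real n)) \<longlonglongrightarrow> 1 / \<kappa>"
proof (rule tendsto_sandwich)
  define N where "N = (\<lambda>m. nat \<lceil>ln (real m)\<rceil> + 2)"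
  have N: "filterlim (\<lambda>m. m * N m) at_top sequentially"
    by (rule filterlim_at_top_mono[OF filterlim_ident]) (auto simp: N_def)
  define lo where "lo = (\<lambda>m. (1 - c / (real (N m) - 1)) * (ln (real m) / ln (real (m * N m)) / ((\<Sum>k\<le>m * N m. b k) / ln (real (m * N m)))))"
  show "lo \<longlonglongrightarrow> 1 / \<kappa>"
  proof -
    have "(\<lambda>m. 1 / (real (N m) - 1)) \<longlonglongrightarrow> 0" unfolding N_def by real_asymp
    then have "(\<lambda>m. 1 - c * (1 / (real (N m) - 1))) \<longlonglongrightarrow> 1 - c * 0" by (intro tendsto_intros)
    then have 1: "(\<lambda>m. 1 - c / (real (N m) - 1)) \<longlonglongrightarrow> 1" by simp
    have 2: "(\<lambda>m. ln (real m) / ln (real (m * N m))) \<longlonglongrightarrow> 1" unfolding N_def by real_asymp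
    have "lo \<longlonglongrightarrow> 1 * (1 / \<kappa>)" unfolding lo_def
      by (intro tendsto_mult tendsto_divide 1 2 filterlim_compose[OF sum_b_asymp N]) (use \<kappa>_pos in auto)
    then show ?thesis by simp
  qed
  show "(\<lambda>m. ln (real m) / (\<Sum>k\<le>m. b k)) \<longlonglongrightarrow> 1 / \<kappa>"
    using tendsto_divide[OF tendsto_const[of 1] sum_b_asymp] \<kappa>_pos by simp
  show "eventually (\<lambda>m. lo m \<le> T m * ln (real m)) sequentially"
    using eventually_gt_at_top[of 1]
  proof eventually_elim
    case (elim m)
    have "m * 2 \<le> m * N m" by (rule mult_le_mono2) (simp add: N_def)
    then have mn: "m \<le> m * N m" and big: "1 < m * N m" using elim by linarith+
    have N2: "2 \<le> real (N m)" by (simp add: N_def)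
    have "real 1 < real (m * N m)" using big by (simp only: of_nat_less_iff)
    then have ln: "0 < ln (real (m * N m))" "0 < ln (real m)" using elim by (auto intro: ln_gt_zero)
    have "real m * (c / (real (m * N m - m) + 1)) \<le> real m * (c / (real m * (real (N m) - 1)))"
    proof (intro mult_left_mono divide_left_mono)
      show "real m * (real (N m) - 1) \<le> real (m * N m - m) + 1"
        using mn by (simp add: of_nat_diff algebra_simps)
      show "0 < (real (m * N m - m) + 1) * (real m * (real (N m) - 1))"
      proof (intro mult_pos_pos)
        show "0 < real (m * N m - m) + 1" by (rule add_nonneg_pos) (rule of_nat_0_le_iff, simp)
      qed (use elim N2 in auto)
    qed (use c_pos in auto)
    also have "\<dots> = c / (real (N m) - 1)" using elim by simp
    finally have "1 - c / (real (N m) - 1) \<le> T m * (\<Sum>k\<le>m * N m. b k)"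
      using T_lower[OF mn] by simp
    then have "(1 - c / (real (N m) - 1)) / (\<Sum>k\<le>m * N m. b k) \<le> T m"
      using sum_b_pos[of "m * N m"] by (simp add: divide_le_eq)
    then have "(1 - c / (real (N m) - 1)) / (\<Sum>k\<le>m * N m. b k) * ln (real m) \<le> T m * ln (real m)"
      using ln by (intro mult_right_mono) auto
    moreover have "lo m = (1 - c / (real (N m) - 1)) / (\<Sum>k\<le>m * N m. b k) * ln (real m)"
      unfolding lo_def using ln(1) by simp
    ultimately show ?case by simp
  qed
  show "eventually (\<lambda>m. T m * ln (real m) \<le> ln (real m) / (\<Sum>k\<le>m. b k)) sequentially"
    using eventually_gt_at_top[of 1]
  proof eventually_elim
    case (elim m)
    have "T m \<le> 1 / (\<Sum>k\<le>m. b k)" using T_upper[of m] sum_b_pos[of m] by (simp add: le_divide_eq)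
    then have "T m * ln (real m) \<le> 1 / (\<Sum>k\<le>m. b k) * ln (real m)"
      using elim by (intro mult_right_mono) auto
    then show ?case by simp
  qed
qed

text \<open>
  Summation by parts.
\<close>
lemma sum_mult_u: "(\<Sum>k\<le>n. real k * u k) = (\<Sum>j<n. T j - T n)"
proof (induction n)
  case (Suc n)
  have "T (Suc n) = T n - u (Suc n)" by (simp add: T_def)
  then have "(\<Sum>j<Suc n. T j - T (Suc n)) = (\<Sum>j<Suc n. (T j - T n) + u (Suc n))"
    by (intro sum.cong) auto
  also have "\<dots> = (\<Sum>j<Suc n. T j - T n) + (\<Sum>j<Suc n. u (Suc n))" by (rule sum.distrib)
  also have "\<dots> = (\<Sum>j<n. T j - T n) + real (Suc n) * u (Suc n)" by simp
  finally show ?case using Suc.IH by simp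
qed simp

text \<open>
  A truncated mean of \<open>u\<close>, divided by \<open>n\<close>. By \<open>sum_mult_u\<close> it measures how far the average of
  \<open>T\<close> over \<open>{..<n}\<close> exceeds \<open>T\<^sub>n\<close>.
\<close>
definition A :: "nat \<Rightarrow> real" where "A n = (\<Sum>k\<le>n. real k * u k) / real n"

lemma A_nonneg: "0 \<le> A n"
  unfolding A_def by (intro divide_nonneg_nonneg sum_nonneg mult_nonneg_nonneg u_nonneg) auto

lemma A_le:
  assumes "0 < n" and that: "m \<le> n"
  shows "A n \<le> real m / real n + (T m - T n)"
proof -
  have "(\<Sum>k\<le>n. real k * u k) \<le> (\<Sum>j<n. (if j < m then 1 else 0) + (T m - T n))"
    unfolding sum_mult_u
  proof (rule sum_mono)
    fix j assume "j \<in> {..<n}"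
    show "T j - T n \<le> (if j < m then 1 else 0) + (T m - T n)"
      using T_le_1[of j] T_decr[OF that] T_decr[of m j] T_nonneg[of m] by (cases "j < m") auto
  qed
  also have "\<dots> = real m + real n * (T m - T n)"
  proof -
    have "(\<Sum>j<n. if j < m then 1 else 0 :: real) = (\<Sum>j<m. 1)"
      using that by (intro sum.mono_neutral_cong_right) auto
    then show ?thesis by (simp add: sum.distrib)
  qed
  finally have "A n \<le> (real m + real n * (T m - T n)) / real n"
    unfolding A_def by (rule divide_right_mono) simp
  also have "\<dots> = real m / real n + (T m - T n)" using assms by (simp add: add_divide_distrib)
  finally show ?thesis .
qed

text \<open>
  As \<open>T\<close> is decreasing and slowly varying, averaging it changes it only by \<open>o(1 / ln n)\<close>.
\<close>
lemma A_small: "(\<lambda>n. A n * ln (real n)) \<longlonglongrightarrow> 0"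
proof (rule tendsto_sandwich[where f = "\<lambda>_. 0"])
  \<comment> \<open>The cut-off is small enough for \<open>m ln n / n\<close> to vanish and large enough for \<open>ln m\<close> and \<open>ln n\<close> to agree.\<close>
  define m where "m = (\<lambda>n. nat \<lfloor>real n / ln (real n) ^ 2\<rfloor>)"
  have m: "filterlim m at_top sequentially"
    unfolding m_def by real_asymp
  have ratio: "(\<lambda>n. ln (real n) / ln (real (m n))) \<longlonglongrightarrow> 1" unfolding m_def by real_asymp
  have "(\<lambda>n. T (m n) * ln (real (m n)) * (ln (real n) / ln (real (m n)))) \<longlonglongrightarrow> 1 / \<kappa> * 1"
    by (intro tendsto_mult ratio filterlim_compose[OF T_asymp m])
  moreover have "eventually (\<lambda>n. T (m n) * ln (real (m n)) * (ln (real n) / ln (real (m n))) = T (m n) * ln (real n)) sequentially"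
    using eventually_compose_filterlim[OF eventually_gt_at_top[of 1] m] by eventually_elim simp
  ultimately have Tm: "(\<lambda>n. T (m n) * ln (real n)) \<longlonglongrightarrow> 1 / \<kappa>"
    by (simp add: Lim_transform_eventually)
  have "(\<lambda>n. real (m n) / real n * ln (real n)) \<longlonglongrightarrow> 0" unfolding m_def by real_asymp
  then have "(\<lambda>n. real (m n) / real n * ln (real n) + (T (m n) * ln (real n) - T n * ln (real n))) \<longlonglongrightarrow> 0 + (1 / \<kappa> - 1 / \<kappa>)"
    by (intro tendsto_intros Tm T_asymp)
  then show "(\<lambda>n. real (m n) / real n * ln (real n) + (T (m n) * ln (real n) - T n * ln (real n))) \<longlonglongrightarrow> 0"
    by simp
  have "eventually (\<lambda>n. ln (real n) ^ 2 \<ge> 1) sequentially" by real_asymp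
  then show "eventually (\<lambda>n. A n * ln (real n) \<le> real (m n) / real n * ln (real n) + (T (m n) * ln (real n) - T n * ln (real n))) sequentially"
    using eventually_gt_at_top[of 1]
  proof eventually_elim
    case (elim n)
    have "real n / ln (real n) ^ 2 \<le> real n" using elim by (simp add: divide_le_eq mult_le_cancel_left1)
    then have "m n \<le> n" unfolding m_def by linarith
    then have "A n * ln (real n) \<le> (real (m n) / real n + (T (m n) - T n)) * ln (real n)"
      using elim by (intro mult_right_mono A_le) auto
    then show ?case by (simp add: algebra_simps)
  qed
  show "eventually (\<lambda>n. 0 \<le> A n * ln (real n)) sequentially"
    using eventually_gt_at_top[of 1] by eventually_elim (simp add: A_nonneg)
qed simp

text \<open>
  The amount by which the partial sums of \<open>v\<close> fall short of \<open>T\<^sub>n\<^sup>2\<close>, the value they would have if \<open>T\<close> were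
  constant on \<open>{..n}\<close>.
\<close>
definition R :: "nat \<Rightarrow> real" where "R n = (\<Sum>k\<le>n. u k * (T (n - k) - T n))"

lemma sum_v_R: "(\<Sum>k\<le>n. v k) = T n ^ 2 - R n"
proof -
  have "R n = (\<Sum>k\<le>n. u k * T (n - k)) - (\<Sum>k\<le>n. u k) * T n"
    by (simp add: R_def right_diff_distrib sum_subtractf sum_distrib_right)
  also have "(\<Sum>k\<le>n. u k) = 1 - T n" by (simp add: T_def)
  finally show ?thesis unfolding sum_v by (simp add: power2_eq_square algebra_simps)
qed

lemma R_nonneg: "0 \<le> R n"
  unfolding R_def by (intro sum_nonneg mult_nonneg_nonneg u_nonneg) (auto simp: T_decr)

text \<open>
  Here \<open>\<beta>\<close> bounds \<open>u\<close> on the upper half of the range. For \<open>k \<le> n / 2\<close> it bounds the increments in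
  \<open>T\<^sub>n\<^sub>-\<^sub>k - T\<^sub>n \<le> k \<beta>\<close>, and for \<open>k > n / 2\<close> it bounds the factor \<open>u\<^sub>k\<close>; in both cases what remains sums to
  \<open>n A\<^sub>n\<close>. Hence a bound on \<open>u\<close> turns into a bound on \<open>R\<close>, and by \<open>u_remainder_le\<close> into a
  better bound on \<open>u\<close>.
\<close>
lemma R_le:
  assumes \<beta>: "\<And>j. n \<le> 2 * j \<Longrightarrow> j \<le> n \<Longrightarrow> u j \<le> \<beta>" and n: "0 < n"
  shows "R n \<le> 2 * \<beta> * real n * A n"
proof -
  have \<beta>0: "0 \<le> \<beta>" using \<beta>[of n] u_nonneg[of n] by simp
  have "R n \<le> (\<Sum>k\<le>n. \<beta> * (real k * u k) + \<beta> * (T (n - k) - T n))"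
    unfolding R_def
  proof (rule sum_mono)
    fix k assume "k \<in> {..n}"
    then have k: "k \<le> n" by simp
    have T: "0 \<le> T (n - k) - T n" by (simp add: T_decr)
    show "u k * (T (n - k) - T n) \<le> \<beta> * (real k * u k) + \<beta> * (T (n - k) - T n)"
    proof (cases "2 * k \<le> n")
      case True
      have "{..n} = {..n - k} \<union> {n - k<..n}" by auto
      then have "(\<Sum>j\<le>n. u j) = (\<Sum>j\<le>n - k. u j) + (\<Sum>j\<in>{n - k<..n}. u j)"
        by (simp only:) (rule sum.union_disjoint, auto)
      then have "T (n - k) - T n = (\<Sum>j\<in>{n - k<..n}. u j)" by (simp add: T_def)
      also have "\<dots> \<le> real (card {n - k<..n}) * \<beta>"
        by (rule sum_bounded_above) (use True in \<open>auto intro!: \<beta>\<close>)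
      finally have "T (n - k) - T n \<le> real k * \<beta>" using k by simp
      then have "u k * (T (n - k) - T n) \<le> u k * (real k * \<beta>)" by (intro mult_left_mono u_nonneg)
      moreover have "0 \<le> \<beta> * (T (n - k) - T n)" using \<beta>0 T by simp
      ultimately show ?thesis by (simp add: mult_ac)
    next
      case False
      then have "u k * (T (n - k) - T n) \<le> \<beta> * (T (n - k) - T n)"
        using k by (intro mult_right_mono \<beta> T) auto
      moreover have "0 \<le> \<beta> * (real k * u k)" using \<beta>0 u_nonneg[of k] by simp
      ultimately show ?thesis by simp
    qed
  qed
  also have "\<dots> = \<beta> * (\<Sum>k\<le>n. real k * u k) + \<beta> * (\<Sum>k\<le>n. T (n - k) - T n)"
    by (simp add: sum.distrib sum_distrib_left)
  also have "(\<Sum>k\<le>n. T (n - k) - T n) = (\<Sum>k\<le>n. T k - T n)"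
    by (rule sum.reindex_bij_witness[of _ "\<lambda>k. n - k" "\<lambda>k. n - k"]) auto
  also have "\<dots> = (\<Sum>k<n. T k - T n)" by (simp add: lessThan_Suc_atMost[symmetric])
  also have "\<dots> = (\<Sum>k\<le>n. real k * u k)" by (rule sum_mult_u[symmetric])
  also have "(\<Sum>k\<le>n. real k * u k) = real n * A n" using n by (simp add: A_def)
  finally show ?thesis by (simp add: algebra_simps)
qed

lemma sum_inverse_products:
  "(\<Sum>k\<le>n. 1 / ((real k + 1) * (real (n - k) + 1))) = 2 * harm (Suc n) / (real n + 2)"
proof -
  have "(\<Sum>k\<le>n. 1 / ((real k + 1) * (real (n - k) + 1)))
      = (\<Sum>k\<le>n. (1 / (real k + 1) + 1 / (real (n - k) + 1)) / (real n + 2))"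
    by (rule sum.cong) (auto simp: of_nat_diff divide_simps)
  also have "\<dots> = ((\<Sum>k\<le>n. 1 / (real k + 1)) + (\<Sum>k\<le>n. 1 / (real (n - k) + 1))) / (real n + 2)"
    by (simp add: sum_divide_distrib[symmetric] sum.distrib)
  also have "(\<Sum>k\<le>n. 1 / (real (n - k) + 1)) = (\<Sum>k\<le>n. 1 / (real k + 1))"
    by (rule sum.reindex_bij_witness[of _ "\<lambda>k. n - k" "\<lambda>k. n - k"]) auto
  also have "(\<Sum>k\<le>n. 1 / (real k + 1)) = harm (Suc n)"
    by (simp add: harm_altdef lessThan_Suc_atMost inverse_eq_divide add.commute)
  finally show ?thesis by simp
qed

text \<open>
  The identity \<open>U' = F' / F\<^sup>2\<close> expresses \<open>n u\<^sub>n\<close> as the convolution of \<open>k b\<^sub>k\<close> and \<open>v\<close>. Replacing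
  \<open>k b\<^sub>k\<close> by its limit \<open>\<kappa>\<close> yields \<open>\<kappa>\<close> times a partial sum of \<open>v\<close>; the error is a convolution of two
  sequences of size \<open>O(1 / k)\<close>, and thus \<open>O(ln n / n)\<close>.
\<close>
lemma u_remainder_le:
  "\<bar>real n * u n - \<kappa> * (T n ^ 2 - R n)\<bar> \<le> (\<kappa> + 2 * D) * (2 * c) * (2 * harm (Suc n) / (real n + 2))"
proof -
  have d: "\<bar>real k * b k - \<kappa>\<bar> \<le> (\<kappa> + 2 * D) / (real k + 1)" for k
  proof (cases "k = 0")
    case False
    have "\<bar>real k * b k - \<kappa>\<bar> \<le> D / real k" using b_approx[of k] False by simp
    also have "\<dots> \<le> (2 * D) / (real k + 1)"
    proof -
      have "D * 1 \<le> D * real k" using False D_nonneg by (intro mult_left_mono) auto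
      then show ?thesis using False by (simp add: field_simps)
    qed
    also have "\<dots> \<le> (\<kappa> + 2 * D) / (real k + 1)" using \<kappa>_pos by (intro divide_right_mono) auto
    finally show ?thesis .
  qed (use \<kappa>_pos D_nonneg in simp)
  have v: "\<bar>v j\<bar> \<le> 2 * c / (real j + 1)" for j using abs_v_le[of j] b_le[of j] by simp
  have "(\<Sum>k\<le>n. v k) = (\<Sum>k\<le>n. v (n - k))"
    by (rule sum.reindex_bij_witness[of _ "\<lambda>k. n - k" "\<lambda>k. n - k"]) auto
  then have "real n * u n - \<kappa> * (T n ^ 2 - R n) = (\<Sum>k\<le>n. (real k * b k - \<kappa>) * v (n - k))"
    unfolding u_log_derivative sum_v_R[symmetric]
    by (simp add: left_diff_distrib sum_subtractf sum_distrib_left)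
  also have "\<bar>\<dots>\<bar> \<le> (\<Sum>k\<le>n. (\<kappa> + 2 * D) * (2 * c) * (1 / ((real k + 1) * (real (n - k) + 1))))"
  proof (rule order_trans[OF sum_abs sum_mono])
    fix k
    have "\<bar>(real k * b k - \<kappa>) * v (n - k)\<bar> \<le> (\<kappa> + 2 * D) / (real k + 1) * (2 * c / (real (n - k) + 1))"
      unfolding abs_mult using \<kappa>_pos D_nonneg by (intro mult_mono d v) auto
    then show "\<bar>(real k * b k - \<kappa>) * v (n - k)\<bar>
        \<le> (\<kappa> + 2 * D) * (2 * c) * (1 / ((real k + 1) * (real (n - k) + 1)))" by simp
  qed
  also have "\<dots> = (\<kappa> + 2 * D) * (2 * c) * (2 * harm (Suc n) / (real n + 2))"
    unfolding sum_distrib_left[symmetric] sum_inverse_products ..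
  finally show ?thesis .
qed

lemma u_remainder_tendsto:
  "(\<lambda>n. (real n * u n - \<kappa> * (T n ^ 2 - R n)) * ln (real n) ^ 2) \<longlonglongrightarrow> 0"
proof (rule Lim_null_comparison)
  define M where "M = (\<kappa> + 2 * D) * (2 * c)"
  have "(\<lambda>n. harm (Suc n) - ln (real (Suc n))) \<longlonglongrightarrow> euler_mascheroni"
    by (rule LIMSEQ_Suc[OF euler_mascheroni_LIMSEQ])
  moreover have "(\<lambda>n. ln (real n) ^ 2 / (real n + 2)) \<longlonglongrightarrow> 0"
    "(\<lambda>n. ln (real (Suc n)) * (ln (real n) ^ 2 / (real n + 2))) \<longlonglongrightarrow> 0" by real_asymp+
  ultimately have "(\<lambda>n. M * (2 * ((harm (Suc n) - ln (real (Suc n))) * (ln (real n) ^ 2 / (real n + 2))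
      + ln (real (Suc n)) * (ln (real n) ^ 2 / (real n + 2))))) \<longlonglongrightarrow> M * (2 * (euler_mascheroni * 0 + 0))"
    by (intro tendsto_intros)
  moreover have "M * (2 * ((H - l) * (q / d) + l * (q / d))) = M * (2 * H / d) * q" for H l q d :: real
    by (simp add: left_diff_distrib right_diff_distrib diff_divide_distrib)
  ultimately show "(\<lambda>n. M * (2 * harm (Suc n) / (real n + 2)) * ln (real n) ^ 2) \<longlonglongrightarrow> 0"
    by simp
  show "eventually (\<lambda>n. norm ((real n * u n - \<kappa> * (T n ^ 2 - R n)) * ln (real n) ^ 2)
      \<le> M * (2 * harm (Suc n) / (real n + 2)) * ln (real n) ^ 2) sequentially"
  proof (intro always_eventually allI)
    fix n
    have "norm ((real n * u n - \<kappa> * (T n ^ 2 - R n)) * ln (real n) ^ 2)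
        = \<bar>real n * u n - \<kappa> * (T n ^ 2 - R n)\<bar> * ln (real n) ^ 2" by (simp add: abs_mult)
    also have "\<dots> \<le> M * (2 * harm (Suc n) / (real n + 2)) * ln (real n) ^ 2"
      unfolding M_def by (intro mult_right_mono u_remainder_le) simp
    finally show "norm ((real n * u n - \<kappa> * (T n ^ 2 - R n)) * ln (real n) ^ 2)
        \<le> M * (2 * harm (Suc n) / (real n + 2)) * ln (real n) ^ 2" .
  qed
qed

lemma T_square_asymp: "(\<lambda>n. T n ^ 2 * ln (real n) ^ 2) \<longlonglongrightarrow> (1 / \<kappa>) ^ 2"
  using tendsto_power[OF T_asymp, of 2] by (simp add: power_mult_distrib)

lemma inverse_ln_tendsto: "(\<lambda>n. 1 / ln (real n)) \<longlonglongrightarrow> 0"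
  by real_asymp

text \<open>
  First round: inserting the trivial bound \<open>u\<^sub>n \<le> b\<^sub>n = O(1 / n)\<close> into \<open>R_le\<close>.
\<close>
lemma u_first_estimate: "(\<lambda>n. real n * u n * ln (real n)) \<longlonglongrightarrow> 0"
proof -
  have R: "(\<lambda>n. R n * ln (real n)) \<longlonglongrightarrow> 0"
  proof (rule Lim_null_comparison)
    show "(\<lambda>n. 4 * c * (A n * ln (real n))) \<longlonglongrightarrow> 0"
      using tendsto_mult[OF tendsto_const A_small, of "4 * c"] by simp
    show "eventually (\<lambda>n. norm (R n * ln (real n)) \<le> 4 * c * (A n * ln (real n))) sequentially"
      using eventually_gt_at_top[of 1]
    proof eventually_elim
      case (elim n)
      have "R n \<le> 2 * (2 * c / real n) * real n * A n"
      proof (rule R_le)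
        fix j assume j: "n \<le> 2 * j" "j \<le> n"
        have "u j \<le> c / (real j + 1)" using u_le_b[of j] b_le[of j] by simp
        also have "\<dots> \<le> c / (real n / 2)" using j elim c_pos by (intro divide_left_mono) auto
        finally show "u j \<le> 2 * c / real n" by (simp add: mult.commute)
      qed (use elim in simp)
      also have "\<dots> = 4 * c * A n" using elim by simp
      finally have "R n * ln (real n) \<le> 4 * c * A n * ln (real n)" using elim by (intro mult_right_mono) auto
      then show ?case using R_nonneg[of n] elim by (simp add: abs_mult mult.assoc)
    qed
  qed
  have "(\<lambda>n. (real n * u n - \<kappa> * (T n ^ 2 - R n)) * ln (real n) ^ 2 * (1 / ln (real n))
      + \<kappa> * (T n ^ 2 * ln (real n) ^ 2 * (1 / ln (real n)) - R n * ln (real n)))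
      \<longlonglongrightarrow> 0 * 0 + \<kappa> * ((1 / \<kappa>) ^ 2 * 0 - 0)"
    by (intro tendsto_intros u_remainder_tendsto T_square_asymp inverse_ln_tendsto R)
  moreover have "eventually (\<lambda>n. (real n * u n - \<kappa> * (T n ^ 2 - R n)) * ln (real n) ^ 2 * (1 / ln (real n))
      + \<kappa> * (T n ^ 2 * ln (real n) ^ 2 * (1 / ln (real n)) - R n * ln (real n)) = real n * u n * ln (real n)) sequentially"
    using eventually_gt_at_top[of 1]
  proof eventually_elim
    case (elim n)
    have "(x - \<kappa> * (t - r)) * l ^ 2 * (1 / l) + \<kappa> * (t * l ^ 2 * (1 / l) - r * l) = x * l"
      if "l \<noteq> 0" for x t r l :: real
      using that by (simp add: power2_eq_square algebra_simps)
    then show ?case using elim by simp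
  qed
  ultimately show ?thesis by (simp add: Lim_transform_eventually)
qed

text \<open>
  Second round: inserting \<open>u\<^sub>n = o(1 / (n ln n))\<close> into \<open>R_le\<close> gives \<open>R\<^sub>n = o(1 / ln\<^sup>2 n)\<close>, which is below the
  order of \<open>T\<^sub>n\<^sup>2\<close>. The function \<open>J\<close> picks an index in \<open>[n / 2, n]\<close> at which \<open>u\<close> is largest.
\<close>
lemma R_second_estimate: "(\<lambda>n. R n * ln (real n) ^ 2) \<longlonglongrightarrow> 0"
proof -
  have "\<exists>j. n \<le> 2 * j \<and> j \<le> n \<and> (\<forall>i. n \<le> 2 * i \<longrightarrow> i \<le> n \<longrightarrow> u i \<le> u j)" for n
  proof -
    let ?I = "{i. n \<le> 2 * i \<and> i \<le> n}"
    have fin: "finite ?I" by (rule finite_subset[of _ "{..n}"]) auto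
    have "n \<in> ?I" by simp
    then have "u ` ?I \<noteq> {}" by blast
    then have "Max (u ` ?I) \<in> u ` ?I" using fin by (intro Max_in) auto
    then obtain j where "j \<in> ?I" "Max (u ` ?I) = u j" by auto
    moreover have "u i \<le> Max (u ` ?I)" if "i \<in> ?I" for i using that fin by (intro Max_ge) auto
    ultimately show ?thesis by auto
  qed
  then obtain J where J: "\<And>n. n \<le> 2 * J n" "\<And>n. J n \<le> n"
      "\<And>n i. n \<le> 2 * i \<Longrightarrow> i \<le> n \<Longrightarrow> u i \<le> u (J n)" by metis
  have half: "n div 2 \<le> J n" for n using J(1)[of n] by presburger
  have "filterlim (\<lambda>n. n div 2) at_top sequentially" by real_asymp
  then have Jlim: "filterlim J at_top sequentially"
    by (rule filterlim_at_top_mono) (simp add: half)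
  show ?thesis
  proof (rule Lim_null_comparison)
    show "(\<lambda>n. 8 * (real (J n) * u (J n) * ln (real (J n))) * (A n * ln (real n))) \<longlonglongrightarrow> 0"
      using tendsto_mult[OF tendsto_mult[OF tendsto_const[of 8] filterlim_compose[OF u_first_estimate Jlim]] A_small] by simp
    show "eventually (\<lambda>n. norm (R n * ln (real n) ^ 2) \<le> 8 * (real (J n) * u (J n) * ln (real (J n))) * (A n * ln (real n))) sequentially"
      using eventually_ge_at_top[of 4]
    proof eventually_elim
      case (elim n)
      have Jn: "2 \<le> J n" "real n \<le> 2 * real (J n)" using J(1)[of n] elim by linarith+
      have "real n \<le> real (J n) ^ 2"
      proof -
        have "2 * real (J n) \<le> real (J n) * real (J n)" using Jn by (intro mult_right_mono) auto
        then show ?thesis using Jn(2) unfolding power2_eq_square by linarith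
      qed
      then have "ln (real n) \<le> ln (real (J n) ^ 2)" using elim Jn by (subst ln_le_cancel_iff) auto
      also have "\<dots> = 2 * ln (real (J n))" using Jn by (simp add: ln_realpow)
      finally have ln: "ln (real n) \<le> 2 * ln (real (J n))" .
      have "R n \<le> 2 * u (J n) * real n * A n" by (rule R_le) (use J(3) elim in auto)
      then have "R n * ln (real n) ^ 2 \<le> 2 * u (J n) * real n * A n * ln (real n) ^ 2"
        by (intro mult_right_mono) auto
      also have "\<dots> = 2 * u (J n) * (real n * ln (real n)) * (A n * ln (real n))"
        by (simp add: power2_eq_square)
      also have "\<dots> \<le> 2 * u (J n) * ((2 * real (J n)) * (2 * ln (real (J n)))) * (A n * ln (real n))"
        using Jn ln elim u_nonneg[of "J n"] A_nonneg[of n]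
        by (intro mult_right_mono mult_left_mono mult_mono mult_nonneg_nonneg) auto
      also have "\<dots> = 8 * (real (J n) * u (J n) * ln (real (J n))) * (A n * ln (real n))" by simp
      finally show ?case using R_nonneg[of n] by (simp add: abs_mult)
    qed
  qed
qed

text \<open>
  Now \<open>n u\<^sub>n\<close> is asymptotic to \<open>\<kappa> T\<^sub>n\<^sup>2\<close>, and \<open>T\<^sub>n\<close> to \<open>1 / (\<kappa> ln n)\<close>.
\<close>
theorem critical_coefficient_limit: "(\<lambda>n. real n * u n * ln (real n) ^ 2) \<longlonglongrightarrow> 1 / \<kappa>"
proof -
  have "(\<lambda>n. (real n * u n - \<kappa> * (T n ^ 2 - R n)) * ln (real n) ^ 2
      + \<kappa> * (T n ^ 2 * ln (real n) ^ 2 - R n * ln (real n) ^ 2)) \<longlonglongrightarrow> 0 + \<kappa> * ((1 / \<kappa>) ^ 2 - 0)"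
    by (intro tendsto_intros u_remainder_tendsto T_square_asymp R_second_estimate)
  moreover have "(real n * u n - \<kappa> * (T n ^ 2 - R n)) * ln (real n) ^ 2
      + \<kappa> * (T n ^ 2 * ln (real n) ^ 2 - R n * ln (real n) ^ 2) = real n * u n * ln (real n) ^ 2" for n
    by (simp add: algebra_simps)
  ultimately show ?thesis using \<kappa>_pos by (simp add: power2_eq_square)
qed

end

section \<open>Two families of weights\<close>

lemma slow_weight_powr:
  assumes s: "1 < s"
  shows "slow_weight (\<lambda>n. (real n + 1) powr - s) (2 powr s)"
proof
  fix n k :: nat
  show "0 < (real n + 1) powr - s" by simp
  show "(real k + 1) powr - s \<le> 2 powr s * (real n + 1) powr - s" if "k \<le> n" "n \<le> 2 * k"
  proof -
    have "(real k + 1) powr - s \<le> ((real n + 1) / 2) powr - s"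
      using that s by (intro powr_mono2') auto
    also have "\<dots> = 2 powr s * (real n + 1) powr - s" by (simp add: powr_divide powr_minus divide_simps)
    finally show ?thesis .
  qed
next
  have "summable (\<lambda>n. real n powr - s)" using s by (simp add: summable_real_powr_iff)
  then have "summable (\<lambda>n. real (Suc n) powr - s)" by (subst summable_Suc_iff)
  then show "summable (\<lambda>n. (real n + 1) powr - s)" by (simp add: add.commute)
  have "(\<lambda>n. ((real (Suc n) + 1) / (real n + 1)) powr - s) \<longlonglongrightarrow> 1 powr - s"
    by (intro tendsto_powr tendsto_const) (real_asymp | simp)+
  then show "(\<lambda>n. (real (Suc n) + 1) powr - s / (real n + 1) powr - s) \<longlonglongrightarrow> 1"
    by (simp add: powr_divide)
qed

text \<open>
  Summable since, up to a constant factor, the weight is the difference of consecutive values of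
  \<open>1 / ln (n + 2)\<close>.
\<close>
lemma slow_weight_log:
  obtains K where "slow_weight (\<lambda>n. 1 / ((real n + 2) * ln (real n + 2) ^ 2)) K"
proof
  let ?w = "\<lambda>n. 1 / ((real n + 2) * ln (real n + 2) ^ 2)"
  \<comment> \<open>For \<open>n \<le> 2 k\<close>, the factor \<open>n + 2\<close> is at most twice \<open>k + 2\<close>, and the squared logarithm at most four times its value at \<open>k\<close>.\<close>
  show "slow_weight ?w 8"
  proof
    fix n k :: nat
    show "0 < ?w n" by simp
    show "?w k \<le> 8 * ?w n" if "k \<le> n" "n \<le> 2 * k"
    proof -
      have kn: "real n + 2 \<le> 2 * (real k + 2)" using that by simp
      also have "\<dots> \<le> (real k + 2) * (real k + 2)" by (intro mult_right_mono) auto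
      finally have "ln (real n + 2) \<le> ln ((real k + 2) * (real k + 2))" by (subst ln_le_cancel_iff) auto
      also have "\<dots> = 2 * ln (real k + 2)" by (subst ln_mult) auto
      finally have "ln (real n + 2) ^ 2 \<le> (2 * ln (real k + 2)) ^ 2" by (intro power_mono) auto
      then have "(real n + 2) * ln (real n + 2) ^ 2 \<le> 2 * (real k + 2) * (2 * ln (real k + 2)) ^ 2"
        using kn by (intro mult_mono) auto
      also have "\<dots> = 8 * ((real k + 2) * ln (real k + 2) ^ 2)" by (simp add: power_mult_distrib)
      finally have "1 / (8 * ((real k + 2) * ln (real k + 2) ^ 2)) \<le> 1 / ((real n + 2) * ln (real n + 2) ^ 2)"
        by (intro divide_left_mono) auto
      from mult_left_mono[OF this, of 8] show ?thesis by simp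
    qed
  next
    have "(\<lambda>n. - (1 / ln (real (Suc n) + 2)) - (- (1 / ln (real n + 2)))) sums (0 - (- (1 / ln (real 0 + 2))))"
      by (rule telescope_sums) real_asymp
    then have tele: "summable (\<lambda>n. - (1 / ln (real (Suc n) + 2)) - (- (1 / ln (real n + 2))))"
      by (rule sums_summable)
    have nonneg: "0 \<le> - (1 / ln (real (Suc n) + 2)) - (- (1 / ln (real n + 2)))" for n
      by (simp add: frac_le)
    have "?w \<in> O(\<lambda>n. - (1 / ln (real (Suc n) + 2)) - (- (1 / ln (real n + 2))))" by real_asymp
    then show "summable ?w" by (rule summable_comparison_test_bigo[rotated]) (use tele nonneg in simp)
    show "(\<lambda>n. ?w (Suc n) / ?w n) \<longlonglongrightarrow> 1" by real_asymp
  qed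
qed

section \<open>Hypergeometric coefficients\<close>

lemma prod_list_map_pos:
  fixes f :: "'a \<Rightarrow> real"
  assumes "\<And>x. x \<in> set xs \<Longrightarrow> 0 < f x"
  shows "0 < (\<Prod>x\<leftarrow>xs. f x)"
  using assms by (induction xs) auto

lemma prod_list_map_mono:
  fixes f g :: "'a \<Rightarrow> real"
  assumes "\<And>x. x \<in> set xs \<Longrightarrow> 0 \<le> f x \<and> f x \<le> g x"
  shows "0 \<le> (\<Prod>x\<leftarrow>xs. f x) \<and> (\<Prod>x\<leftarrow>xs. f x) \<le> (\<Prod>x\<leftarrow>xs. g x)"
  using assms by (induction xs) (auto intro!: mult_mono mult_nonneg_nonneg intro: order_trans)

definition hypergeometric_coeff :: "real list \<Rightarrow> nat \<Rightarrow> real" where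
  "hypergeometric_coeff as n = (\<Prod>a\<leftarrow>as. pochhammer a n / fact n)"

definition harmonic_excess :: "real list \<Rightarrow> nat \<Rightarrow> real" where
  "harmonic_excess as n = (\<Sum>a\<leftarrow>as. H_sum a n - H_sum 1 n)"

definition coeff_ratio :: "real list \<Rightarrow> nat \<Rightarrow> real" where
  "coeff_ratio as n = (\<Prod>a\<leftarrow>as. (a + real n) / (1 + real n))"

lemma hypergeometric_coeff_Suc:
  "hypergeometric_coeff as (Suc n) = hypergeometric_coeff as n * coeff_ratio as n"
proof (induction as)
  case (Cons a as)
  have "pochhammer a (Suc n) / fact (Suc n) = pochhammer a n / fact n * ((a + real n) / (1 + real n))"
    by (simp add: pochhammer_Suc)
  then show ?case using Cons.IH
    unfolding hypergeometric_coeff_def coeff_ratio_def list.map prod_list.Cons by (simp only: mult_ac)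
qed (simp add: hypergeometric_coeff_def coeff_ratio_def)

lemma harmonic_excess_Suc:
  "harmonic_excess as (Suc n) = harmonic_excess as n + (\<Sum>a\<leftarrow>as. 1 / (a + real n) - 1 / (1 + real n))"
  unfolding harmonic_excess_def by (induction as) (simp_all add: H_sum_def)

text \<open>
  Gauss's product formula for the Gamma function.
\<close>
lemma pochhammer_asymp:
  fixes a :: real
  assumes "0 < a"
  shows "(\<lambda>n. pochhammer a n / fact n * real n powr (1 - a)) \<longlonglongrightarrow> 1 / Gamma a"
proof -
  have G: "Gamma a \<noteq> 0" using Gamma_real_pos[OF assms] by simp
  have "(\<lambda>n. 1 / Gamma_series a n * (real n / (a + real n))) \<longlonglongrightarrow> 1 / Gamma a * 1"
  proof (intro tendsto_mult tendsto_divide tendsto_const Gamma_series_LIMSEQ G)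
    show "(\<lambda>n. real n / (a + real n)) \<longlonglongrightarrow> 1" by real_asymp
  qed
  moreover have "eventually (\<lambda>n. 1 / Gamma_series a n * (real n / (a + real n))
      = pochhammer a n / fact n * real n powr (1 - a)) sequentially"
    using eventually_gt_at_top[of 0]
  proof eventually_elim
    case (elim n)
    have e: "exp (a * ln (real n)) = real n powr a" using elim by (simp add: powr_def)
    have "a + real n \<noteq> 0" using assms by simp
    then show ?case using elim
      by (simp add: Gamma_series_def e pochhammer_Suc powr_diff add.commute)
  qed
  ultimately show ?thesis by (simp add: Lim_transform_eventually)
qed

lemma hypergeometric_coeff_asymp:
  assumes "\<And>a. a \<in> set as \<Longrightarrow> 0 < a"
  shows "(\<lambda>n. hypergeometric_coeff as n * real n powr (\<Sum>a\<leftarrow>as. 1 - a)) \<longlonglongrightarrow> (\<Prod>a\<leftarrow>as. 1 / Gamma a)"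
  using assms
proof (induction as)
  case Nil
  have "(\<lambda>n. real n powr 0) \<longlonglongrightarrow> 1"
    by (rule tendsto_eventually) (use eventually_gt_at_top[of 0] in eventually_elim, simp)
  then show ?case by (simp add: hypergeometric_coeff_def)
next
  case (Cons a as)
  have "(\<lambda>n. (pochhammer a n / fact n * real n powr (1 - a)) *
      (hypergeometric_coeff as n * real n powr (\<Sum>a\<leftarrow>as. 1 - a))) \<longlonglongrightarrow> 1 / Gamma a * (\<Prod>a\<leftarrow>as. 1 / Gamma a)"
    by (intro tendsto_mult pochhammer_asymp Cons.IH Cons.prems) auto
  then show ?case by (simp add: hypergeometric_coeff_def powr_add mult_ac)
qed

text \<open>
  The condition \<open>balanced\<close> holds for all parameter lists that are symmetric under \<open>a \<mapsto> 1 - a\<close>. It is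
  what makes the decay exponent of the coefficients equal to half the number of parameters.
\<close>
locale hypergeometric =
  fixes as :: "real list" and L :: real
  assumes nonempty: "as \<noteq> []"
    and pos: "a \<in> set as \<Longrightarrow> 0 < a" and less_1: "a \<in> set as \<Longrightarrow> a < 1"
    and balanced: "sum_list as = real (length as) / 2"
    and excess_lim: "harmonic_excess as \<longlonglongrightarrow> L"
begin

lemma ratio_mono:
  assumes "m \<le> n"
  shows "coeff_ratio as m \<le> coeff_ratio as n"
proof -
  have "0 \<le> (a + real m) / (1 + real m) \<and> (a + real m) / (1 + real m) \<le> (a + real n) / (1 + real n)"
    if "a \<in> set as" for a
  proof -
    have a: "0 < a" "a < 1" using that pos less_1 by auto
    have "a * (real n - real m) \<le> 1 * (real n - real m)" using a assms by (intro mult_right_mono) auto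
    then show ?thesis using a by (simp add: divide_simps) (simp add: algebra_simps)
  qed
  then show ?thesis unfolding coeff_ratio_def by (intro conjunct2[OF prod_list_map_mono]) simp
qed

lemma ratio_le_1: "coeff_ratio as n \<le> 1"
proof -
  have "0 \<le> (a + real n) / (1 + real n) \<and> (a + real n) / (1 + real n) \<le> 1" if "a \<in> set as" for a
    using pos[OF that] less_1[OF that] by simp
  then have "coeff_ratio as n \<le> (\<Prod>a\<leftarrow>as. 1)"
    unfolding coeff_ratio_def by (intro conjunct2[OF prod_list_map_mono]) simp
  also have "(\<Prod>a\<leftarrow>as. 1) = (1 :: real)" by (induction as) auto
  finally show ?thesis .
qed

lemma increment_nonneg: "0 \<le> (\<Sum>a\<leftarrow>as. 1 / (a + real n) - 1 / (1 + real n))"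
proof (rule sum_list_nonneg)
  fix x assume "x \<in> set (map (\<lambda>a. 1 / (a + real n) - 1 / (1 + real n)) as)"
  then obtain a where "a \<in> set as" "x = 1 / (a + real n) - 1 / (1 + real n)" by auto
  then show "0 \<le> x" using pos[of a] less_1[of a] by (simp add: frac_le)
qed

lemma increment_le:
  assumes "0 < n"
  shows "(\<Sum>a\<leftarrow>as. 1 / (a + real n) - 1 / (1 + real n)) \<le> real (length as) * (1 / real n - 1 / real (Suc n))"
proof -
  have "(\<Sum>a\<leftarrow>as. 1 / (a + real n) - 1 / (1 + real n)) \<le> (\<Sum>a\<leftarrow>as. 1 / real n - 1 / real (Suc n))"
  proof (rule sum_list_mono)
    fix a assume "a \<in> set as"
    then show "1 / (a + real n) - 1 / (1 + real n) \<le> 1 / real n - 1 / real (Suc n)"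
      using assms pos[of a] by (simp add: frac_le add.commute)
  qed
  then show ?thesis by (simp add: sum_list_triv)
qed

lemma excess_0: "harmonic_excess as 0 = 0"
  unfolding harmonic_excess_def by (induction as) (simp_all add: H_sum_def)

lemma excess_mono: "harmonic_excess as n \<le> harmonic_excess as (Suc n)"
  using increment_nonneg[of n] by (simp add: harmonic_excess_Suc)

lemma L_pos: "0 < L"
proof -
  have "0 < (\<Sum>a\<leftarrow>as. 1 / (a + real 0) - 1 / (1 + real 0))"
  proof -
    obtain a xs where as: "as = a # xs" using nonempty by (cases as) auto
    have "0 < 1 / a - 1" using pos[of a] less_1[of a] as by simp
    moreover have "0 \<le> (\<Sum>a\<leftarrow>xs. 1 / (a + real 0) - 1 / (1 + real 0))"
      by (rule sum_list_nonneg) (use pos less_1 as in force)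
    ultimately show ?thesis by (simp add: as)
  qed
  then have "0 < harmonic_excess as 1" using harmonic_excess_Suc[of as 0] excess_0 by simp
  also have "\<dots> \<le> L" by (rule incseq_le[OF _ excess_lim]) (simp add: incseq_Suc_iff excess_mono)
  finally show ?thesis .
qed

sublocale mirror_seq "hypergeometric_coeff as" "harmonic_excess as" L
proof
  have b_pos: "0 < hypergeometric_coeff as n" for n
    unfolding hypergeometric_coeff_def
    by (rule prod_list_map_pos) (simp add: pochhammer_pos pos)
  fix n
  show "0 < hypergeometric_coeff as n" by (rule b_pos)
  show "hypergeometric_coeff as 0 = 1"
    unfolding hypergeometric_coeff_def by (induction as) simp_all
  show "hypergeometric_coeff as (Suc n) \<le> hypergeometric_coeff as n"
    using b_pos[of n] ratio_le_1[of n] by (simp add: hypergeometric_coeff_Suc mult_left_le)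
  have "hypergeometric_coeff as (Suc n) * hypergeometric_coeff as n * coeff_ratio as n
      \<le> hypergeometric_coeff as (Suc n) * hypergeometric_coeff as n * coeff_ratio as (Suc n)"
    by (intro mult_left_mono ratio_mono mult_nonneg_nonneg less_imp_le[OF b_pos]) auto
  then show "(hypergeometric_coeff as (Suc n))\<^sup>2 \<le> hypergeometric_coeff as n * hypergeometric_coeff as (Suc (Suc n))"
    using hypergeometric_coeff_Suc[of as "Suc n"] hypergeometric_coeff_Suc[of as n]
    by (simp add: power2_eq_square mult_ac)
  show "harmonic_excess as 0 = 0" by (rule excess_0)
  show "harmonic_excess as n \<le> harmonic_excess as (Suc n)" by (rule excess_mono)
  show "harmonic_excess as \<longlonglongrightarrow> L" by (rule excess_lim)
  show "0 < L" by (rule L_pos)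
qed

text \<open>
  The increments of the excess at \<open>n\<close> are at most those of \<open>- length as / n\<close>, so the bound telescopes.
\<close>
lemma L_minus_excess_le:
  assumes "0 < n"
  shows "L - harmonic_excess as n \<le> real (length as) / real n"
proof -
  have *: "harmonic_excess as (n + j) - harmonic_excess as n \<le> real (length as) * (1 / real n - 1 / real (n + j))" for j
  proof (induction j)
    case (Suc j)
    then show ?case using increment_le[of "n + j"] assms by (simp add: harmonic_excess_Suc algebra_simps)
  qed simp
  have "harmonic_excess as (n + j) \<le> harmonic_excess as n + real (length as) / real n" for j
  proof -
    have "real (length as) * (1 / real n - 1 / real (n + j)) \<le> real (length as) * (1 / real n)"
      by (intro mult_left_mono) auto
    then show ?thesis using *[of j] by simp
  qed
  moreover have "(\<lambda>j. harmonic_excess as (j + n)) \<longlonglongrightarrow> L" by (rule LIMSEQ_ignore_initial_segment[OF excess_lim])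
  ultimately have "L \<le> harmonic_excess as n + real (length as) / real n"
    by (intro LIMSEQ_le_const2[of _ L]) (auto simp: add.commute)
  then show ?thesis by simp
qed

lemma sum_complement: "(\<Sum>a\<leftarrow>as. 1 - a) = real (length as) / 2"
proof -
  have "(\<Sum>a\<leftarrow>xs. 1 - a) = real (length xs) - sum_list xs" for xs :: "real list"
    by (induction xs) auto
  then show ?thesis by (simp add: balanced)
qed

definition gamma_const :: real where "gamma_const = (\<Prod>a\<leftarrow>as. 1 / Gamma a)"

lemma gamma_const_pos: "0 < gamma_const"
  unfolding gamma_const_def by (rule prod_list_map_pos) (simp add: Gamma_real_pos pos)

lemma coeff_asymp:
  "(\<lambda>n. hypergeometric_coeff as n * real n powr (real (length as) / 2)) \<longlonglongrightarrow> gamma_const"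
  using hypergeometric_coeff_asymp[of as, OF pos] by (simp only: sum_complement gamma_const_def)

theorem exp_coefficient_limit_ge_3:
  assumes "3 \<le> length as"
  obtains \<kappa> where "0 < \<kappa>" "(\<lambda>n. p n / (real n + 1) powr - (real (length as) / 2)) \<longlonglongrightarrow> \<kappa>"
proof -
  define s where "s = real (length as) / 2"
  have s: "1 < s" using assms by (simp add: s_def)
  define w where "w = (\<lambda>n. (real n + 1) powr - s)"
  have sw: "slow_weight w (2 powr s)" unfolding w_def by (rule slow_weight_powr[OF s])
  have "(\<lambda>n. hypergeometric_coeff as n * real n powr s * ((real n + 1) / real n) powr s) \<longlonglongrightarrow> gamma_const * 1 powr s"
    by (intro tendsto_mult tendsto_powr tendsto_const coeff_asymp[folded s_def]) (real_asymp | simp)+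
  moreover have "eventually (\<lambda>n. hypergeometric_coeff as n * real n powr s * ((real n + 1) / real n) powr s
      = hypergeometric_coeff as n / w n) sequentially"
    using eventually_gt_at_top[of 0]
    by eventually_elim (simp add: w_def powr_divide powr_minus divide_simps)
  ultimately have b: "(\<lambda>n. hypergeometric_coeff as n / w n) \<longlonglongrightarrow> gamma_const"
    by (simp add: Lim_transform_eventually)
  have "(\<lambda>n. (L - harmonic_excess as n) * (hypergeometric_coeff as n / w n)) \<longlonglongrightarrow> (L - L) * gamma_const"
    by (intro tendsto_intros b excess_lim)
  then have e: "(\<lambda>n. e n / w n) \<longlonglongrightarrow> 0" by (simp add: e_def)
  obtain \<mu> where "0 < \<mu>" "(\<lambda>n. u n / w n) \<longlonglongrightarrow> \<mu>"
    using transient_coefficient_limit[OF sw b gamma_const_pos] by blast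
  then show ?thesis
    using exp_coefficient_limit[OF sw _ _ e] that unfolding w_def s_def by blast
qed

text \<open>
  For two parameters with \<open>\<alpha> + \<beta> = 1\<close>, the sequence \<open>x\<^sub>n = n b\<^sub>n\<close> satisfies
  \<open>x\<^sub>n\<^sub>+\<^sub>1 = x\<^sub>n (1 + \<alpha> \<beta> / (n (n + 1)))\<close>. It increases to its limit with error \<open>O(1 / n)\<close>, which is the
  input of the critical renewal analysis.
\<close>
theorem exp_coefficient_limit_2:
  assumes len: "length as = 2"
  obtains \<kappa> where "0 < \<kappa>" "(\<lambda>n. p n / (1 / ((real n + 2) * ln (real n + 2) ^ 2))) \<longlonglongrightarrow> \<kappa>"
proof -
  define w where "w = (\<lambda>n. 1 / ((real n + 2) * ln (real n + 2) ^ 2))"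
  obtain K where sw: "slow_weight w K" unfolding w_def using slow_weight_log by blast
  define x where "x = (\<lambda>n. real n * hypergeometric_coeff as n)"
  obtain \<alpha> \<beta> where as: "as = [\<alpha>, \<beta>]" using len by (auto simp: length_Suc_conv numeral_2_eq_2)
  have ab: "\<alpha> + \<beta> = 1" "0 < \<alpha>" "0 < \<beta>" using balanced pos by (auto simp: as)
  define t where "t = \<alpha> * \<beta>"
  have t: "0 < t" using ab by (simp add: t_def)
  have xlim: "x \<longlonglongrightarrow> gamma_const"
  proof -
    have "(\<lambda>n. hypergeometric_coeff as n * real n powr 1) \<longlonglongrightarrow> gamma_const"
      using coeff_asymp len by simp
    moreover have "(\<lambda>n. hypergeometric_coeff as n * real n powr 1) = x"
      by (auto simp: x_def mult.commute)
    ultimately show ?thesis by simp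
  qed
  have x_Suc: "x (Suc n) = x n + x n * t * (1 / real n - 1 / real (Suc n))" if "0 < n" for n
  proof -
    have "(\<alpha> + real n) * (\<beta> + real n) = t + real n * (\<alpha> + \<beta>) + real n * real n"
      by (simp add: t_def algebra_simps)
    then have "coeff_ratio as n = (t + real n + real n * real n) / ((1 + real n) * (1 + real n))"
      using ab(1) by (simp add: coeff_ratio_def as)
    then have "(1 + real n) * coeff_ratio as n = real n + t / (1 + real n)"
      by (simp add: divide_simps) (simp add: algebra_simps)
    then have "x (Suc n) = hypergeometric_coeff as n * (real n + t / (1 + real n))"
      by (simp add: x_def hypergeometric_coeff_Suc mult_ac)
    also have "t / (1 + real n) = real n * t * (1 / real n - 1 / real (Suc n))"
      using that by (simp add: divide_simps)
    finally show ?thesis by (simp add: x_def algebra_simps)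
  qed
  have x_nonneg: "0 \<le> x n" for n using b_pos[of n] by (simp add: x_def)
  have x_mono: "x n \<le> x (Suc n)" if "0 < n" for n
  proof -
    have "0 \<le> x n * t * (1 / real n - 1 / real (Suc n))"
      using that t x_nonneg[of n] by (intro mult_nonneg_nonneg) (auto simp: frac_le)
    then show ?thesis using x_Suc[OF that] by simp
  qed
  have x_le: "x n \<le> gamma_const" for n
  proof (cases "n = 0")
    case False
    have "incseq (\<lambda>j. x (j + n))" by (rule incseq_SucI) (use x_mono False in simp)
    then show ?thesis using incseq_le[OF _ LIMSEQ_ignore_initial_segment[OF xlim, of n], of 0] by simp
  qed (use gamma_const_pos in \<open>simp add: x_def\<close>)
  interpret log_renewal "hypergeometric_coeff as" gamma_const "gamma_const * t"
  proof
    show "0 < gamma_const" by (rule gamma_const_pos)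
    fix n :: nat assume n: "0 < n"
    have *: "x (n + j) - x n \<le> gamma_const * t * (1 / real n - 1 / real (n + j))" for j
    proof (induction j)
      case (Suc j)
      have "x (n + j) * t * (1 / real (n + j) - 1 / real (Suc (n + j)))
          \<le> gamma_const * t * (1 / real (n + j) - 1 / real (Suc (n + j)))"
        using n t by (intro mult_right_mono x_le) (auto simp: frac_le)
      then show ?case using Suc.IH x_Suc[of "n + j"] n by (simp add: algebra_simps)
    qed simp
    have "x (j + n) \<le> x n + gamma_const * t / real n" for j
    proof -
      have "gamma_const * t * (1 / real n - 1 / real (n + j)) \<le> gamma_const * t * (1 / real n)"
        using gamma_const_pos t by (intro mult_left_mono) auto
      then show ?thesis using *[of j] by (simp add: add.commute)
    qed
    then have "gamma_const \<le> x n + gamma_const * t / real n"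
      by (intro LIMSEQ_le_const2[OF LIMSEQ_ignore_initial_segment[OF xlim, of n]]) auto
    then show "\<bar>real n * hypergeometric_coeff as n - gamma_const\<bar> \<le> gamma_const * t / real n"
      using x_le[of n] by (simp add: x_def)
  qed
  have "(\<lambda>n. real n * u n * ln (real n) ^ 2 * ((real n + 2) * ln (real n + 2) ^ 2 / (real n * ln (real n) ^ 2)))
      \<longlonglongrightarrow> 1 / gamma_const * 1"
    by (intro tendsto_mult critical_coefficient_limit) real_asymp
  moreover have "eventually (\<lambda>n. real n * u n * ln (real n) ^ 2 * ((real n + 2) * ln (real n + 2) ^ 2 / (real n * ln (real n) ^ 2))
      = u n / w n) sequentially"
    using eventually_gt_at_top[of 1] by eventually_elim (simp add: w_def)
  ultimately have u: "(\<lambda>n. u n / w n) \<longlonglongrightarrow> 1 / gamma_const"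
    by (simp add: Lim_transform_eventually)
  have e: "(\<lambda>n. e n / w n) \<longlonglongrightarrow> 0"
  proof (rule Lim_null_comparison)
    have "(\<lambda>n. 2 * gamma_const * ((real n + 2) * ln (real n + 2) ^ 2 / (real n * real n))) \<longlonglongrightarrow> 2 * gamma_const * 0"
      by (intro tendsto_mult tendsto_const) real_asymp
    then show "(\<lambda>n. 2 * gamma_const * ((real n + 2) * ln (real n + 2) ^ 2 / (real n * real n))) \<longlonglongrightarrow> 0" by simp
    show "eventually (\<lambda>n. norm (e n / w n) \<le> 2 * gamma_const * ((real n + 2) * ln (real n + 2) ^ 2 / (real n * real n))) sequentially"
      using eventually_gt_at_top[of 0]
    proof eventually_elim
      case (elim n)
      have "hypergeometric_coeff as n \<le> gamma_const / real n"
        using x_le[of n] elim by (simp add: x_def le_divide_eq mult.commute)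
      then have "e n \<le> 2 / real n * (gamma_const / real n)"
        unfolding e_def using L_minus_excess_le[OF elim] len less_imp_le[OF b_pos[of n]] gamma_const_pos
        by (intro mult_mono) auto
      then have "e n * ((real n + 2) * ln (real n + 2) ^ 2) \<le> 2 / real n * (gamma_const / real n) * ((real n + 2) * ln (real n + 2) ^ 2)"
        by (intro mult_right_mono) auto
      then show ?case using e_nonneg[of n] by (simp add: w_def abs_mult)
    qed
  qed
  show ?thesis
    using exp_coefficient_limit[OF sw u _ e] gamma_const_pos that unfolding w_def by auto
qed

end

section \<open>Limits of the harmonic sums\<close>

lemma harm_add: "(harm (a + n) :: real) = harm a + (\<Sum>r=1..n. 1 / (real a + real r))"
proof (induction n)
  case 0
  show ?case by simp
next
  case (Suc n)
  have "(harm (a + Suc n) :: real) = harm (a + n) + inverse (real (Suc (a + n)))"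
    unfolding add_Suc_right by (rule harm_Suc)
  also have "inverse (real (Suc (a + n))) = 1 / (real a + real (Suc n))"
    unfolding inverse_eq_divide by simp
  also have "harm (a + n) + 1 / (real a + real (Suc n)) = harm a + (\<Sum>r=1..Suc n. 1 / (real a + real r))"
    unfolding Suc.IH by (subst sum.cl_ivl_Suc) simp
  finally show ?case .
qed

lemma H_sum_1: "H_sum 1 m = harm m"
  by (simp add: H_sum_def harm_altdef inverse_eq_divide add.commute)

lemma sum_H_sum:
  assumes "0 < N"
  shows "(\<Sum>r=1..N. H_sum (real r / real N) m) = real N * harm (N * m)"
proof (induction m)
  case (Suc m)
  have "(\<Sum>r=1..N. H_sum (real r / real N) (Suc m))
      = (\<Sum>r=1..N. H_sum (real r / real N) m + real N * (1 / (real (N * m) + real r)))"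
  proof (rule sum.cong)
    fix r assume "r \<in> {1..N}"
    then have "1 / (real r / real N + real m) = real N * (1 / (real (N * m) + real r))"
      using assms by (simp add: field_simps)
    then show "H_sum (real r / real N) (Suc m) = H_sum (real r / real N) m + real N * (1 / (real (N * m) + real r))"
      by (simp add: H_sum_def)
  qed simp
  also have "\<dots> = real N * harm (N * m) + real N * (\<Sum>r=1..N. 1 / (real (N * m) + real r))"
    by (simp only: sum.distrib sum_distrib_left[symmetric] Suc.IH)
  also have "\<dots> = real N * harm (N * m + N)" by (simp only: harm_add distrib_left)
  finally show ?case by (simp add: add.commute)
qed (simp add: H_sum_def harm_def)

text \<open>
  Every fraction \<open>r / N\<close> in \<open>(0, 1]\<close> has a unique reduced form, whose denominator divides \<open>N\<close>.
\<close>
lemma sum_fractions_by_denominator: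
  fixes f :: "real \<Rightarrow> real"
  assumes "0 < N"
  shows "(\<Sum>r=1..N. f (real r / real N)) = (\<Sum>d | d dvd N. \<Sum>r\<in>totatives d. f (real r / real d))"
proof -
  have "(\<Sum>d | d dvd N. \<Sum>r\<in>totatives d. f (real r / real d))
      = (\<Sum>(d, r)\<in>(SIGMA d:{d. d dvd N}. totatives d). f (real r / real d))"
    by (rule sum.Sigma) (use assms in auto)
  also have "\<dots> = (\<Sum>r=1..N. f (real r / real N))"
  proof (rule sum.reindex_bij_witness[of _ "\<lambda>k. (N div gcd k N, k div gcd k N)" "\<lambda>(d, r). r * (N div d)"], goal_cases)
    case (1 x)
    obtain d r where x: "x = (d, r)" "d dvd N" "r \<in> totatives d" using 1 by auto
    obtain q where q: "N = d * q" using x(2) by blast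
    have "0 < q" "0 < d" using q assms by auto
    moreover have "gcd r d = 1" using x(3) by (simp add: in_totatives_iff)
    then have "gcd (r * q) (d * q) = q"
      using gcd_mult_distrib_nat[of q r d] by (simp add: mult.commute)
    ultimately show ?case using x q by simp
  next
    case (2 x)
    obtain d r where x: "x = (d, r)" "d dvd N" "r \<in> totatives d" using 2 by auto
    obtain q where q: "N = d * q" using x(2) by blast
    have "0 < q" "0 < d" using q assms by auto
    then show ?case using x q by (auto simp: in_totatives_iff)
  next
    case (3 k)
    obtain i j where ij: "k = gcd k N * i" "N = gcd k N * j" by (meson dvdE gcd_dvd1 gcd_dvd2)
    define g where "g = gcd k N"
    have g: "N = g * j" "k = g * i" unfolding g_def by (fact ij)+
    have "0 < g * j" using assms g(1) by metis
    then have g0: "0 < g" "0 < j" by simp_all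
    have "N div g = j" "N div j = g" "k div g = i" using g0 by (simp_all only: g) simp_all
    then have "k div g * (N div (N div g)) = k" using g(2) by (simp only: mult.commute)
    then show ?case by (simp add: g_def)
  next
    case (4 k)
    obtain i j where ij: "k = gcd k N * i" "N = gcd k N * j" by (meson dvdE gcd_dvd1 gcd_dvd2)
    define g where "g = gcd k N"
    have g: "N = g * j" "k = g * i" unfolding g_def by (fact ij)+
    have "0 < g * j" using assms g(1) by metis
    then have g0: "0 < g" "0 < j" by simp_all
    have q: "N div g = j" "k div g = i" using g0 by (simp_all only: g) simp_all
    have "coprime (k div g) (N div g)"
      unfolding g_def using assms by (intro div_gcd_coprime) auto
    then have "coprime i j" unfolding q .
    moreover have "0 < g * i" "g * i \<le> g * j" using 4 unfolding g[symmetric] by simp_all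
    then have "0 < i" "i \<le> j" using g0 by simp_all
    moreover have "j dvd N" unfolding g(1) by simp
    ultimately show ?case unfolding g_def[symmetric] q by (simp add: in_totatives_iff)
  next
    case (5 x)
    obtain d r where x: "x = (d, r)" "d dvd N" "r \<in> totatives d" using 5 by auto
    obtain q where q: "N = d * q" using x(2) by blast
    have "0 < q" "0 < d" using q assms by auto
    then show ?case using x q by simp
  qed
  finally show ?thesis ..
qed

text \<open>
  Over all residues instead of the coprime ones, the harmonic sums recombine to a single long
  harmonic sum.
\<close>
lemma sum_H1_divisors:
  assumes "0 < N"
  shows "(\<Sum>d | d dvd N. H1 d m) = real N * (harm (N * m) - harm m)"
proof -
  have "(\<Sum>d | d dvd N. H1 d m) = (\<Sum>d | d dvd N. \<Sum>r\<in>totatives d. H_sum (real r / real d) m)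
      - real (\<Sum>d | d dvd N. totient d) * harm m"
    by (simp add: H1_def sum_subtractf sum_distrib_right H_sum_1)
  also have "\<dots> = real N * harm (N * m) - real N * harm m"
    unfolding sum_fractions_by_denominator[OF assms, of "\<lambda>x. H_sum x m", symmetric] sum_H_sum[OF assms] totient_divisor_sum ..
  finally show ?thesis by (simp add: right_diff_distrib)
qed

lemma ln_C1:
  assumes "0 < N"
  shows "ln (C1 N) = real (totient N) * (ln (real N) + (\<Sum>p\<in>prime_factors N. ln (real p) / (real p - 1)))"
proof -
  have p: "2 \<le> p" "(p - 1) dvd totient N" if "p \<in> prime_factors N" for p
  proof -
    have "prime p" "p dvd N" using that by auto
    then show "2 \<le> p" "(p - 1) dvd totient N"
      using totient_dvd[of p N] prime_ge_2_nat[of p] by (simp_all add: totient_prime)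
  qed
  have "ln (C1 N) = ln (real N ^ totient N) + ln (\<Prod>p\<in>prime_factors N. real p ^ (totient N div (p - 1)))"
  proof -
    have "0 < real p" if "p \<in> prime_factors N" for p using p(1)[OF that] by simp
    then have "0 < (\<Prod>p\<in>prime_factors N. real p ^ (totient N div (p - 1)))"
      by (intro prod_pos) (simp add: zero_less_power)
    then show ?thesis unfolding C1_def using assms by (intro ln_mult_pos) simp_all
  qed
  also have "ln (\<Prod>p\<in>prime_factors N. real p ^ (totient N div (p - 1)))
      = (\<Sum>p\<in>prime_factors N. ln (real p ^ (totient N div (p - 1))))"
  proof (rule ln_prod)
    fix q assume "q \<in> prime_factors N"
    then show "real q ^ (totient N div (q - 1)) \<noteq> 0" using p(1)[of q] by simp
  qed simp
  also have "\<dots> = (\<Sum>p\<in>prime_factors N. real (totient N) * (ln (real p) / (real p - 1)))"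
  proof (rule sum.cong)
    fix q assume q: "q \<in> prime_factors N"
    have "real (totient N div (q - 1)) = real (totient N) / (real q - 1)"
      using p[OF q] by (simp add: real_of_nat_div of_nat_diff)
    then show "ln (real q ^ (totient N div (q - 1))) = real (totient N) * (ln (real q) / (real q - 1))"
      using p(1)[OF q] by (simp add: ln_realpow)
  qed simp
  finally show ?thesis using assms by (simp add: ln_realpow distrib_left sum_distrib_left)
qed

text \<open>
  A Leibniz rule: \<open>ln C\<^sub>N\<close> is the totient times an additive function.
\<close>
lemma ln_C1_coprime:
  assumes "coprime a b" "0 < a" "0 < b"
  shows "ln (C1 (a * b)) = real (totient a) * ln (C1 b) + real (totient b) * ln (C1 a)"
proof -
  have "prime_factors (a * b) = prime_factors a \<union> prime_factors b"
    using assms by (simp add: prime_factors_product)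
  moreover have "prime_factors a \<inter> prime_factors b = {}"
  proof (rule equals0I)
    fix p assume "p \<in> prime_factors a \<inter> prime_factors b"
    then have "prime p" "p dvd a" "p dvd b" by auto
    then show False using coprime_common_divisor[OF assms(1)] not_prime_unit by blast
  qed
  ultimately have "(\<Sum>p\<in>prime_factors (a * b). ln (real p) / (real p - 1))
      = (\<Sum>p\<in>prime_factors a. ln (real p) / (real p - 1)) + (\<Sum>p\<in>prime_factors b. ln (real p) / (real p - 1))"
    by (simp add: sum.union_disjoint)
  then show ?thesis
    using assms by (simp add: ln_C1 totient_mult_coprime ln_mult algebra_simps)
qed

lemma sum_divisors_coprime:
  fixes f :: "nat \<Rightarrow> real"
  assumes "coprime a b" "0 < a" "0 < b"
  shows "(\<Sum>d | d dvd a * b. f d) = (\<Sum>x | x dvd a. \<Sum>y | y dvd b. f (x * y))"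
proof -
  have *: "gcd (x * y) a = x" "gcd (x * y) b = y" if "x dvd a" "y dvd b" for x y
  proof -
    have "coprime a y" "coprime b x"
      using that assms(1) by (auto intro: coprime_divisors[of _ a _ b] simp: coprime_commute)
    then show "gcd (x * y) a = x" "gcd (x * y) b = y"
      using that by (simp_all add: gcd_mult_left_right_cancel gcd_mult_left_left_cancel gcd_proj1_iff coprime_commute)
  qed
  have "(\<Sum>x | x dvd a. \<Sum>y | y dvd b. f (x * y)) = (\<Sum>(x, y)\<in>{x. x dvd a} \<times> {y. y dvd b}. f (x * y))"
    by (rule sum.cartesian_product)
  also have "\<dots> = (\<Sum>d | d dvd a * b. f d)"
  proof (rule sum.reindex_bij_witness[of _ "\<lambda>d. (gcd d a, gcd d b)" "\<lambda>(x, y). x * y"], goal_cases)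
    case (1 z)
    then show ?case using * by auto
  next
    case (3 d)
    then obtain x y where "d = x * y" "x dvd a" "y dvd b" using division_decomp[of d a b] by auto
    then show ?case using * by simp
  qed (auto intro: mult_dvd_mono)
  finally show ?thesis ..
qed

lemma sum_ln_C1_prime_power:
  assumes p: "prime p"
  shows "(\<Sum>d | d dvd p ^ n. ln (C1 d)) = real (p ^ n) * ln (real (p ^ n))"
proof -
  have p2: "2 \<le> p" using p by (rule prime_ge_2_nat)
  have inj: "inj_on (\<lambda>i. p ^ i) {..n}" using p2 by (auto simp: inj_on_def)
  have set: "{d. d dvd p ^ n} = (\<lambda>i. p ^ i) ` {..n}"
    using divides_primepow_nat[OF p] by (auto simp: le_imp_power_dvd)
  have "(\<Sum>d | d dvd p ^ n. ln (C1 d)) = (\<Sum>i\<le>n. ln (C1 (p ^ i)))"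
    unfolding set by (simp add: sum.reindex[OF inj])
  also have "\<dots> = real (p ^ n) * (real n * ln (real p))"
  proof (induction n)
    case 0
    then show ?case by (simp add: C1_def)
  next
    case (Suc n)
    have "prime_factors (p ^ Suc n) = {p}"
      using p prime_factors_power[of "Suc n" p] by (simp only: prime_prime_factors)
    then have "ln (C1 (p ^ Suc n)) = real (totient (p ^ Suc n)) * (real (Suc n) * ln (real p) + ln (real p) / (real p - 1))"
      using p2 by (subst ln_C1) (simp_all add: ln_realpow del: power_Suc)
    also have "totient (p ^ Suc n) = p ^ n * (p - 1)" by (rule totient_prime_power_Suc[OF p])
    also have "real (p ^ n * (p - 1)) * (real (Suc n) * ln (real p) + ln (real p) / (real p - 1))
        = real (p ^ n) * (real p - 1) * real (Suc n) * ln (real p) + real (p ^ n) * ln (real p)"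
      using p2 by (simp add: of_nat_diff field_simps)
    finally show ?case using Suc.IH by (simp add: algebra_simps)
  qed
  finally show ?thesis using p2 by (simp add: ln_realpow)
qed

text \<open>
  This is the arithmetic counterpart of the limit of \<open>sum_H1_divisors\<close>. By the Leibniz rule
  \<open>ln_C1_coprime\<close> it suffices to split off one prime power at a time, for which the sum telescopes.
\<close>
lemma sum_ln_C1:
  assumes "0 < N"
  shows "(\<Sum>d | d dvd N. ln (C1 d)) = real N * ln (real N)"
  using assms
proof (induction N rule: less_induct)
  case (less N)
  show ?case
  proof (cases "N = 1")
    case True
    have "{d::nat. d dvd 1} = {1}" by auto
    then show ?thesis unfolding True by (simp add: C1_def)
  next
    case False
    then obtain p where p: "prime p" "p dvd N" using prime_factor_nat by blast
    obtain M where M: "N = p ^ multiplicity p N * M" "\<not> p dvd M"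
      by (rule multiplicity_decompose'[of N p]) (use p less.prems in auto)
    define k where "k = multiplicity p N"
    have k: "0 < k" using p less.prems by (simp add: k_def prime_multiplicity_gt_zero_iff)
    have M0: "0 < M" using M(1) less.prems by (metis gr0I mult_0_right)
    have "1 < p ^ k" using p(1) k by (intro one_less_power prime_gt_1_nat)
    then have "M < N" using M(1) M0 by (simp add: k_def[symmetric])
    have cop: "coprime (p ^ k) M" using p(1) M(2) by (simp add: prime_imp_coprime)
    have dvd_pos: "0 < d" if "d dvd p ^ k" for d using p(1) by (intro dvd_pos_nat[OF _ that]) (simp add: prime_gt_0_nat)
    have "(\<Sum>d | d dvd N. ln (C1 d)) = (\<Sum>x | x dvd p ^ k. \<Sum>y | y dvd M. ln (C1 (x * y)))"
      unfolding M(1)[folded k_def] by (rule sum_divisors_coprime[OF cop]) (use p(1) M0 prime_gt_0_nat in auto)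
    also have "\<dots> = (\<Sum>x | x dvd p ^ k. \<Sum>y | y dvd M. real (totient x) * ln (C1 y) + real (totient y) * ln (C1 x))"
      using cop M0 dvd_pos by (intro sum.cong ln_C1_coprime) (auto intro: coprime_divisors dvd_pos_nat)
    also have "\<dots> = real (\<Sum>x | x dvd p ^ k. totient x) * (\<Sum>y | y dvd M. ln (C1 y))
        + real (\<Sum>y | y dvd M. totient y) * (\<Sum>x | x dvd p ^ k. ln (C1 x))"
    proof -
      have "(\<Sum>x | x dvd p ^ k. \<Sum>y | y dvd M. real (totient y) * ln (C1 x))
          = (\<Sum>y | y dvd M. \<Sum>x | x dvd p ^ k. real (totient y) * ln (C1 x))" by (rule sum.swap)
      then show ?thesis by (simp only: sum.distrib sum_product of_nat_sum)
    qed
    also have "\<dots> = real (p ^ k) * (real M * ln (real M)) + real M * (real (p ^ k) * ln (real (p ^ k)))"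
      unfolding totient_divisor_sum sum_ln_C1_prime_power[OF p(1)] less.IH[OF \<open>M < N\<close> M0] ..
    also have "\<dots> = real N * ln (real N)"
      unfolding M(1)[folded k_def] using p(1) M0 by (simp add: ln_mult prime_gt_0_nat algebra_simps)
    finally show ?thesis .
  qed
qed

text \<open>
  Gauss's formula for \<open>\<Sum> (\<psi>(1) - \<psi>(r / N))\<close> over the \<open>r\<close> coprime to \<open>N\<close>. The limits and the numbers
  \<open>ln C\<^sub>d\<close> both have the divisor sum \<open>N ln N\<close>, so they agree by induction on \<open>N\<close>.
\<close>
theorem H1_tendsto: "0 < N \<Longrightarrow> H1 N \<longlonglongrightarrow> ln (C1 N)"
proof (induction N rule: less_induct)
  case (less N)
  define E where "E = {d. d dvd N \<and> d \<noteq> N}"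
  have fin: "finite E" unfolding E_def using less.prems by (intro finite_subset[OF _ finite_divisors_nat]) auto
  have split: "{d. d dvd N} = insert N E" "N \<notin> E" by (auto simp: E_def)
  have H: "H1 N = (\<lambda>m. real N * (harm (N * m) - harm m) - (\<Sum>d\<in>E. H1 d m))"
  proof
    fix m
    show "H1 N m = real N * (harm (N * m) - harm m) - (\<Sum>d\<in>E. H1 d m)"
      using sum_H1_divisors[OF less.prems, of m] unfolding split using fin split(2) by simp
  qed
  have C: "ln (C1 N) = real N * ln (real N) - (\<Sum>d\<in>E. ln (C1 d))"
    using sum_ln_C1[OF less.prems] unfolding split using fin split(2) by simp
  have "filterlim (\<lambda>m. N * m) at_top sequentially"
    using less.prems by (intro filterlim_at_top_mono[OF filterlim_ident]) (auto intro!: always_eventually)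
  then have "(\<lambda>m. (harm (N * m) - ln (real (N * m))) - (harm m - ln (real m)) + ln (real N))
      \<longlonglongrightarrow> euler_mascheroni - euler_mascheroni + ln (real N)"
    by (intro tendsto_intros euler_mascheroni_LIMSEQ filterlim_compose[OF euler_mascheroni_LIMSEQ])
  moreover have "eventually (\<lambda>m. (harm (N * m) - ln (real (N * m))) - (harm m - ln (real m)) + ln (real N)
      = harm (N * m) - harm m) sequentially"
    using eventually_gt_at_top[of 0] by eventually_elim (use less.prems in \<open>simp add: ln_mult\<close>)
  ultimately have "(\<lambda>m. harm (N * m) - harm m) \<longlonglongrightarrow> ln (real N)"
    by (simp add: Lim_transform_eventually)
  moreover have "H1 d \<longlonglongrightarrow> ln (C1 d)" if "d \<in> E" for d
  proof -
    have d: "d dvd N" "d \<noteq> N" using that by (simp_all add: E_def)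
    then have "0 < d" "d < N"
      using less.prems dvd_imp_le[OF d(1)] dvd_pos_nat[OF _ d(1)] by auto
    then show ?thesis using less.IH by blast
  qed
  ultimately show ?case unfolding H C by (intro tendsto_intros)
qed

section \<open>Pringsheim's theorem\<close>

lemma higher_deriv_eval_fps:
  fixes f :: "complex fps"
  assumes "norm z < fps_conv_radius f"
  shows "(deriv ^^ k) (eval_fps f) z = eval_fps ((fps_deriv ^^ k) f) z
    \<and> fps_conv_radius f \<le> fps_conv_radius ((fps_deriv ^^ k) f)"
  using assms
proof (induction k arbitrary: z)
  case (Suc k)
  let ?g = "(fps_deriv ^^ k) f"
  have rad: "fps_conv_radius f \<le> fps_conv_radius ?g" using Suc by blast
  have op: "open (eball (0::complex) (fps_conv_radius f))" by simp
  have z: "z \<in> eball 0 (fps_conv_radius f)" using Suc.prems by (simp add: in_eball_iff)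
  have "eventually (\<lambda>x. x \<in> eball 0 (fps_conv_radius f)) (nhds z)"
    using eventually_nhds_in_open[OF op z] .
  then have "eventually (\<lambda>x. (deriv ^^ k) (eval_fps f) x = eval_fps ?g x) (nhds z)"
    by eventually_elim (use Suc.IH in \<open>auto simp: in_eball_iff\<close>)
  then have "deriv ((deriv ^^ k) (eval_fps f)) z = deriv (eval_fps ?g) z"
    by (intro deriv_cong_ev) auto
  also have "\<dots> = eval_fps (fps_deriv ?g) z"
    using Suc.prems rad by (intro DERIV_imp_deriv has_field_derivative_eval_fps) (auto intro: less_le_trans)
  finally show ?case using rad fps_conv_radius_deriv[of ?g] by (simp add: order_trans)
qed simp

lemma fps_nth_higher_deriv:
  fixes f :: "complex fps"
  shows "fps_nth ((fps_deriv ^^ k) f) n = of_nat ((n + k) choose k) * fact k * fps_nth f (n + k)"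
proof (induction k arbitrary: n)
  case (Suc k)
  have "Suc n * (((Suc n + k) choose k) * fact k) = ((n + Suc k) choose Suc k) * fact (Suc k)"
  proof -
    have d: "Suc (n + k) - k = Suc n" "Suc (n + k) - Suc k = n" by auto
    have "fact k * fact (Suc n) * (Suc (n + k) choose k) = (fact (Suc k) * fact n * (Suc (n + k) choose Suc k) :: nat)"
      using binomial_fact_lemma[of k "Suc (n + k)"] binomial_fact_lemma[of "Suc k" "Suc (n + k)"]
      unfolding d by simp
    then have "Suc n * (((Suc n + k) choose k) * fact k) * fact n = ((n + Suc k) choose Suc k) * fact (Suc k) * fact n"
      unfolding fact_Suc[of n] add_Suc add_Suc_right by (simp only: of_nat_id mult_ac)
    then show ?thesis by (simp del: fact_Suc binomial_Suc_Suc)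
  qed
  then have "of_nat (Suc n) * (of_nat ((Suc n + k) choose k) * fact k) = (of_nat ((n + Suc k) choose Suc k) * fact (Suc k) :: complex)"
    by (metis of_nat_fact of_nat_mult)
  then show ?case using Suc.IH[of "Suc n"] by (simp add: mult.assoc[symmetric])
qed simp

text \<open>
  If \<open>g\<close> continued the series to a disc of radius \<open>e\<close> about \<open>R\<close>, its Taylor series at \<open>R\<close> would converge
  at \<open>R + t\<close> for \<open>0 < t < e\<close>. Approaching \<open>R\<close> from the left shows that the Taylor coefficients of \<open>g\<close>
  dominate those of every partial sum of the original series, because \<open>a \<ge> 0\<close>. Re-expanding a partial
  sum about \<open>R\<close> therefore bounds it at \<open>R + t\<close> by \<open>g(R + t)\<close>, independently of its length, and the
  original series would converge beyond \<open>R\<close>.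
\<close>
theorem Pringsheim:
  fixes a :: "nat \<Rightarrow> real"
  assumes nonneg: "\<And>n. 0 \<le> a n" and R: "0 < R"
    and rad: "fps_conv_radius (Abs_fps (\<lambda>n. complex_of_real (a n))) = ereal R"
  shows "has_boundary_singularity (eval_fps (Abs_fps (\<lambda>n. complex_of_real (a n)))) R (of_real R)"
  unfolding has_boundary_singularity_def
proof
  define f where "f = Abs_fps (\<lambda>n. complex_of_real (a n))"
  assume "\<exists>e>0. \<exists>g. g holomorphic_on ball (complex_of_real R) e
    \<and> (\<forall>z\<in>ball 0 R \<inter> ball (complex_of_real R) e. g z = eval_fps (Abs_fps (\<lambda>n. complex_of_real (a n))) z)"
  then obtain e g where e: "0 < e" and g: "g holomorphic_on ball (of_real R) e"
    and gf: "\<And>z. z \<in> ball 0 R \<inter> ball (of_real R) e \<Longrightarrow> g z = eval_fps f z"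
    unfolding f_def by blast
  define t where "t = e / 2"
  have t: "0 < t" "t < e" using e by (auto simp: t_def)
  let ?D = "\<lambda>k. (deriv ^^ k) g (of_real R)"
  have taylor: "(\<lambda>k. ?D k / fact k * of_real t ^ k) sums g (of_real (R + t))"
    using holomorphic_power_series[OF g, of "of_real (R + t)"] t by (simp add: dist_norm)
  have lower: "(\<Sum>n\<le>N. real (n choose k) * a n * R ^ (n - k)) \<le> Re (?D k / fact k)" for k N
  proof -
    let ?x = "\<lambda>s. complex_of_real (R - s)"
    have cont: "isCont ((deriv ^^ k) g) (of_real R)"
    proof -
      have "(deriv ^^ k) g holomorphic_on ball (of_real R) e" by (intro holomorphic_higher_deriv g) auto
      then have "continuous_on (ball (of_real R) e) ((deriv ^^ k) g)" by (rule holomorphic_on_imp_continuous_on)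
      then show ?thesis using e by (simp add: continuous_on_eq_continuous_at)
    qed
    have x_lim: "((\<lambda>s. complex_of_real (R - s)) \<longlongrightarrow> complex_of_real R) (at_right (0::real))"
    proof -
      have "((\<lambda>s. complex_of_real (R - s)) \<longlongrightarrow> complex_of_real (R - 0)) (at_right (0::real))"
        by (intro tendsto_of_real tendsto_diff tendsto_const tendsto_ident_at)
      then show ?thesis by (simp only: diff_zero)
    qed
    then have "((\<lambda>s. Re ((deriv ^^ k) g (?x s) / fact k)) \<longlongrightarrow> Re (?D k / fact k)) (at_right (0::real))"
      by (intro tendsto_Re tendsto_divide isCont_tendsto_compose[OF cont] tendsto_const x_lim) simp
    moreover have "((\<lambda>s. \<Sum>n\<le>N. real (n choose k) * a n * (R - s) ^ (n - k)) \<longlongrightarrow> (\<Sum>n\<le>N. real (n choose k) * a n * (R - 0) ^ (n - k))) (at_right (0::real))"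
      by (intro tendsto_intros)
    moreover have "eventually (\<lambda>s. (\<Sum>n\<le>N. real (n choose k) * a n * (R - s) ^ (n - k)) \<le> Re ((deriv ^^ k) g (?x s) / fact k)) (at_right (0::real))"
    proof -
      have "eventually (\<lambda>s. s \<in> {0<..<min e R}) (at_right (0::real))"
        by (rule eventually_at_right_real) (use e R in auto)
      then show ?thesis
      proof eventually_elim
        case (elim s)
        define x where "x = R - s"
        have x: "0 < x" "x < R" using elim by (auto simp: x_def)
        have xin: "complex_of_real x \<in> ball 0 R \<inter> ball (of_real R) e"
          using elim x by (auto simp: x_def dist_norm norm_of_real simp flip: of_real_diff)
        have "(deriv ^^ k) g (of_real x) = (deriv ^^ k) (eval_fps f) (of_real x)"
        proof (rule higher_deriv_cong_ev)
          show "eventually (\<lambda>z. g z = eval_fps f z) (nhds (of_real x))"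
          proof (rule eventually_mono)
            show "eventually (\<lambda>z. z \<in> ball 0 R \<inter> ball (of_real R) e) (nhds (complex_of_real x))"
              by (rule eventually_nhds_in_open[OF _ xin]) auto
          qed (rule gf)
        qed simp
        also have "\<dots> = eval_fps ((fps_deriv ^^ k) f) (of_real x)"
          using higher_deriv_eval_fps[of "of_real x" f k] rad x by (simp add: f_def)
        finally have dg: "(deriv ^^ k) g (of_real x) = eval_fps ((fps_deriv ^^ k) f) (of_real x)" .
        have "ereal (norm (complex_of_real x)) < fps_conv_radius ((fps_deriv ^^ k) f)"
        proof (rule less_le_trans)
          show less: "ereal (norm (complex_of_real x)) < fps_conv_radius f" using rad x by (simp add: f_def)
          show "fps_conv_radius f \<le> fps_conv_radius ((fps_deriv ^^ k) f)"
            using higher_deriv_eval_fps[OF less] by blast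
        qed
        then have sums: "(\<lambda>n. fps_nth ((fps_deriv ^^ k) f) n * of_real x ^ n) sums ((deriv ^^ k) g (of_real x))"
          unfolding dg eval_fps_def by (intro summable_sums summable_fps)
        have "(\<lambda>n. Re (fps_nth ((fps_deriv ^^ k) f) n * of_real x ^ n / fact k)) sums Re ((deriv ^^ k) g (of_real x) / fact k)"
          by (intro sums_Re sums_divide sums)
        moreover have "fps_nth ((fps_deriv ^^ k) f) n * of_real x ^ n / fact k
            = of_real (real ((n + k) choose k) * a (n + k) * x ^ n)" for n
          by (simp add: fps_nth_higher_deriv f_def)
        ultimately have sums': "(\<lambda>n. real ((n + k) choose k) * a (n + k) * x ^ n) sums Re ((deriv ^^ k) g (of_real x) / fact k)"
          by simp
        have "(\<Sum>n\<le>N. real (n choose k) * a n * x ^ (n - k)) = (\<Sum>n\<in>{k..N}. real (n choose k) * a n * x ^ (n - k))"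
          by (rule sum.mono_neutral_right) (auto simp: binomial_eq_0)
        also have "\<dots> = (\<Sum>n\<in>{n. n + k \<le> N}. real ((n + k) choose k) * a (n + k) * x ^ n)"
          by (rule sum.reindex_bij_witness[of _ "\<lambda>n. n + k" "\<lambda>n. n - k"]) auto
        also have "\<dots> \<le> Re ((deriv ^^ k) g (of_real x) / fact k)"
          unfolding sums_unique[OF sums']
          by (rule sum_le_suminf[OF sums_summable[OF sums']])
            (use x nonneg in \<open>auto intro: finite_subset[of _ "{..N}"]\<close>)
        finally show ?case by (simp add: x_def)
      qed
    qed
    ultimately have "(\<Sum>n\<le>N. real (n choose k) * a n * (R - 0) ^ (n - k)) \<le> Re (?D k / fact k)"
      by (intro tendsto_le[OF _ _ _]) (auto simp: trivial_limit_at_right_real)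
    then show ?thesis by simp
  qed
  have "(\<Sum>n\<le>N. a n * (R + t) ^ n) \<le> Re (g (of_real (R + t)))" for N
  proof -
    have "(\<Sum>n\<le>N. a n * (R + t) ^ n) = (\<Sum>n\<le>N. \<Sum>k\<le>N. real (n choose k) * a n * R ^ (n - k) * t ^ k)"
    proof (rule sum.cong)
      fix n assume "n \<in> {..N}"
      have "a n * (R + t) ^ n = (\<Sum>k\<le>n. real (n choose k) * a n * R ^ (n - k) * t ^ k)"
        using binomial_ring[of t R n] by (simp add: add.commute sum_distrib_left mult_ac)
      also have "\<dots> = (\<Sum>k\<le>N. real (n choose k) * a n * R ^ (n - k) * t ^ k)"
        using \<open>n \<in> {..N}\<close> by (intro sum.mono_neutral_left) (auto simp: binomial_eq_0)
      finally show "a n * (R + t) ^ n = (\<Sum>k\<le>N. real (n choose k) * a n * R ^ (n - k) * t ^ k)" .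
    qed simp
    also have "\<dots> = (\<Sum>k\<le>N. (\<Sum>n\<le>N. real (n choose k) * a n * R ^ (n - k)) * t ^ k)"
      unfolding sum_distrib_right by (rule sum.swap)
    also have "\<dots> \<le> (\<Sum>k\<le>N. Re (?D k / fact k) * t ^ k)"
      using t by (intro sum_mono mult_right_mono lower) auto
    also have "\<dots> \<le> Re (g (of_real (R + t)))"
    proof -
      have "(\<lambda>k. Re (?D k / fact k * of_real t ^ k)) sums Re (g (of_real (R + t)))"
        by (intro sums_Re taylor)
      moreover have "Re (?D k / fact k * of_real t ^ k) = Re (?D k / fact k) * t ^ k" for k
      proof -
        have "Re (z * complex_of_real x) = Re z * x" for z x by simp
        then show ?thesis unfolding of_real_power[symmetric] .
      qed
      ultimately have sums: "(\<lambda>k. Re (?D k / fact k) * t ^ k) sums Re (g (of_real (R + t)))" by simp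
      have "0 \<le> Re (?D k / fact k)" for k
      proof -
        have "0 \<le> (\<Sum>n\<le>0. real (n choose k) * a n * R ^ (n - k))"
          using R nonneg by (intro sum_nonneg mult_nonneg_nonneg) auto
        then show ?thesis using lower[of k 0] by (rule order_trans)
      qed
      then show ?thesis
        unfolding sums_unique[OF sums] using t by (intro sum_le_suminf[OF sums_summable[OF sums]]) auto
    qed
    finally show ?thesis .
  qed
  then have "summable (\<lambda>n. a n * (R + t) ^ n)"
    using t R nonneg by (intro bounded_imp_summable[of _ "Re (g (of_real (R + t)))"]) auto
  then have "summable (\<lambda>n. complex_of_real (a n * (R + t) ^ n))" by (rule summable_of_real)
  then have "summable (\<lambda>n. fps_nth f n * of_real (R + t) ^ n)" by (simp add: f_def)
  then have "norm (complex_of_real (R + t)) \<le> fps_conv_radius f"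
    unfolding fps_conv_radius_def by (rule conv_radius_geI)
  moreover have "norm (complex_of_real (R + t)) = R + t" using t R by (simp only: norm_of_real)
  ultimately have "ereal (R + t) \<le> ereal R" using rad unfolding f_def by simp
  then show False using t by simp
qed

section \<open>The Catalan case\<close>

lemma log_derivative_unique:
  fixes P Q :: "'a :: field_char_0 fps"
  assumes P: "fps_deriv P = A * P" and Q: "fps_deriv Q = A * Q" and 0: "fps_nth P 0 = fps_nth Q 0"
  shows "P = Q"
proof (rule fps_ext)
  fix n
  show "fps_nth P n = fps_nth Q n"
  proof (induction n rule: less_induct)
    case (less n)
    show ?case
    proof (cases n)
      case (Suc m)
      have "fps_nth (A * P) m = fps_nth (A * Q) m"
        unfolding fps_mult_nth using less.IH Suc by (intro sum.cong) auto
      then have "of_nat (Suc m) * fps_nth P (Suc m) = (of_nat (Suc m) * fps_nth Q (Suc m) :: 'a)"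
        using arg_cong[OF P, of "\<lambda>f. fps_nth f m"] arg_cong[OF Q, of "\<lambda>f. fps_nth f m"]
        by (simp add: add.commute)
      then show ?thesis unfolding Suc by (simp only: mult_cancel_left of_nat_eq_0_iff) simp
    qed (simp add: 0)
  qed
qed

definition catalan :: "nat \<Rightarrow> real" where
  "catalan m = real ((2 * m) choose m) / (real m + 1)"

lemma central_binomial_fact: "real ((2 * m) choose m) = fact (2 * m) / (fact m * fact m)"
proof -
  have "m \<le> 2 * m" "2 * m - m = m" by simp_all
  then show ?thesis using binomial_fact[of m "2 * m", where 'a = real] by simp
qed

lemma central_binomial_Suc:
  "real ((2 * Suc m) choose Suc m) * (real m + 1) = 2 * (2 * real m + 1) * real ((2 * m) choose m)"
proof -
  define f where "f = (fact m :: real)"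
  have f: "f \<noteq> 0" by (simp add: f_def)
  have n: "real m + 1 \<noteq> 0" by simp
  have 1: "(fact (2 * Suc m) :: real) = 2 * (real m + 1) * (2 * real m + 1) * fact (2 * m)"
    by (simp add: algebra_simps)
  have 2: "(fact (Suc m) :: real) = (real m + 1) * f" by (simp add: f_def)
  show ?thesis
    unfolding central_binomial_fact 1 2 f_def[symmetric] using f n
    by (simp add: divide_simps) (simp add: algebra_simps)
qed

lemma catalan_Suc: "catalan (Suc m) * (real m + 2) = 2 * (2 * real m + 1) * catalan m"
proof -
  have nz: "real m + 1 \<noteq> 0" "real m + 2 \<noteq> 0" by simp_all
  have "real (Suc m) + 1 = real m + 2" by simp
  then have "catalan (Suc m) * (real m + 2) = real ((2 * Suc m) choose Suc m)"
    unfolding catalan_def using nonzero_mult_div_cancel_right[OF nz(2)]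
    by (simp only: times_divide_eq_left)
  also have "\<dots> = 2 * (2 * real m + 1) * real ((2 * m) choose m) / (real m + 1)"
    unfolding nonzero_eq_divide_eq[OF nz(1)] by (rule central_binomial_Suc)
  finally show ?thesis by (simp add: catalan_def)
qed

lemma central_binomial_pochhammer: "real ((2 * m) choose m) = 4 ^ m * (pochhammer (1 / 2) m / fact m)"
proof (induction m)
  case (Suc m)
  have nz: "real m + 1 \<noteq> 0" by simp
  have "real ((2 * Suc m) choose Suc m) = 2 * (2 * real m + 1) * real ((2 * m) choose m) / (real m + 1)"
    unfolding nonzero_eq_divide_eq[OF nz] by (rule central_binomial_Suc)
  also have "\<dots> = 4 ^ Suc m * (pochhammer (1 / 2) (Suc m) / fact (Suc m))"
    unfolding Suc.IH by (simp add: pochhammer_Suc divide_simps) (simp add: algebra_simps)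
  finally show ?case .
qed simp

lemma catalan_asymp: "(\<lambda>m. catalan m / (4 ^ m / (sqrt pi * real m powr (3 / 2)))) \<longlonglongrightarrow> 1"
proof -
  have "(\<lambda>m. sqrt pi * (pochhammer (1 / 2) m / fact m * real m powr (1 - 1 / 2)) * (real m / (real m + 1)))
      \<longlonglongrightarrow> sqrt pi * (1 / Gamma (1 / 2)) * 1"
    by (intro tendsto_mult tendsto_const pochhammer_asymp) (simp | real_asymp)+
  moreover have "eventually (\<lambda>m. sqrt pi * (pochhammer (1 / 2) m / fact m * real m powr (1 - 1 / 2)) * (real m / (real m + 1))
      = catalan m / (4 ^ m / (sqrt pi * real m powr (3 / 2)))) sequentially"
    using eventually_gt_at_top[of 0]
  proof eventually_elim
    case (elim m)
    have "real m powr (3 / 2) = real m powr (1 / 2) * real m"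
      using elim powr_add[of "real m" "1 / 2" 1] by simp
    then show ?case using elim by (simp add: catalan_def central_binomial_pochhammer)
  qed
  ultimately show ?thesis by (simp add: Lim_transform_eventually Gamma_one_half_real)
qed

text \<open>
  For the single parameter \<open>1 / 2\<close> one has \<open>F = (1 - x)\<^bsup>-1/2\<^esup>\<close>. Put \<open>S = 1 / F\<close> and \<open>Y = (1 - S) / x\<close>,
  which is half the generating function \<open>c\<close> of the Catalan numbers at \<open>x / 4\<close>. The aim is
  \<open>exp W = c\<^sup>2 = 4 Y\<^sup>2\<close>. To avoid the division by \<open>x\<close>, \<open>Y\<close> is defined as \<open>D S\<close> with
  \<open>D = (F - 1) / x\<close>.
\<close>
locale catalan_case = hypergeometric "[1 / 2]" L for L
begin

definition "F = Abs_fps (hypergeometric_coeff [1 / 2])"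
definition "D = Abs_fps (\<lambda>n. hypergeometric_coeff [1 / 2] (Suc n))"
definition "S = inverse F"
definition "Y = D * S"

lemma b_Suc: "(real n + 1) * hypergeometric_coeff [1 / 2] (Suc n) = (real n + 1 / 2) * hypergeometric_coeff [1 / 2] n"
  by (simp add: hypergeometric_coeff_Suc coeff_ratio_def) (simp add: field_simps)

lemma F_ODE: "2 * ((1 - fps_X) * fps_deriv F) = F"
proof -
  have "(1 - fps_X) * fps_deriv F = fps_const (1 / 2) * F"
  proof (rule fps_ext)
    fix n
    show "fps_nth ((1 - fps_X) * fps_deriv F) n = fps_nth (fps_const (1 / 2) * F) n"
      using b_Suc[of n] by (cases n) (simp_all add: F_def left_diff_distrib algebra_simps b_0)
  qed
  then have "2 * ((1 - fps_X) * fps_deriv F) = fps_const (2 * (1 / 2)) * F"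
    by (simp only: numeral_fps_const mult.assoc[symmetric] fps_const_mult)
  then show ?thesis by simp
qed

lemma F_S: "F * S = 1"
  unfolding S_def F_def by (rule fps_mult_inverse)

lemma F_square: "F ^ 2 * (1 - fps_X) = 1"
proof -
  have "fps_deriv (F * F * (1 - fps_X)) = F * (2 * ((1 - fps_X) * fps_deriv F)) - F * F"
    by (simp add: algebra_simps)
  also have "\<dots> = 0" unfolding F_ODE by simp
  finally have "fps_deriv (F ^ 2 * (1 - fps_X)) = 0" by (simp only: power2_eq_square)
  then have "F ^ 2 * (1 - fps_X) = fps_const (fps_nth (F ^ 2 * (1 - fps_X)) 0)"
    unfolding fps_deriv_eq_0_iff .
  also have "fps_nth (F ^ 2 * (1 - fps_X)) 0 = 1" by (simp add: power2_eq_square b_0 F_def)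
  finally show ?thesis by simp
qed

lemma S_square: "S ^ 2 = 1 - fps_X"
proof -
  have "S ^ 2 = (F * S) ^ 2 * (1 - fps_X)"
    using F_square by (simp add: power_mult_distrib mult_ac)
  then show ?thesis by (simp add: F_S)
qed

lemma X_Y: "fps_X * Y = 1 - S"
proof -
  have "fps_X * D = F - 1"
  proof (rule fps_ext)
    fix n show "fps_nth (fps_X * D) n = fps_nth (F - 1) n" by (cases n) (simp_all add: b_0 F_def D_def)
  qed
  then have "fps_X * Y = (F - 1) * S" by (simp only: Y_def mult.assoc[symmetric])
  then show ?thesis by (simp only: left_diff_distrib F_S mult_1)
qed

text \<open>
  The quadratic equation of \<open>Y\<close>, obtained from \<open>S\<^sup>2 = 1 - x\<close> and \<open>S = 1 - x Y\<close> after cancelling \<open>x\<close>.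
\<close>
lemma X_Y_square: "fps_X * Y ^ 2 = 2 * Y - 1"
proof -
  have "(1 - fps_X * Y) ^ 2 = 1 - fps_X" unfolding X_Y using S_square by simp
  then have "fps_X * (fps_X * Y ^ 2) = fps_X * (2 * Y - 1)"
    by (simp add: power2_eq_square algebra_simps)
  then show ?thesis by (simp only: mult_cancel_left) simp
qed

lemma S_Y: "S * Y = 1 - Y"
proof -
  have "S * Y = (1 - fps_X * Y) * Y" by (simp add: X_Y)
  also have "\<dots> = Y - fps_X * Y ^ 2" by (simp only: left_diff_distrib power2_eq_square mult_1 mult.assoc)
  finally have "S * Y = Y - fps_X * Y ^ 2" .
  then show ?thesis unfolding X_Y_square by simp
qed

lemma Y_ODE: "2 * (1 - fps_X) * fps_deriv Y = (1 - Y) * Y"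
proof -
  have "fps_deriv (fps_X * Y ^ 2) = fps_deriv (2 * Y - 1)" by (simp only: X_Y_square)
  then have "Y ^ 2 + 2 * (fps_X * Y) * fps_deriv Y = 2 * fps_deriv Y"
    by (simp add: power2_eq_square algebra_simps)
  then have "Y ^ 2 = 2 * fps_deriv Y * S"
    unfolding X_Y by (simp add: algebra_simps)
  then have "S * (S * fps_deriv Y * 2) = S * Y ^ 2" by (simp add: mult_ac)
  then have "2 * S ^ 2 * fps_deriv Y = (S * Y) * Y" by (simp add: power2_eq_square mult_ac)
  then show ?thesis by (simp only: S_square S_Y)
qed

lemma excess_coeff_Suc:
  "(real n + 1) * (harmonic_excess [1 / 2] (Suc n) * hypergeometric_coeff [1 / 2] (Suc n))
    = (real n + 1 / 2) * (harmonic_excess [1 / 2] n * hypergeometric_coeff [1 / 2] n)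
      + hypergeometric_coeff [1 / 2] n - hypergeometric_coeff [1 / 2] (Suc n)"
proof -
  define h where "h = harmonic_excess [1 / 2] n"
  define b where "b = hypergeometric_coeff [1 / 2] n"
  define b' where "b' = hypergeometric_coeff [1 / 2] (Suc n)"
  have b: "(real n + 1) * b' = (real n + 1 / 2) * b" unfolding b'_def b_def by (rule b_Suc)
  have gen: "(real n + 1) * ((h + (x - y)) * b') = h * ((real n + 1) * b') + x * ((real n + 1) * b') - b' * ((real n + 1) * y)"
    for x y by (simp add: algebra_simps)
  have x: "1 / (1 / 2 + real n) * ((real n + 1 / 2) * b) = b" by (simp add: divide_simps)
  have y: "(real n + 1) * (1 / (1 + real n)) = 1" by simp
  have "harmonic_excess [1 / 2] (Suc n) = h + (1 / (1 / 2 + real n) - 1 / (1 + real n))"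
    by (simp add: harmonic_excess_Suc h_def)
  then have "(real n + 1) * (harmonic_excess [1 / 2] (Suc n) * b') = h * ((real n + 1 / 2) * b) + b - b'"
    by (simp only: gen b x y mult_1_right)
  then show ?thesis unfolding h_def b_def b'_def by (simp only: mult_ac)
qed

lemma W_ODE: "(1 - fps_X) * fps_deriv W = 1 - Y"
proof -
  define G where "G = Abs_fps (\<lambda>n. harmonic_excess [1 / 2] n * hypergeometric_coeff [1 / 2] n)"
  have WF: "W * F = G" unfolding F_def G_def by (rule W_mult)
  have "(1 - fps_X) * fps_deriv G = fps_const (1 / 2) * G + F - D"
  proof (rule fps_ext)
    fix n
    show "fps_nth ((1 - fps_X) * fps_deriv G) n = fps_nth (fps_const (1 / 2) * G + F - D) n"
      using excess_coeff_Suc[of n]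
      by (cases n) (simp_all add: G_def F_def D_def left_diff_distrib algebra_simps h_0)
  qed
  then have "2 * ((1 - fps_X) * fps_deriv G) = fps_const (2 * (1 / 2)) * G + 2 * (F - D)"
    by (simp only: numeral_fps_const distrib_left right_diff_distrib mult.assoc[symmetric] fps_const_mult add_diff_eq)
  then have G: "2 * ((1 - fps_X) * fps_deriv G) = W * F + 2 * (F - D)" unfolding WF by simp
  have "2 * ((1 - fps_X) * fps_deriv (W * F)) = W * F + 2 * (F - D)" unfolding WF by (rule G[unfolded WF])
  then have "W * (2 * ((1 - fps_X) * fps_deriv F)) + 2 * ((1 - fps_X) * fps_deriv W * F) = W * F + 2 * (F - D)"
    by (simp add: algebra_simps)
  then have "2 * ((1 - fps_X) * fps_deriv W * F) = 2 * (F - D)"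
    unfolding F_ODE by simp
  then have "(1 - fps_X) * fps_deriv W * F = F - D" by (simp only: mult_cancel_left) simp
  then have "(1 - fps_X) * fps_deriv W * (F * S) = F * S - D * S"
    by (simp only: mult.assoc[symmetric] left_diff_distrib)
  then show ?thesis by (simp only: F_S mult_1_right Y_def)
qed

text \<open>
  By \<open>Y_ODE\<close> and \<open>W_ODE\<close>, both sides have the logarithmic derivative
  \<open>2 Y' / Y = (1 - Y) / (1 - x) = W'\<close>.
\<close>
lemma exp_W: "fps_exp 1 oo W = 4 * Y ^ 2"
proof (rule log_derivative_unique)
  show "fps_deriv (fps_exp 1 oo W) = fps_deriv W * (fps_exp 1 oo W)"
    by (simp add: fps_compose_deriv[OF g_0] mult.commute)
  have "(1 - fps_X) * fps_deriv (4 * Y ^ 2) = 4 * Y * (2 * (1 - fps_X) * fps_deriv Y)"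
    by (simp add: fps_deriv_power power2_eq_square algebra_simps)
  also have "\<dots> = (1 - fps_X) * (fps_deriv W * (4 * Y ^ 2))"
    unfolding Y_ODE W_ODE[symmetric] by (simp only: power2_eq_square mult_ac)
  finally have "(1 - fps_X) * fps_deriv (4 * Y ^ 2) = (1 - fps_X) * (fps_deriv W * (4 * Y ^ 2))" .
  moreover have "(1 - fps_X :: real fps) \<noteq> 0"
  proof
    assume "(1 - fps_X :: real fps) = 0"
    from arg_cong[OF this, of "\<lambda>f. fps_nth f 0"] show False by simp
  qed
  ultimately show "fps_deriv (4 * Y ^ 2) = fps_deriv W * (4 * Y ^ 2)" by (metis mult_left_cancel)
  show "fps_nth (fps_exp 1 oo W) 0 = fps_nth (4 * Y ^ 2) 0"
    by (simp add: power2_eq_square fps_mult_nth hypergeometric_coeff_def numeral_fps_const F_def D_def S_def Y_def)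
qed

lemma u_Suc: "(real n + 1) * u (Suc n) = (real n - 1 / 2) * u n" if "0 < n"
proof -
  have "fps_deriv (S ^ 2) = fps_deriv (1 - fps_X)" by (simp only: S_square)
  then have "S * fps_deriv S + S * fps_deriv S = -1" by (simp add: power2_eq_square mult.commute)
  then have "S * (S * fps_deriv S + S * fps_deriv S) = - S" by simp
  then have "S ^ 2 * fps_deriv S + S ^ 2 * fps_deriv S = - S"
    by (simp only: power2_eq_square distrib_left mult.assoc)
  then have "(1 - fps_X) * fps_deriv S + (1 - fps_X) * fps_deriv S = - S" by (simp only: S_square)
  then have "fps_nth ((1 - fps_X) * fps_deriv S) n + fps_nth ((1 - fps_X) * fps_deriv S) n = - fps_nth S n"
    by (metis fps_add_nth fps_neg_nth)
  then show ?thesis using that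
    by (cases n) (simp_all add: left_diff_distrib inverse_fps_nth S_def F_def, simp add: algebra_simps)
qed

text \<open>
  By the quadratic equation \<open>x \<cdot> 4 Y\<^sup>2 = 8 Y - 4\<close>, so that \<open>p\<^sub>n = 8 u\<^sub>n\<^sub>+\<^sub>2\<close>, and the recursion of \<open>u\<close> is that of the
  Catalan numbers.
\<close>
theorem p_catalan: "4 ^ n * p n = catalan (Suc n)"
proof -
  have Y_nth: "fps_nth Y n = u (Suc n)" for n
    using arg_cong[OF X_Y, of "\<lambda>f. fps_nth f (Suc n)"] by (simp add: inverse_fps_nth S_def F_def)
  have p_u: "p n = 8 * u (Suc (Suc n))" for n
  proof -
    have "fps_X * (fps_exp 1 oo W) = 4 * (fps_X * Y ^ 2)" unfolding exp_W by (simp only: mult_ac)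
    also have "\<dots> = fps_const 8 * Y - fps_const 4" unfolding X_Y_square by (simp add: numeral_fps_const fps_eq_iff)
    finally have "fps_nth (fps_X * (fps_exp 1 oo W)) (Suc n) = fps_nth (fps_const 8 * Y - fps_const 4) (Suc n)" by simp
    then show ?thesis by (simp add: Y_nth del: fps_mult_nth_0)
  qed
  show ?thesis
  proof (induction n)
    case 0
    then show ?case by (simp add: p_0 catalan_def)
  next
    case (Suc n)
    have "(real (Suc (Suc n)) + 1) * p (Suc n) = (real (Suc (Suc n)) - 1 / 2) * p n"
      unfolding p_u using u_Suc[of "Suc (Suc n)"] by simp
    then have step: "p (Suc n) * (real n + 3) = (real n + 3 / 2) * p n"
      by (simp add: algebra_simps)
    have "4 ^ Suc n * p (Suc n) * (real (Suc n) + 2) = 4 * 4 ^ n * (p (Suc n) * (real n + 3))"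
      by (simp add: algebra_simps)
    also have "\<dots> = 2 * (2 * real (Suc n) + 1) * (4 ^ n * p n)"
      unfolding step by (simp add: algebra_simps)
    finally have "4 ^ Suc n * p (Suc n) * (real (Suc n) + 2) = 2 * (2 * real (Suc n) + 1) * (4 ^ n * p n)" .
    also have "\<dots> = catalan (Suc (Suc n)) * (real (Suc n) + 2)"
      unfolding Suc.IH catalan_Suc ..
    finally show ?case by simp
  qed
qed

end

section \<open>Parameter lists of tuples\<close>

context hypergeometric
begin

lemma p_ratio_from_weight:
  assumes "slow_weight w K" and "0 < \<kappa>" and "(\<lambda>n. p n / w n) \<longlonglongrightarrow> \<kappa>"
  shows "(\<lambda>n. p n / p (Suc n)) \<longlonglongrightarrow> 1"
proof -
  interpret slow_weight w K by fact
  have "(\<lambda>n. (p n / w n) / (p (Suc n) / w (Suc n)) / (w (Suc n) / w n)) \<longlonglongrightarrow> \<kappa> / \<kappa> / 1"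
    using assms(2) by (intro tendsto_divide assms(3) LIMSEQ_Suc[OF assms(3)] w_ratio) auto
  then show ?thesis using assms(2) by simp
qed

end

definition parameters :: "nat list \<Rightarrow> real list" where
  "parameters Ns = concat (map (\<lambda>N. map (\<lambda>r. real r / real N) (sorted_list_of_set (totatives N))) Ns)"

lemma sum_list_totatives:
  fixes f :: "nat \<Rightarrow> 'a :: comm_monoid_add"
  shows "(\<Sum>r\<leftarrow>sorted_list_of_set (totatives N). f r) = (\<Sum>r\<in>totatives N. f r)"
  by (simp add: sum_list_distinct_conv_sum_set)

lemma prod_list_totatives:
  fixes f :: "nat \<Rightarrow> 'a :: comm_monoid_mult"
  shows "(\<Prod>r\<leftarrow>sorted_list_of_set (totatives N). f r) = (\<Prod>r\<in>totatives N. f r)"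
  by (simp add: prod.distinct_set_conv_list[symmetric])

lemma parameters_Nil [simp]: "parameters [] = []"
  by (simp add: parameters_def)

lemma parameters_Cons: "parameters (N # Ns) = map (\<lambda>r. real r / real N) (sorted_list_of_set (totatives N)) @ parameters Ns"
  by (simp add: parameters_def)

lemma length_parameters: "length (parameters Ns) = Phi_tup Ns"
  by (induction Ns) (simp_all add: parameters_Cons Phi_tup_def totient_def)

lemma B_tup_eq: "B_tup Ns m = C_tup Ns ^ m * hypergeometric_coeff (parameters Ns) m"
proof (induction Ns)
  case (Cons N Ns)
  have "hypergeometric_coeff (parameters (N # Ns)) m
      = (\<Prod>r\<in>totatives N. pochhammer (real r / real N) m / fact m) * hypergeometric_coeff (parameters Ns) m"
    unfolding prod_list_totatives[symmetric]
    by (simp add: hypergeometric_coeff_def parameters_Cons o_def)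
  then show ?case using Cons.IH by (simp add: B_tup_def C_tup_def B1_def power_mult_distrib mult_ac)
qed (simp add: B_tup_def C_tup_def hypergeometric_coeff_def)

lemma H_tup_eq: "H_tup Ns m = harmonic_excess (parameters Ns) m"
proof (induction Ns)
  case (Cons N Ns)
  have "harmonic_excess (parameters (N # Ns)) m
      = (\<Sum>r\<in>totatives N. H_sum (real r / real N) m - H_sum 1 m) + harmonic_excess (parameters Ns) m"
    unfolding sum_list_totatives[symmetric]
    by (simp add: harmonic_excess_def parameters_Cons o_def)
  then show ?case using Cons.IH by (simp add: H_tup_def H1_def sum_subtractf totient_def)
qed (simp add: H_tup_def harmonic_excess_def)

lemma C1_pos: "0 < N \<Longrightarrow> 0 < C1 N"
  unfolding C1_def by (intro mult_pos_pos prod_pos) (auto intro!: zero_less_power prime_gt_0_nat)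

lemma C_tup_pos: "\<forall>N\<in>set Ns. 2 \<le> N \<Longrightarrow> 0 < C_tup Ns"
  unfolding C_tup_def by (intro prod_list_map_pos C1_pos) auto

lemma ln_C_tup: "\<forall>N\<in>set Ns. 2 \<le> N \<Longrightarrow> ln (C_tup Ns) = (\<Sum>N\<leftarrow>Ns. ln (C1 N))"
proof (induction Ns)
  case (Cons N Ns)
  have "0 < C1 N" using Cons.prems by (intro C1_pos) auto
  moreover have "0 < C_tup Ns" using Cons.prems by (intro C_tup_pos) auto
  moreover have "C_tup (N # Ns) = C1 N * C_tup Ns" by (simp add: C_tup_def)
  ultimately show ?case using Cons by (simp add: ln_mult)
qed (simp add: C_tup_def)

lemma H_tup_tendsto: "\<forall>N\<in>set Ns. 2 \<le> N \<Longrightarrow> H_tup Ns \<longlonglongrightarrow> ln (C_tup Ns)"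
proof -
  assume N: "\<forall>N\<in>set Ns. 2 \<le> N"
  have "(\<lambda>m. \<Sum>N\<leftarrow>Ns. H1 N m) \<longlonglongrightarrow> (\<Sum>N\<leftarrow>Ns. ln (C1 N))"
    using N by (induction Ns) (auto intro!: tendsto_add H1_tendsto)
  then show ?thesis unfolding ln_C_tup[OF N] by (simp add: H_tup_def[abs_def])
qed

text \<open>
  Average over the involution \<open>r \<mapsto> N - r\<close> of the residues coprime to \<open>N\<close>.
\<close>
lemma sum_totatives: 
  assumes "2 \<le> N"
  shows "(\<Sum>r\<in>totatives N. real r / real N) = real (totient N) / 2"
proof -
  have less: "r < N" if "r \<in> totatives N" for r by (rule totatives_less[OF that]) (use assms in linarith)
  have "(\<Sum>r\<in>totatives N. real r / real N) = (\<Sum>r\<in>totatives N. real (N - r) / real N)"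
  proof (rule sum.reindex_bij_witness[of _ "\<lambda>r. N - r" "\<lambda>r. N - r"])
    fix r assume r: "r \<in> totatives N"
    have "gcd (N - r) N = gcd (N - r) ((N - r) + r)" using less[OF r] by simp
    also have "\<dots> = gcd (N - r) r" by (rule gcd_add2)
    also have "\<dots> = gcd N r" using less[OF r] by (intro gcd_diff1_nat) simp
    also have "\<dots> = 1" using r by (simp add: in_totatives_iff coprime_iff_gcd_eq_1[symmetric] coprime_commute)
    finally have "coprime (N - r) N" by (rule coprime_iff_gcd_eq_1[THEN iffD2])
    then show "N - r \<in> totatives N" using r less[OF r] by (simp add: in_totatives_iff)
    then show "N - r \<in> totatives N" .
    show "N - (N - r) = r" using less[OF r] by simp
    then show "N - (N - r) = r" .
    then show "real (N - (N - r)) / real N = real r / real N" by simp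
  qed
  also have "\<dots> = (\<Sum>r\<in>totatives N. 1 - real r / real N)"
    using assms less by (intro sum.cong) (auto simp: of_nat_diff diff_divide_distrib less_imp_le)
  also have "\<dots> = real (totient N) - (\<Sum>r\<in>totatives N. real r / real N)"
    by (simp add: sum_subtractf totient_def)
  finally show ?thesis by simp
qed

lemma hypergeometric_parameters:
  assumes "Ns \<noteq> []" and N: "\<forall>N\<in>set Ns. 2 \<le> N"
  shows "hypergeometric (parameters Ns) (ln (C_tup Ns))"
proof
  show "parameters Ns \<noteq> []"
  proof -
    obtain N Ns' where "Ns = N # Ns'" using assms(1) by (cases Ns) auto
    moreover have "sorted_list_of_set (totatives N) \<noteq> []" if "2 \<le> N"
      using that by (simp add: sorted_list_of_set_eq_Nil_iff)
    ultimately show ?thesis using N by (simp add: parameters_Cons)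
  qed
  show "0 < a" "a < 1" if a: "a \<in> set (parameters Ns)" for a
  proof -
    obtain N r where Nr: "N \<in> set Ns" "r \<in> totatives N" "a = real r / real N"
      using a by (auto simp: parameters_def)
    have "2 \<le> N" using Nr N by blast
    then have "r < N" "0 < r" using Nr(2) totatives_less[of r N] by (auto simp: in_totatives_iff)
    then show "0 < a" "a < 1" using Nr(3) by simp_all
  qed
  show "sum_list (parameters Ns) = real (length (parameters Ns)) / 2"
    using N
  proof (induction Ns)
    case (Cons N Ns)
    have "sum_list (parameters (N # Ns)) = (\<Sum>r\<in>totatives N. real r / real N) + sum_list (parameters Ns)"
      unfolding sum_list_totatives[symmetric] by (simp add: parameters_Cons)
    also have "(\<Sum>r\<in>totatives N. real r / real N) = real (totient N) / 2"
      using Cons.prems by (intro sum_totatives) auto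
    finally show ?case using Cons by (simp add: length_parameters Phi_tup_def add_divide_distrib)
  qed simp
  show "harmonic_excess (parameters Ns) \<longlonglongrightarrow> ln (C_tup Ns)"
    using H_tup_tendsto[OF N] by (simp add: H_tup_eq[abs_def])
qed

lemma Phi_tup_eq_1_iff:
  assumes "Ns \<noteq> []" and N: "\<forall>N\<in>set Ns. 2 \<le> N"
  shows "Phi_tup Ns = 1 \<longleftrightarrow> Ns = [2]"
proof
  assume *: "Phi_tup Ns = 1"
  obtain N Ns' where Ns: "Ns = N # Ns'" using assms(1) by (cases Ns) auto
  have "0 < totient N" using N Ns by auto
  moreover have "totient N + Phi_tup Ns' = 1" using * by (simp add: Ns Phi_tup_def)
  ultimately have 1: "totient N = 1" "Phi_tup Ns' = 0" by linarith+
  have "N = 2"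
  proof (rule ccontr)
    assume "N \<noteq> 2"
    then have "2 < N" using N Ns by auto
    then have "even (totient N)" by (rule totient_even)
    then show False using 1 by simp
  qed
  moreover have "Ns' = []"
  proof (rule ccontr)
    assume "Ns' \<noteq> []"
    then obtain M Ms where "Ns' = M # Ms" by (cases Ns') auto
    moreover then have "0 < totient M" using N Ns by auto
    ultimately show False using 1(2) by (simp add: Phi_tup_def)
  qed
  ultimately show "Ns = [2]" using Ns by simp
qed (simp add: Phi_tup_def)

lemma parameters_2: "parameters [2] = [1 / 2]"
proof -
  have "{0<..<2::nat} = {1}" by auto
  then have "totatives 2 = {1}" using totatives_prime[OF two_is_prime_nat] by (simp only:)
  then show ?thesis by (simp add: parameters_def)
qed

lemma C_tup_2: "C_tup [2] = 4"
proof -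
  have "prime_factors (2::nat) = {2}" by (simp add: prime_prime_factors)
  then show ?thesis by (simp add: C_tup_def C1_def)
qed

section \<open>The Taylor series of the canonical coordinate\<close>

locale canonical_coordinate =
  fixes Ns :: "nat list"
  assumes Ns_nonempty: "Ns \<noteq> []" and Ns_ge: "\<forall>N\<in>set Ns. 2 \<le> N"
begin

sublocale hypergeometric "parameters Ns" "ln (C_tup Ns)"
  by (rule hypergeometric_parameters[OF Ns_nonempty Ns_ge])

abbreviation C :: real where "C \<equiv> C_tup Ns"

lemma C_pos: "0 < C"
  by (rule C_tup_pos[OF Ns_ge])

lemma p_catalan: "Phi_tup Ns = 1 \<Longrightarrow> 4 ^ n * p n = catalan (Suc n)"
proof -
  assume "Phi_tup Ns = 1"
  then have par: "parameters Ns = [1 / 2]"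
    using Phi_tup_eq_1_iff[OF Ns_nonempty Ns_ge] parameters_2 by simp
  have "catalan_case (ln C)"
    unfolding catalan_case_def using hypergeometric_axioms unfolding par .
  from catalan_case.p_catalan[OF this, of n] show ?thesis unfolding par .
qed

lemma p_ratio: "(\<lambda>n. p n / p (Suc n)) \<longlonglongrightarrow> 1"
proof -
  have "Phi_tup Ns \<noteq> 0"
    using nonempty by (simp flip: length_parameters)
  then consider "Phi_tup Ns = 1" | "Phi_tup Ns = 2" | "3 \<le> Phi_tup Ns" by linarith
  then show ?thesis
  proof cases
    case 1
    have nz: "catalan (Suc n) \<noteq> 0" for n
      by (simp add: catalan_def del: binomial_Suc_Suc mult_Suc_right)
    have "(\<lambda>n. 4 * (catalan (Suc n) / catalan (Suc (Suc n)))) \<longlonglongrightarrow> 1"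
    proof -
      have "catalan (Suc n) / catalan (Suc (Suc n)) = (real n + 3) / (2 * (2 * real n + 3))" for n
        using catalan_Suc[of "Suc n"] nz[of "Suc n"] by (simp add: divide_simps) (simp add: algebra_simps)
      moreover have "(\<lambda>n. 4 * ((real n + 3) / (2 * (2 * real n + 3)))) \<longlonglongrightarrow> 1" by real_asymp
      ultimately show ?thesis by simp
    qed
    moreover have "4 * (catalan (Suc n) / catalan (Suc (Suc n))) = p n / p (Suc n)" for n
      unfolding p_catalan[OF 1, symmetric] by simp
    ultimately show ?thesis by simp
  next
    case 2
    then obtain \<kappa> where \<kappa>: "0 < \<kappa>" "(\<lambda>n. p n / (1 / ((real n + 2) * ln (real n + 2) ^ 2))) \<longlonglongrightarrow> \<kappa>"
      using exp_coefficient_limit_2 by (auto simp: length_parameters)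
    obtain K where "slow_weight (\<lambda>n. 1 / ((real n + 2) * ln (real n + 2) ^ 2)) K" by (rule slow_weight_log)
    then show ?thesis by (rule p_ratio_from_weight[OF _ \<kappa>])
  next
    case 3
    then obtain \<kappa> where \<kappa>: "0 < \<kappa>" "(\<lambda>n. p n / (real n + 1) powr - (real (length (parameters Ns)) / 2)) \<longlonglongrightarrow> \<kappa>"
      using exp_coefficient_limit_ge_3 by (auto simp: length_parameters)
    have "1 < real (length (parameters Ns)) / 2" using 3 by (simp add: length_parameters)
    from p_ratio_from_weight[OF slow_weight_powr[OF this] \<kappa>] show ?thesis .
  qed
qed

text \<open>
  The complex power series of the problem in the unscaled variable \<open>z\<close>; the scaling \<open>x = C z\<close> multiplies
  the \<open>m\<close>-th coefficient by \<open>C\<^sup>m\<close>.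
\<close>
definition Fc :: "complex fps" where "Fc = Abs_fps (\<lambda>m. of_real (B_tup Ns m))"
definition Gc :: "complex fps" where "Gc = Abs_fps (\<lambda>m. of_real (H_tup Ns m * B_tup Ns m))"
definition Wc :: "complex fps" where "Wc = Abs_fps (\<lambda>m. of_real (C ^ m * g m))"
definition Pc :: "complex fps" where "Pc = Abs_fps (\<lambda>m. of_real (C ^ m * p m))"

lemma scaled_conv_radius_pos:
  fixes a :: "nat \<Rightarrow> real"
  assumes "\<And>n. \<bar>a n\<bar> \<le> M"
  shows "0 < fps_conv_radius (Abs_fps (\<lambda>n. complex_of_real (C ^ n * a n)))"
proof -
  have "summable (\<lambda>n. complex_of_real (C ^ n * a n) * of_real (1 / (2 * C)) ^ n)"
  proof (rule summable_comparison_test)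
    show "summable (\<lambda>n. M * (1 / 2) ^ n)" by (intro summable_mult summable_geometric) simp
    show "\<exists>N. \<forall>n\<ge>N. norm (complex_of_real (C ^ n * a n) * of_real (1 / (2 * C)) ^ n) \<le> M * (1 / 2) ^ n"
    proof (intro exI allI impI)
      fix n
      have "complex_of_real (C ^ n * a n) * of_real (1 / (2 * C)) ^ n = of_real (a n * (1 / 2) ^ n)"
        using C_pos by (simp add: power_divide power_mult_distrib)
      then have "norm (complex_of_real (C ^ n * a n) * of_real (1 / (2 * C)) ^ n) = \<bar>a n\<bar> * (1 / 2) ^ n"
        by (simp only: norm_of_real abs_mult) simp
      also have "\<dots> \<le> M * (1 / 2) ^ n" by (intro mult_right_mono assms) simp
      finally show "norm (complex_of_real (C ^ n * a n) * of_real (1 / (2 * C)) ^ n) \<le> M * (1 / 2) ^ n" .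
    qed
  qed
  then have "ereal (norm (complex_of_real (1 / (2 * C)))) \<le> fps_conv_radius (Abs_fps (\<lambda>n. complex_of_real (C ^ n * a n)))"
    unfolding fps_conv_radius_def by (intro conv_radius_geI) simp
  moreover have "0 < ereal (norm (complex_of_real (1 / (2 * C))))" using C_pos by simp
  ultimately show ?thesis by (rule less_le_trans[rotated])
qed

lemma Fc_eq: "Fc = Abs_fps (\<lambda>m. of_real (C ^ m * hypergeometric_coeff (parameters Ns) m))"
  by (simp add: Fc_def B_tup_eq)

lemma Gc_eq: "Gc = Abs_fps (\<lambda>m. of_real (C ^ m * (harmonic_excess (parameters Ns) m * hypergeometric_coeff (parameters Ns) m)))"
  by (simp add: Gc_def B_tup_eq H_tup_eq mult_ac)

lemma F_tup_expansion: "F_tup Ns has_fps_expansion Fc"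
proof -
  have "0 < fps_conv_radius Fc" unfolding Fc_eq
    by (rule scaled_conv_radius_pos[of _ 1]) (simp only: abs_of_pos[OF b_pos] b_le_1)
  then have "eval_fps Fc has_fps_expansion Fc" by (rule eval_fps_has_fps_expansion)
  moreover have "eval_fps Fc = F_tup Ns" by (rule ext) (simp add: eval_fps_def F_tup_def Fc_def)
  ultimately show ?thesis by simp
qed

lemma G_tup_expansion: "G_tup Ns has_fps_expansion Gc"
proof -
  have bound: "\<bar>harmonic_excess (parameters Ns) n * hypergeometric_coeff (parameters Ns) n\<bar> \<le> ln C * 1" for n
    unfolding abs_mult using h_nonneg[of n] h_le_L[of n] b_le_1[of n] b_pos[of n] L_pos
    by (intro mult_mono) auto
  have rad: "0 < fps_conv_radius Gc" unfolding Gc_eq by (rule scaled_conv_radius_pos[OF bound])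
  have "eventually (\<lambda>z. z \<in> eball 0 (fps_conv_radius Gc)) (nhds (0 :: complex))"
    using rad by (intro eventually_nhds_in_open) (auto simp: zero_ereal_def)
  then have "eventually (\<lambda>z. eval_fps Gc z = G_tup Ns z) (nhds 0)"
  proof eventually_elim
    case (elim z)
    then have "summable (\<lambda>m. fps_nth Gc m * z ^ m)" by (intro summable_fps) simp
    from suminf_split_head[OF this] have "G_tup Ns z = eval_fps Gc z - fps_nth Gc 0 * z ^ 0"
      by (simp add: eval_fps_def G_tup_def Gc_def)
    then show ?case by (simp add: Gc_eq h_0)
  qed
  then show ?thesis using rad by (simp add: has_fps_expansion_def)
qed

lemma Wc_quotient: "Gc / Fc = Wc"
proof -
  have "Wc * Fc = Gc"
  proof (rule fps_ext)
    fix n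
    have "fps_nth (Wc * Fc) n = (\<Sum>k\<le>n. of_real (C ^ n * (g k * hypergeometric_coeff (parameters Ns) (n - k))))"
      unfolding fps_mult_nth atLeast0AtMost
    proof (rule sum.cong)
      fix k assume "k \<in> {..n}"
      then have "C ^ n = C ^ k * C ^ (n - k)" by (simp flip: power_add)
      then show "fps_nth Wc k * fps_nth Fc (n - k)
          = of_real (C ^ n * (g k * hypergeometric_coeff (parameters Ns) (n - k)))"
        by (simp add: Wc_def Fc_eq mult_ac)
    qed simp
    also have "\<dots> = of_real (C ^ n * (harmonic_excess (parameters Ns) n * hypergeometric_coeff (parameters Ns) n))"
      unfolding sum_g_b[symmetric] by (simp add: sum_distrib_left)
    finally show "fps_nth (Wc * Fc) n = fps_nth Gc n" by (simp add: Gc_eq)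
  qed
  moreover have "fps_nth Fc 0 \<noteq> 0" by (simp add: Fc_eq b_0)
  then have "Fc \<noteq> 0" by auto
  ultimately show ?thesis by (metis nonzero_mult_div_cancel_right)
qed

text \<open>
  Scaling and passing to complex coefficients commute with \<open>exp\<close>, since both sides solve
  \<open>P' = W\<^sub>c' P\<close> with the same constant term.
\<close>
lemma exp_Wc: "fps_exp 1 oo Wc = Pc"
proof (rule log_derivative_unique)
  have Wc0: "fps_nth Wc 0 = 0" by (simp add: Wc_def g_0)
  show "fps_deriv (fps_exp 1 oo Wc) = fps_deriv Wc * (fps_exp 1 oo Wc)"
    by (simp add: fps_compose_deriv[OF Wc0] mult.commute)
  show "fps_nth (fps_exp 1 oo Wc) 0 = fps_nth Pc 0" by (simp add: Pc_def p_0)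
  show "fps_deriv Pc = fps_deriv Wc * Pc"
  proof (rule fps_ext)
    fix n
    have "fps_deriv (fps_exp 1 oo W) = fps_deriv W * (fps_exp 1 oo W)"
      by (simp add: fps_compose_deriv[OF g_0] mult.commute)
    then have "fps_nth (fps_deriv (fps_exp 1 oo W)) n = fps_nth (fps_deriv W * (fps_exp 1 oo W)) n" by (rule arg_cong)
    then have rec: "real (n + 1) * p (n + 1) = (\<Sum>k\<le>n. real (k + 1) * g (k + 1) * p (n - k))"
      unfolding fps_deriv_nth fps_mult_nth atLeast0AtMost .
    have "fps_nth (fps_deriv Wc * Pc) n = (\<Sum>k\<le>n. of_real (C ^ (n + 1) * (real (k + 1) * g (k + 1) * p (n - k))))"
      unfolding fps_mult_nth atLeast0AtMost
    proof (rule sum.cong)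
      fix k assume "k \<in> {..n}"
      then have C: "C ^ (n + 1) = C ^ (k + 1) * C ^ (n - k)" unfolding power_add[symmetric] by simp
      have "fps_nth (fps_deriv Wc) k = of_real (real (k + 1) * (C ^ (k + 1) * g (k + 1)))"
        by (simp add: Wc_def)
      moreover have "fps_nth Pc (n - k) = of_real (C ^ (n - k) * p (n - k))" by (simp add: Pc_def)
      ultimately show "fps_nth (fps_deriv Wc) k * fps_nth Pc (n - k)
          = of_real (C ^ (n + 1) * (real (k + 1) * g (k + 1) * p (n - k)))"
        unfolding C by (simp only: of_real_mult mult_ac)
    qed simp
    also have "\<dots> = of_real (C ^ (n + 1) * (real (n + 1) * p (n + 1)))"
      unfolding rec by (simp add: sum_distrib_left)
    also have "\<dots> = fps_nth (fps_deriv Pc) n" by (simp add: Pc_def)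
    finally show "fps_nth (fps_deriv Pc) n = fps_nth (fps_deriv Wc * Pc) n" ..
  qed
qed

definition q :: "nat \<Rightarrow> real" where
  "q m = (case m of 0 \<Rightarrow> 0 | Suc n \<Rightarrow> C ^ n * p n)"

text \<open>
  The factor \<open>z\<close> in \<open>z exp (G / F)\<close> shifts the coefficients by one.
\<close>
theorem q_taylor_eq: "q_taylor Ns = Abs_fps (\<lambda>m. complex_of_real (q m))"
proof -
  have "fps_nth Fc 0 \<noteq> 0" by (simp add: Fc_eq b_0)
  from has_fps_expansion_divide'[OF G_tup_expansion F_tup_expansion this]
  have W: "(\<lambda>z. G_tup Ns z / F_tup Ns z) has_fps_expansion Wc" by (simp only: Wc_quotient)
  have "(exp \<circ> (\<lambda>z. G_tup Ns z / F_tup Ns z)) has_fps_expansion Pc"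
    using has_fps_expansion_compose[OF has_fps_expansion_exp1 W] unfolding exp_Wc by (simp add: Wc_def g_0)
  from has_fps_expansion_mult[OF has_fps_expansion_fps_X this]
  have "q_germ Ns has_fps_expansion fps_X * Pc" by (simp add: q_germ_def[abs_def] o_def)
  then have "q_taylor Ns = fps_X * Pc" unfolding q_taylor_def by (rule fps_expansion_eqI)
  also have "\<dots> = Abs_fps (\<lambda>m. complex_of_real (q m))"
  proof (rule fps_ext)
    fix n show "fps_nth (fps_X * Pc) n = fps_nth (Abs_fps (\<lambda>m. complex_of_real (q m))) n"
      by (cases n) (simp_all add: q_def Pc_def)
  qed
  finally show ?thesis .
qed

lemma q_nonneg: "0 \<le> q m"
  using C_pos p_nonneg by (cases m) (simp_all add: q_def)

lemma q_ratio: "(\<lambda>m. q m / q (Suc m)) \<longlonglongrightarrow> 1 / C"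
proof -
  have "(\<lambda>n. (1 / C) * (p n / p (Suc n))) \<longlonglongrightarrow> 1 / C * 1" by (intro tendsto_intros p_ratio)
  moreover have "(1 / C) * (p n / p (Suc n)) = q (Suc n) / q (Suc (Suc n))" for n
    using C_pos by (simp add: q_def)
  ultimately have "(\<lambda>n. q (Suc n) / q (Suc (Suc n))) \<longlonglongrightarrow> 1 / C" by simp
  then show ?thesis by (rule LIMSEQ_imp_Suc)
qed

lemma conv_radius_q: "fps_conv_radius (q_taylor Ns) = ereal (1 / C)"
  unfolding fps_conv_radius_def q_taylor_eq
  by (rule conv_radius_ratio_limit_nonzero[OF refl])
    (use C_pos q_ratio q_nonneg in \<open>simp_all add: abs_of_nonneg\<close>)

lemma boundary_terms:
  assumes "norm z \<le> 1 / C"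
  shows "norm (fps_nth (q_taylor Ns) m * z ^ m) \<le> q m * (1 / C) ^ m"
proof -
  have "norm (fps_nth (q_taylor Ns) m * z ^ m) = q m * norm z ^ m"
    by (simp add: q_taylor_eq norm_mult norm_power q_nonneg)
  also have "\<dots> \<le> q m * (1 / C) ^ m"
    using assms by (intro mult_left_mono power_mono q_nonneg) auto
  finally show ?thesis .
qed

text \<open>
  At \<open>|z| = 1 / C\<close> the terms are \<open>p\<^sub>n / C\<close>, and \<open>\<Sum> p\<^sub>n \<le> exp (ln C)\<close>.
\<close>
lemma boundary_sum_le: "(\<Sum>m\<le>n. q m * (1 / C) ^ m) \<le> 1"
proof (cases n)
  case (Suc k)
  have "(\<Sum>m\<le>n. q m * (1 / C) ^ m) = q 0 * (1 / C) ^ 0 + (\<Sum>m\<le>k. q (Suc m) * (1 / C) ^ Suc m)"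
    unfolding Suc by (rule sum.atMost_Suc_shift)
  also have "q (Suc m) * (1 / C) ^ Suc m = p m / C" for m
    using C_pos by (simp add: q_def power_divide)
  then have "q 0 * (1 / C) ^ 0 + (\<Sum>m\<le>k. q (Suc m) * (1 / C) ^ Suc m) = (\<Sum>m\<le>k. p m) / C"
    by (simp only: sum_divide_distrib) (simp add: q_def)
  also have "\<dots> \<le> exp (ln C) / C" using C_pos by (intro divide_right_mono sum_p_le) auto
  also have "\<dots> = 1" using C_pos by simp
  finally show ?thesis .
qed (simp add: q_def)

lemma boundary_summable: "summable (\<lambda>m. q m * (1 / C) ^ m)"
proof (rule bounded_imp_summable[of _ 1])
  show "0 \<le> q m * (1 / C) ^ m" for m using C_pos q_nonneg[of m] by simp
qed (rule boundary_sum_le)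

lemma summable_closed_disc:
  assumes "norm z \<le> 1 / C"
  shows "summable (\<lambda>m. fps_nth (q_taylor Ns) m * z ^ m)"
  by (rule summable_comparison_test[OF _ boundary_summable]) (use boundary_terms[OF assms] in blast)

lemma norm_q_val_le_1:
  assumes "norm z \<le> 1 / C"
  shows "norm (q_val Ns z) \<le> 1"
proof -
  have "norm (q_val Ns z) \<le> (\<Sum>m. q m * (1 / C) ^ m)"
    unfolding q_val_def eval_fps_def
    by (rule norm_suminf_le[OF boundary_terms[OF assms] boundary_summable])
  also have "\<dots> \<le> 1"
    by (rule suminf_le_const[OF boundary_summable])
      (use boundary_sum_le in \<open>metis lessThan_Suc_atMost bot_nat_0.extremum_uniqueI lessThan_0 sum.empty zero_le_one not0_implies_Suc\<close>)
  finally show ?thesis .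
qed

lemma singularity: "has_boundary_singularity (q_val Ns) (1 / C) (of_real (1 / C))"
proof -
  have "q_val Ns = eval_fps (Abs_fps (\<lambda>m. complex_of_real (q m)))"
    by (rule ext) (simp add: q_val_def q_taylor_eq)
  moreover have "has_boundary_singularity (eval_fps (Abs_fps (\<lambda>m. complex_of_real (q m)))) (1 / C) (of_real (1 / C))"
    by (rule Pringsheim) (use q_nonneg C_pos conv_radius_q in \<open>simp_all add: q_taylor_eq\<close>)
  ultimately show ?thesis by simp
qed

lemma q_asymp_equivI:
  assumes "(\<lambda>n. q (Suc n) / f (Suc n)) \<longlonglongrightarrow> 1"
  shows "fps_nth (q_taylor Ns) \<sim>[sequentially] (\<lambda>m. complex_of_real (f m))"
proof (rule asymp_equivI')
  have "(\<lambda>m. q m / f m) \<longlonglongrightarrow> 1" using assms by (rule LIMSEQ_imp_Suc)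
  then have "(\<lambda>m. complex_of_real (q m / f m)) \<longlonglongrightarrow> of_real 1" by (rule tendsto_of_real)
  then show "(\<lambda>m. fps_nth (q_taylor Ns) m / complex_of_real (f m)) \<longlonglongrightarrow> 1"
    by (simp add: q_taylor_eq)
qed

lemma q_eq_catalan:
  assumes "Phi_tup Ns = 1" "1 \<le> m"
  shows "q m = catalan m"
proof -
  have "C = 4" using assms(1) Phi_tup_eq_1_iff[OF Ns_nonempty Ns_ge] C_tup_2 by simp
  then show ?thesis using assms p_catalan[OF assms(1)] by (cases m) (simp_all add: q_def)
qed

lemma case_1_coefficients:
  assumes "Phi_tup Ns = 1" "1 \<le> m"
  shows "fps_nth (q_taylor Ns) m = 1 / of_nat (m + 1) * of_nat ((2 * m) choose m)"
proof -
  have "fps_nth (q_taylor Ns) m = complex_of_real (catalan m)"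
    using q_eq_catalan[OF assms] by (simp add: q_taylor_eq)
  also have "\<dots> = 1 / of_nat (m + 1) * of_nat ((2 * m) choose m)"
    by (simp add: catalan_def add.commute)
  finally show ?thesis .
qed

lemma case_1_asymp:
  assumes "Phi_tup Ns = 1"
  shows "fps_nth (q_taylor Ns) \<sim>[sequentially] (\<lambda>m. of_real (4 ^ m / (sqrt pi * real m powr (3 / 2))))"
proof (rule q_asymp_equivI)
  have "q (Suc n) = catalan (Suc n)" for n by (rule q_eq_catalan[OF assms]) simp
  then show "(\<lambda>n. q (Suc n) / (4 ^ Suc n / (sqrt pi * real (Suc n) powr (3 / 2)))) \<longlonglongrightarrow> 1"
    using LIMSEQ_Suc[OF catalan_asymp] by (simp only:)
qed

lemma case_2_asymp:
  assumes "Phi_tup Ns = 2"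
  obtains \<kappa> :: real where "\<kappa> \<noteq> 0"
    "fps_nth (q_taylor Ns) \<sim>[sequentially] (\<lambda>m. of_real (\<kappa> * (C ^ m / (real m * (ln (real m))\<^sup>2))))"
proof -
  obtain \<kappa> where \<kappa>: "0 < \<kappa>" "(\<lambda>n. p n / (1 / ((real n + 2) * ln (real n + 2) ^ 2))) \<longlonglongrightarrow> \<kappa>"
    using exp_coefficient_limit_2 assms unfolding length_parameters by blast
  have "fps_nth (q_taylor Ns) \<sim>[sequentially] (\<lambda>m. of_real (\<kappa> / C * (C ^ m / (real m * (ln (real m))\<^sup>2))))"
  proof (rule q_asymp_equivI)
    have ratio: "(\<lambda>n. real (Suc n) * ln (real (Suc n)) ^ 2 / ((real n + 2) * ln (real n + 2) ^ 2)) \<longlonglongrightarrow> 1"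
      by real_asymp
    have "\<kappa> \<noteq> 0" using \<kappa>(1) by simp
    have "(\<lambda>n. p n / (1 / ((real n + 2) * ln (real n + 2) ^ 2)) / \<kappa>
        * (real (Suc n) * ln (real (Suc n)) ^ 2 / ((real n + 2) * ln (real n + 2) ^ 2))) \<longlonglongrightarrow> \<kappa> / \<kappa> * 1"
      by (rule tendsto_mult[OF tendsto_divide[OF \<kappa>(2) tendsto_const \<open>\<kappa> \<noteq> 0\<close>] ratio])
    moreover have "p n / (1 / ((real n + 2) * ln (real n + 2) ^ 2)) / \<kappa>
        * (real (Suc n) * ln (real (Suc n)) ^ 2 / ((real n + 2) * ln (real n + 2) ^ 2))
        = q (Suc n) / (\<kappa> / C * (C ^ Suc n / (real (Suc n) * (ln (real (Suc n)))\<^sup>2)))" for n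
    proof -
      have nz: "x / (1 / y) / \<kappa> * (z / y) = x * z / \<kappa>" if "y \<noteq> 0" for x y z :: real
        using that by simp
      have C: "C ^ n * x / (\<kappa> / C * (C ^ Suc n / z)) = x * z / \<kappa>" for x z
        using C_pos by (simp add: divide_simps)
      have y: "(real n + 2) * ln (real n + 2) ^ 2 \<noteq> 0" by simp
      show ?thesis unfolding nz[OF y] q_def nat.case C by (simp only: mult_ac)
    qed
    ultimately show "(\<lambda>n. q (Suc n) / (\<kappa> / C * (C ^ Suc n / (real (Suc n) * (ln (real (Suc n)))\<^sup>2)))) \<longlonglongrightarrow> 1"
      by (simp only: divide_self[OF \<open>\<kappa> \<noteq> 0\<close>] mult_1_right)
  qed
  then show ?thesis using \<kappa>(1) C_pos by (intro that[of "\<kappa> / C"]) simp_all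
qed

lemma case_ge_3_asymp:
  assumes "3 \<le> Phi_tup Ns"
  obtains \<kappa> :: real where "\<kappa> \<noteq> 0"
    "fps_nth (q_taylor Ns) \<sim>[sequentially] (\<lambda>m. of_real (\<kappa> * (C ^ m / real m powr (real (Phi_tup Ns) / 2))))"
proof -
  define s where "s = real (Phi_tup Ns) / 2"
  obtain \<kappa> where \<kappa>: "0 < \<kappa>" "(\<lambda>n. p n / (real n + 1) powr - s) \<longlonglongrightarrow> \<kappa>"
    using exp_coefficient_limit_ge_3 assms unfolding length_parameters s_def by blast
  have "fps_nth (q_taylor Ns) \<sim>[sequentially] (\<lambda>m. of_real (\<kappa> / C * (C ^ m / real m powr s)))"
  proof (rule q_asymp_equivI)
    have "\<kappa> \<noteq> 0" using \<kappa>(1) by simp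
    have "(\<lambda>n. p n / (real n + 1) powr - s / \<kappa>) \<longlonglongrightarrow> \<kappa> / \<kappa>"
      by (rule tendsto_divide[OF \<kappa>(2) tendsto_const \<open>\<kappa> \<noteq> 0\<close>])
    moreover have "p n / (real n + 1) powr - s / \<kappa> = q (Suc n) / (\<kappa> / C * (C ^ Suc n / real (Suc n) powr s))" for n
    proof -
      have *: "\<kappa> / C * (C ^ Suc n / x) = \<kappa> * C ^ n / x" for x using C_pos by simp
      show ?thesis unfolding * using C_pos by (simp add: q_def powr_minus_divide add.commute)
    qed
    ultimately show "(\<lambda>n. q (Suc n) / (\<kappa> / C * (C ^ Suc n / real (Suc n) powr s))) \<longlonglongrightarrow> 1"
      by (simp only: divide_self[OF \<open>\<kappa> \<noteq> 0\<close>])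
  qed
  then show ?thesis using \<kappa>(1) C_pos unfolding s_def by (intro that[of "\<kappa> / C"]) simp_all
qed

end

theorem theorem1p2:
  fixes Ns :: "nat list"
  assumes "length Ns \<ge> 1" and "\<forall>N\<in>set Ns. N \<ge> 2"
  shows
    "\<comment> \<open>(i)\<close>
     (fps_conv_radius (q_taylor Ns) = ereal (1 / C_tup Ns) \<and>
      (\<forall>z::complex. norm z = 1 / C_tup Ns \<longrightarrow> summable (\<lambda>m. fps_nth (q_taylor Ns) m * z ^ m))) \<and>
     \<comment> \<open>(ii)\<close>
     (has_boundary_singularity (q_val Ns) (1 / C_tup Ns) (of_real (1 / C_tup Ns))) \<and>
     \<comment> \<open>(iii)\<close>
     (\<forall>z::complex. norm z \<le> 1 / C_tup Ns \<longrightarrow> norm (q_val Ns z) \<le> 1) \<and>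
     \<comment> \<open>(iv)\<close>
     ((Phi_tup Ns = 1 \<longleftrightarrow> Ns = [2]) \<and>
      (Phi_tup Ns = 1 \<longrightarrow>
        (\<forall>m\<ge>1. fps_nth (q_taylor Ns) m = 1 / of_nat (m + 1) * of_nat ((2 * m) choose m)) \<and>
        fps_nth (q_taylor Ns) \<sim>[sequentially]
          (\<lambda>m. of_real (4 ^ m / (sqrt pi * real m powr (3 / 2)))))) \<and>
     \<comment> \<open>(v)\<close>
     (Phi_tup Ns = 2 \<longrightarrow>
        (\<exists>\<kappa>::real. \<kappa> \<noteq> 0 \<and>
          fps_nth (q_taylor Ns) \<sim>[sequentially]
            (\<lambda>m. of_real (\<kappa> * (C_tup Ns ^ m / (real m * (ln (real m))\<^sup>2)))))) \<and>
     \<comment> \<open>(vi)\<close>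
     (Phi_tup Ns \<ge> 3 \<longrightarrow>
        (\<exists>\<kappa>::real. \<kappa> \<noteq> 0 \<and>
          fps_nth (q_taylor Ns) \<sim>[sequentially]
            (\<lambda>m. of_real (\<kappa> * (C_tup Ns ^ m / real m powr (real (Phi_tup Ns) / 2))))))"
proof -
  interpret canonical_coordinate Ns
    by unfold_locales (use assms in auto)
  show ?thesis
  proof (intro conjI allI impI)
    show "Phi_tup Ns = 1 \<longleftrightarrow> Ns = [2]" by (rule Phi_tup_eq_1_iff[OF Ns_nonempty Ns_ge])
    show "\<exists>\<kappa>::real. \<kappa> \<noteq> 0 \<and> fps_nth (q_taylor Ns) \<sim>[sequentially]
        (\<lambda>m. of_real (\<kappa> * (C_tup Ns ^ m / (real m * (ln (real m))\<^sup>2))))" if "Phi_tup Ns = 2"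
      using case_2_asymp[OF that] by metis
    show "\<exists>\<kappa>::real. \<kappa> \<noteq> 0 \<and> fps_nth (q_taylor Ns) \<sim>[sequentially]
        (\<lambda>m. of_real (\<kappa> * (C_tup Ns ^ m / real m powr (real (Phi_tup Ns) / 2))))" if "3 \<le> Phi_tup Ns"
      using case_ge_3_asymp[OF that] by metis
  qed (use conv_radius_q summable_closed_disc singularity norm_q_val_le_1 case_1_coefficients case_1_asymp in auto)
qed

end
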